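(* Let $(M, F=\alpha^2/\beta)$ be a Kropina space of dimension $n\ge 2$, where $\alpha^2=a_{ij}(x)y^iy^j$, $\beta=b_i(x)y^i$ and the matrix $(a_{ij})$ is positive definite, and the covector field $(b_i)$ is nowhere zero. Define a function $\kappa$ on $M$ by $e^{\kappa(x)}b^2=4$, where $b^2=a^{ij}b_ib_j$, and define a Riemannian metric $h=\sqrt{h_{ij}(x)y^iy^j}$ and a vector field $W=W^i(\partial/\partial x^i)$ on $M$ by $$h_{ij}=e^{\kappa(x)}a_{ij},\qquad 2W_i=e^{\kappa(x)}b_i,\qquad W_i=h_{ij}W^j,$$ so that $W$ has constant length $|W|=1$ with respect to $h$. Let $K$ be a real constant. Then the Kropina space $(M,\alpha^2/\beta)$ is of constant curvature $K$ if and only if the following two conditions hold: (1) $W_{i||j}+W_{j||i}=0$, that is, $W$ is a Killing vector field of $(M,h)$; (2) the Riemannian space $(M,h)$ is of constant curvature $K$.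
   Context: A Kropina space $(M,\alpha^2/\beta)$ is a smooth manifold $M$ with the Finsler fundamental function $F(x,y)=\alpha^2/\beta$, where $\alpha=\sqrt{a_{ij}(x)y^iy^j}$ comes from a Riemannian metric and $\beta=b_i(x)y^i$ from a 1-form; $F$ is considered on tangent vectors $y$ with $\beta(y)>0$. Here $(a^{ij})=(a_{ij})^{-1}$, and $_{||j}$ denotes the covariant derivative with respect to the Levi-Civita connection of $(M,h)$. Let $G^i(x,y)$ be the spray coefficients of $F$, normalized so that the geodesics parametrized with constant $F$-speed satisfy $\ddot x^i+2G^i(x,\dot x)=0$ (for a Riemannian metric, $2G^i=\gamma^i_{jk}y^jy^k$ with $\gamma^i_{jk}$ the Christoffel symbols). Put $G^i{}_j=\partial G^i/\partial y^j$, $G_j{}^i{}_k=\partial G^i{}_j/\partial y^k$ and $$R_0{}^i{}_{0l}=2\frac{\partial G^i}{\partial x^l}-y^k\frac{\partial G^i{}_l}{\partial x^k}+2G^rG_r{}^i{}_l-G^i{}_rG^r{}_l .$$ (This is $y^jy^kR_j{}^i{}_{kl}$, with $R_j{}^i{}_{kl}$ the $h$-curvature tensor of the Cartan connection.) The Finsler space $(M,F)$ is of constant curvature $K$ if $K$ is constant and $R_0{}^i{}_{0l}=KF^2(\delta^i{}_l-l^il_l)$ holds for all $(x,y)$ in the domain of $F$, where $l^i=y^i/F$ and $l_l=\partial F/\partial y^l$. For the Riemannian space $(M,h)$, constant curvature $K$ means constant sectional curvature $K$. *)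

theory Defs
  imports "HOL-Analysis.Analysis"
begin

section \<open>Partial derivatives and smooth functions on open subsets of \<open>\<real>\<^sup>n\<close>\<close>

definition pd :: "'n::finite \<Rightarrow> (real^'n \<Rightarrow> real) \<Rightarrow> real^'n \<Rightarrow> real"
  where "pd i f x = deriv (\<lambda>t. f (x + t *\<^sub>R axis i 1)) 0"

text \<open>The class \<open>C\<^sup>k\<close>; only meaningful for open \<open>S\<close>.\<close>

primrec Ck_on :: "nat \<Rightarrow> (real^'n::finite) set \<Rightarrow> (real^'n \<Rightarrow> real) \<Rightarrow> bool"
  where
    "Ck_on 0 S f \<longleftrightarrow> continuous_on S f"
  | "Ck_on (Suc k) S f \<longleftrightarrow> (\<forall>x\<in>S. f differentiable (at x)) \<and> (\<forall>i. Ck_on k S (pd i f))"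

definition smooth_fun_on :: "(real^'n::finite) set \<Rightarrow> (real^'n \<Rightarrow> real) \<Rightarrow> bool"
  where "smooth_fun_on S f \<longleftrightarrow> (\<forall>k. Ck_on k S f)"


section \<open>Smooth manifolds and tensor fields\<close>

text \<open>A chart is a pair of its domain and its coordinate map; the values of the coordinate
  map outside the domain are irrelevant.\<close>

type_synonym ('m, 'n) chart = "'m set \<times> ('m \<Rightarrow> real^'n)"

abbreviation chart_dom :: "('m, 'n::finite) chart \<Rightarrow> 'm set"
  where "chart_dom c \<equiv> fst c"

abbreviation coord :: "('m, 'n::finite) chart \<Rightarrow> 'm \<Rightarrow> real^'n"
  where "coord c \<equiv> snd c"

definition chart_img :: "('m, 'n::finite) chart \<Rightarrow> (real^'n) set"
  where "chart_img c = coord c ` chart_dom c"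

definition overlap :: "('m, 'n::finite) chart \<Rightarrow> ('m, 'n) chart \<Rightarrow> (real^'n) set"
  where "overlap c d = coord c ` (chart_dom c \<inter> chart_dom d)"

definition transition :: "('m, 'n::finite) chart \<Rightarrow> ('m, 'n) chart \<Rightarrow> real^'n \<Rightarrow> real^'n"
  where "transition c d = coord d \<circ> inv_into (chart_dom c) (coord c)"

text \<open>The entry in row \<open>k\<close> and column \<open>i\<close> is \<open>\<partial>x\<^sub>d\<^sup>k / \<partial>x\<^sub>c\<^sup>i\<close>.\<close>

definition transition_jacobian ::
    "('m, 'n::finite) chart \<Rightarrow> ('m, 'n) chart \<Rightarrow> real^'n \<Rightarrow> real^'n^'n"
  where "transition_jacobian c d x = (\<chi> k i. pd i (\<lambda>z. transition c d z $ k) x)"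

text \<open>\<open>A\<close> is an arbitrary (not necessarily maximal) smooth atlas of the space \<open>X\<close>.\<close>

definition smooth_manifold :: "'m topology \<Rightarrow> ('m, 'n::finite) chart set \<Rightarrow> bool"
  where "smooth_manifold X A \<longleftrightarrow>
    Hausdorff_space X \<and> second_countable X \<and>
    (\<Union>c\<in>A. chart_dom c) = topspace X \<and>
    (\<forall>c\<in>A. openin X (chart_dom c) \<and> open (chart_img c) \<and>
       homeomorphic_map (subtopology X (chart_dom c))
         (top_of_set (chart_img c)) (coord c)) \<and>
    (\<forall>c\<in>A. \<forall>d\<in>A. \<forall>k. smooth_fun_on (overlap c d) (\<lambda>x. transition c d x $ k))"

text \<open>A tensor field on the manifold is given by its components in every chart of the atlas,
  as functions of the coordinates, subject to the transformation law of its type.\<close>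

definition riemannian_metric ::
    "('m, 'n::finite) chart set \<Rightarrow> (('m, 'n) chart \<Rightarrow> real^'n \<Rightarrow> real^'n^'n) \<Rightarrow> bool"
  where "riemannian_metric A g \<longleftrightarrow>
    (\<forall>c\<in>A. \<forall>i j. smooth_fun_on (chart_img c) (\<lambda>x. g c x $ i $ j)) \<and>
    (\<forall>c\<in>A. \<forall>x\<in>chart_img c. transpose (g c x) = g c x \<and>
       (\<forall>y. y \<noteq> 0 \<longrightarrow> y \<bullet> (g c x *v y) > 0)) \<and>
    (\<forall>c\<in>A. \<forall>d\<in>A. \<forall>x\<in>overlap c d.
       g c x = transpose (transition_jacobian c d x) ** g d (transition c d x)
                 ** transition_jacobian c d x)"

definition covector_field ::
    "('m, 'n::finite) chart set \<Rightarrow> (('m, 'n) chart \<Rightarrow> real^'n \<Rightarrow> real^'n) \<Rightarrow> bool"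
  where "covector_field A b \<longleftrightarrow>
    (\<forall>c\<in>A. \<forall>i. smooth_fun_on (chart_img c) (\<lambda>x. b c x $ i)) \<and>
    (\<forall>c\<in>A. \<forall>d\<in>A. \<forall>x\<in>overlap c d.
       b c x = transpose (transition_jacobian c d x) *v b d (transition c d x))"


section \<open>Finsler geometry in a coordinate domain\<close>

text \<open>Functions on the tangent bundle are written \<open>f x y\<close>, with \<open>x\<close> the coordinates of the
  point and \<open>y\<close> those of the tangent vector.\<close>

type_synonym 'n tbfun = "real^'n \<Rightarrow> real^'n \<Rightarrow> real"

definition pdx :: "'n::finite \<Rightarrow> 'n tbfun \<Rightarrow> 'n tbfun"
  where "pdx i f x y = pd i (\<lambda>z. f z y) x"

definition pdy :: "'n::finite \<Rightarrow> 'n tbfun \<Rightarrow> 'n tbfun"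
  where "pdy i f x y = pd i (f x) y"

definition fundamental_tensor :: "'n::finite tbfun \<Rightarrow> real^'n \<Rightarrow> real^'n \<Rightarrow> real^'n^'n"
  where "fundamental_tensor F x y =
    (\<chi> i j. (1/2) * pdy i (pdy j (\<lambda>x y. (F x y)\<^sup>2)) x y)"

text \<open>The Euler--Lagrange equations of \<open>F\<^sup>2/2\<close>, whose solutions are the geodesics of constant
  \<open>F\<close>-speed, solved for the second derivatives in the form \<open>x'' + 2 G(x, x') = 0\<close>.\<close>

definition spray :: "'n::finite tbfun \<Rightarrow> 'n \<Rightarrow> 'n tbfun"
  where "spray F i x y =
    (1/4) * (\<Sum>l\<in>UNIV. matrix_inv (fundamental_tensor F x y) $ i $ l *
      ((\<Sum>k\<in>UNIV. pdx k (pdy l (\<lambda>x y. (F x y)\<^sup>2)) x y * y $ k)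
        - pdx l (\<lambda>x y. (F x y)\<^sup>2) x y))"

text \<open>\<open>spray1 F i j\<close> is \<open>G\<^sup>i\<^sub>j\<close>, \<open>spray2 F j i k\<close> is \<open>G\<^sub>j\<^sup>i\<^sub>k\<close> and \<open>finsler_curv F i l\<close> is
  \<open>R\<^sub>0\<^sup>i\<^sub>0\<^sub>l\<close>.\<close>

definition spray1 :: "'n::finite tbfun \<Rightarrow> 'n \<Rightarrow> 'n \<Rightarrow> 'n tbfun"
  where "spray1 F i j = pdy j (spray F i)"

definition spray2 :: "'n::finite tbfun \<Rightarrow> 'n \<Rightarrow> 'n \<Rightarrow> 'n \<Rightarrow> 'n tbfun"
  where "spray2 F j i k = pdy k (spray1 F i j)"

definition finsler_curv :: "'n::finite tbfun \<Rightarrow> 'n \<Rightarrow> 'n \<Rightarrow> 'n tbfun"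
  where "finsler_curv F i l x y =
    2 * pdx l (spray F i) x y
    - (\<Sum>k\<in>UNIV. y $ k * pdx k (spray1 F i l) x y)
    + 2 * (\<Sum>r\<in>UNIV. spray F r x y * spray2 F r i l x y)
    - (\<Sum>r\<in>UNIV. spray1 F i r x y * spray1 F r l x y)"

text \<open>\<open>D c\<close> is the domain of the Finsler function in the chart \<open>c\<close>.\<close>

definition finsler_constant_curvature ::
    "('m, 'n::finite) chart set \<Rightarrow> (('m, 'n) chart \<Rightarrow> ((real^'n) \<times> (real^'n)) set) \<Rightarrow>
      (('m, 'n) chart \<Rightarrow> 'n tbfun) \<Rightarrow> real \<Rightarrow> bool"
  where "finsler_constant_curvature A D F K \<longleftrightarrow>
    (\<forall>c\<in>A. \<forall>(x, y)\<in>D c. \<forall>i l.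
       finsler_curv (F c) i l x y =
         K * (F c x y)\<^sup>2 * ((if i = l then 1 else 0) - (y $ i / F c x y) * pdy l (F c) x y))"


section \<open>Riemannian geometry in a coordinate domain\<close>

text \<open>\<open>christoffel h k i j\<close> is \<open>\<gamma>\<^sup>k\<^sub>i\<^sub>j\<close>.\<close>

definition christoffel ::
    "(real^'n::finite \<Rightarrow> real^'n^'n) \<Rightarrow> 'n \<Rightarrow> 'n \<Rightarrow> 'n \<Rightarrow> real^'n \<Rightarrow> real"
  where "christoffel h k i j x =
    (1/2) * (\<Sum>l\<in>UNIV. matrix_inv (h x) $ k $ l *
      (pd i (\<lambda>z. h z $ l $ j) x + pd j (\<lambda>z. h z $ l $ i) x - pd l (\<lambda>z. h z $ i $ j) x))"

text \<open>\<open>covd h w i j\<close> is the covariant derivative \<open>w\<^sub>i\<^sub>|\<^sub>|\<^sub>j\<close> of the covector field \<open>w\<close>.\<close>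

definition covd ::
    "(real^'n::finite \<Rightarrow> real^'n^'n) \<Rightarrow> (real^'n \<Rightarrow> real^'n) \<Rightarrow> 'n \<Rightarrow> 'n \<Rightarrow> real^'n \<Rightarrow> real"
  where "covd h w i j x =
    pd j (\<lambda>z. w z $ i) x - (\<Sum>k\<in>UNIV. christoffel h k i j x * w x $ k)"

definition lower_index ::
    "(real^'n::finite \<Rightarrow> real^'n^'n) \<Rightarrow> (real^'n \<Rightarrow> real^'n) \<Rightarrow> real^'n \<Rightarrow> real^'n"
  where "lower_index h W x = h x *v W x"

definition killing_field ::
    "('m, 'n::finite) chart set \<Rightarrow> (('m, 'n) chart \<Rightarrow> real^'n \<Rightarrow> real^'n^'n) \<Rightarrow>
      (('m, 'n) chart \<Rightarrow> real^'n \<Rightarrow> real^'n) \<Rightarrow> bool"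
  where "killing_field A h W \<longleftrightarrow>
    (\<forall>c\<in>A. \<forall>x\<in>chart_img c. \<forall>i j.
       covd (h c) (lower_index (h c) (W c)) i j x
         + covd (h c) (lower_index (h c) (W c)) j i x = 0)"

text \<open>\<open>riem h l k i j\<close> is the coefficient of \<open>\<partial>\<^sub>l\<close> in \<open>R(\<partial>\<^sub>i, \<partial>\<^sub>j) \<partial>\<^sub>k\<close>, where
  \<open>R(u, v) = [\<nabla>\<^sub>u, \<nabla>\<^sub>v] - \<nabla>\<^bsub>[u, v]\<^esub>\<close>.\<close>

definition riem ::
    "(real^'n::finite \<Rightarrow> real^'n^'n) \<Rightarrow> 'n \<Rightarrow> 'n \<Rightarrow> 'n \<Rightarrow> 'n \<Rightarrow> real^'n \<Rightarrow> real"
  where "riem h l k i j x =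
    pd i (christoffel h l j k) x - pd j (christoffel h l i k) x
    + (\<Sum>m\<in>UNIV. christoffel h l i m x * christoffel h m j k x
                  - christoffel h l j m x * christoffel h m i k x)"

text \<open>\<open>\<langle>R(u, v) v, u\<rangle> / (|u|\<^sup>2 |v|\<^sup>2 - \<langle>u, v\<rangle>\<^sup>2)\<close>, which is positive for round spheres.\<close>

definition sectional_curvature ::
    "(real^'n::finite \<Rightarrow> real^'n^'n) \<Rightarrow> real^'n \<Rightarrow> real^'n \<Rightarrow> real^'n \<Rightarrow> real"
  where "sectional_curvature h x u v =
    (\<Sum>s\<in>UNIV. \<Sum>l\<in>UNIV. \<Sum>k\<in>UNIV. \<Sum>i\<in>UNIV. \<Sum>j\<in>UNIV.
       h x $ s $ l * riem h l k i j x * u $ i * v $ j * v $ k * u $ s)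
    / ((u \<bullet> (h x *v u)) * (v \<bullet> (h x *v v)) - (u \<bullet> (h x *v v))\<^sup>2)"

definition riemannian_constant_curvature ::
    "('m, 'n::finite) chart set \<Rightarrow> (('m, 'n) chart \<Rightarrow> real^'n \<Rightarrow> real^'n^'n) \<Rightarrow> real \<Rightarrow> bool"
  where "riemannian_constant_curvature A h K \<longleftrightarrow>
    (\<forall>c\<in>A. \<forall>x\<in>chart_img c. \<forall>u v. u \<noteq> v \<and> independent {u, v} \<longrightarrow>
       sectional_curvature (h c) x u v = K)"


section \<open>Kropina spaces\<close>

definition kropina_alpha :: "(real^'n::finite \<Rightarrow> real^'n^'n) \<Rightarrow> 'n tbfun"
  where "kropina_alpha a x y = sqrt (\<Sum>i\<in>UNIV. \<Sum>j\<in>UNIV. a x $ i $ j * y $ i * y $ j)"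

definition kropina_beta :: "(real^'n::finite \<Rightarrow> real^'n) \<Rightarrow> 'n tbfun"
  where "kropina_beta b x y = (\<Sum>i\<in>UNIV. b x $ i * y $ i)"

definition kropina_F ::
    "(real^'n::finite \<Rightarrow> real^'n^'n) \<Rightarrow> (real^'n \<Rightarrow> real^'n) \<Rightarrow> 'n tbfun"
  where "kropina_F a b x y = (kropina_alpha a x y)\<^sup>2 / kropina_beta b x y"

definition kropina_domain ::
    "('m, 'n::finite) chart \<Rightarrow> (real^'n \<Rightarrow> real^'n) \<Rightarrow> ((real^'n) \<times> (real^'n)) set"
  where "kropina_domain c b = {(x, y). x \<in> chart_img c \<and> kropina_beta b x y > 0}"

definition kropina_space ::
    "'m topology \<Rightarrow> ('m, 'n::finite) chart set \<Rightarrow> (('m, 'n) chart \<Rightarrow> real^'n \<Rightarrow> real^'n^'n) \<Rightarrow>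
      (('m, 'n) chart \<Rightarrow> real^'n \<Rightarrow> real^'n) \<Rightarrow> bool"
  where "kropina_space X A a b \<longleftrightarrow>
    smooth_manifold X A \<and> riemannian_metric A a \<and> covector_field A b \<and>
    (\<forall>c\<in>A. \<forall>x\<in>chart_img c. b c x \<noteq> 0)"

definition kropina_constant_curvature ::
    "('m, 'n::finite) chart set \<Rightarrow> (('m, 'n) chart \<Rightarrow> real^'n \<Rightarrow> real^'n^'n) \<Rightarrow>
      (('m, 'n) chart \<Rightarrow> real^'n \<Rightarrow> real^'n) \<Rightarrow> real \<Rightarrow> bool"
  where "kropina_constant_curvature A a b K \<longleftrightarrow>
    finsler_constant_curvature A (\<lambda>c. kropina_domain c (b c)) (\<lambda>c. kropina_F (a c) (b c)) K"

definition covector_norm_sq :: "real^'n^'n::finite \<Rightarrow> real^'n \<Rightarrow> real"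
  where "covector_norm_sq g w = (\<Sum>i\<in>UNIV. \<Sum>j\<in>UNIV. matrix_inv g $ i $ j * w $ i * w $ j)"

end

(*
  On the tangent bundle F = |y|^2 / (2 W(y)), with |.| the norm of h, so e^kappa enters only through h and W.
  Writing S and R for the skew and the symmetric part of the covariant derivative of W, and s^i = S^i_j y^j,
  the Euler-Lagrange equations give the spray of F as
    2 G^i = Gamma^i_00 - (R_00 / F + 2 W(s)) (y^i - F W^i) - 2 F s^i.

  Constant curvature forces R = 0.  Split G = E + P y, where P = - R_00 W(y) / |y|^2 and E has only powers
  of W(y) in its denominators.  Contracted with a covector that annihilates y, the curvature equation times
  |y|^4 reads 3 (R_00 W(y))^2 + |y|^2 (...) = 0.  Along the line y = W + t v, with v a unit vector
  orthogonal to W, W(y) = 1 and |y|^2 = 1 + t^2, so this is an identity of polynomials in t: 1 + t^2 divides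
  R_00^2, whereas R_00 = a t + b t^2 because R(W, W) = 0.  Hence a = b = 0.

  If W is Killing, the curvature of F is that of h plus explicit terms in S and its covariant derivative.
  Letting W(y) tend to 0, the two leading orders of the equation determine first S S and then the covariant
  derivative of S; what remains of the equation is the constant curvature of h.  Conversely, for Killing W
  and h of constant curvature, S S and the derivative of S have these values.
*)
theory Submission
  imports Defs
begin

section \<open>Calculus of smooth functions\<close>

text \<open>The pair \<open>h\<close>, \<open>W\<close> comes from Zermelo navigation:
  \<open>F\<close> solves |y / F - W| = 1 in the norm of \<open>h\<close>, and the constant 4 in the
  definition of \<kappa> is what makes |W| = 1. A wind of full strength confines \<open>F\<close> to
  the half space W(y) > 0, at whose boundary \<open>F\<close> blows up; expanding the curvature
  equation there separates the terms in \<open>S\<close> from the curvature of \<open>h\<close>. The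
  expansion determines only a symmetric part of the covariant derivative of \<open>S\<close>;
  skewness and a cyclic identity restore the rest.

  The obstacle in the first half is the curvature of \<open>E\<close>, which contains second
  derivatives of every ingredient. It is never computed. It suffices that it lies in a class of
  functions closed under differentiation whose denominators are powers of W(y), so that it restricts
  to a polynomial on a line where W(y) = 1. Divisibility by 1 + t^2 then stands for evaluation at a
  complex vector y that is isotropic for \<open>h\<close> but has W(y) = 1.\<close>

lemma line_tendsto: "((\<lambda>t. x + t *\<^sub>R (v::real^'n)) \<longlongrightarrow> x) (nhds 0)"
proof -
  have "isCont (\<lambda>t. x + t *\<^sub>R v) 0" by (intro continuous_intros)
  then have "((\<lambda>t. x + t *\<^sub>R v) \<longlongrightarrow> x) (at 0)" by (simp add: isCont_def)
  then show ?thesis by (simp add: tendsto_nhds_iff)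
qed

lemma eventually_line_in_open:
  assumes "open S" "x \<in> S"
  shows "\<forall>\<^sub>F t in nhds 0. x + t *\<^sub>R (v::real^'n) \<in> S"
  using topological_tendstoD[OF line_tendsto assms] .

lemma pd_cong_open:
  assumes "open S" "x \<in> S" "\<And>z. z \<in> S \<Longrightarrow> f z = g z"
  shows "pd i f x = pd i g x"
proof -
  have "\<forall>\<^sub>F t in nhds 0. f (x + t *\<^sub>R axis i 1) = g (x + t *\<^sub>R axis i 1)"
    using eventually_line_in_open[OF assms(1,2), of "axis i 1"]
    by (rule eventually_mono) (rule assms(3))
  then show ?thesis unfolding pd_def by (rule deriv_cong_ev) simp
qed

text \<open>\<open>deriv\<close> carries information only where a derivative exists.
  Differentiability at \<open>x\<close> supplies one along every coordinate line, which makes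
  \<open>pd\<close> usable in derivative rules.\<close>

lemma DERIV_pd:
  assumes "f differentiable (at x)"
  shows "((\<lambda>t. f (x + t *\<^sub>R axis i 1)) has_real_derivative pd i f x) (at 0)"
proof -
  obtain f' where f': "(f has_derivative f') (at x)"
    using assms by (auto simp: differentiable_def)
  have g: "((\<lambda>t. x + t *\<^sub>R axis i 1) has_derivative (\<lambda>t. t *\<^sub>R axis i 1)) (at (0::real))"
    by (auto intro!: derivative_eq_intros)
  have "((\<lambda>t. f (x + t *\<^sub>R axis i 1)) has_derivative (\<lambda>t. f' (t *\<^sub>R axis i 1))) (at 0)"
    using has_derivative_compose[OF g, of f f'] f' by simp
  moreover have "(\<lambda>t. f' (t *\<^sub>R axis i 1)) = (*) (f' (axis i 1))"
    using has_derivative_linear[OF f'] by (auto simp: linear_cmul)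
  ultimately have "((\<lambda>t. f (x + t *\<^sub>R axis i 1)) has_real_derivative f' (axis i 1)) (at 0)"
    by (simp add: has_field_derivative_def)
  then show ?thesis unfolding pd_def by (metis DERIV_imp_deriv)
qed

lemma pd_eqI: "((\<lambda>t. f (x + t *\<^sub>R axis i 1)) has_real_derivative d) (at 0) \<Longrightarrow> pd i f x = d"
  unfolding pd_def by (rule DERIV_imp_deriv)

section \<open>Closure properties of C^k and smooth functions\<close>

lemma Ck_on_cong:
  assumes "open S" "\<And>z. z \<in> S \<Longrightarrow> f z = g z"
  shows "Ck_on k S f \<longleftrightarrow> Ck_on k S g"
  using assms(2)
proof (induction k arbitrary: f g)
  case 0
  then show ?case by (auto intro: continuous_on_cong[THEN iffD1])
next
  case (Suc k)
  have *: "f differentiable (at x) \<longleftrightarrow> g differentiable (at x)" if "x \<in> S" for x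
  proof -
    have "(f has_derivative f') (at x) \<longleftrightarrow> (g has_derivative f') (at x)" for f'
      using has_derivative_transform_within_open[OF _ assms(1) that, of f f' _ g]
        has_derivative_transform_within_open[OF _ assms(1) that, of g f' _ f] Suc.prems by auto
    then show ?thesis by (simp add: differentiable_def)
  qed
  have "Ck_on k S (pd i f) \<longleftrightarrow> Ck_on k S (pd i g)" for i
    by (rule Suc.IH) (auto intro: pd_cong_open[OF assms(1)] Suc.prems)
  then show ?case using * by simp
qed

text \<open>The product rule leaves undifferentiated factors, which the inductions below need in the
  class of order \<open>k\<close>.\<close>

lemma Ck_on_SucD: "Ck_on (Suc k) S f \<Longrightarrow> Ck_on k S f"
proof (induction k arbitrary: f)
  case 0
  then show ?case
    by (auto intro!: continuous_at_imp_continuous_on differentiable_imp_continuous_within)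
next
  case (Suc k)
  then show ?case by (metis Ck_on.simps(2))
qed

lemma Ck_on_const: "Ck_on k (S :: (real^'n::finite) set) (\<lambda>x. c)"
proof (induction k arbitrary: c)
  case (Suc k)
  have "pd i (\<lambda>x. c) = (\<lambda>x. 0)" for i :: 'n by (rule ext, rule pd_eqI) simp
  with Suc show ?case by simp
qed simp

lemma Ck_on_add:
  assumes "open S"
  shows "Ck_on k S f \<Longrightarrow> Ck_on k S g \<Longrightarrow> Ck_on k S (\<lambda>x. f x + g x)"
proof (induction k arbitrary: f g)
  case 0
  then show ?case by (auto intro: continuous_intros)
next
  case (Suc k)
  have "pd i (\<lambda>x. f x + g x) x = pd i f x + pd i g x" if "x \<in> S" for x i
    using Suc.prems that by (intro pd_eqI DERIV_add DERIV_pd) auto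
  then have "Ck_on k S (pd i (\<lambda>x. f x + g x)) \<longleftrightarrow> Ck_on k S (\<lambda>x. pd i f x + pd i g x)" for i
    by (intro Ck_on_cong assms) auto
  then show ?case using Suc by auto
qed

lemma Ck_on_mult:
  assumes "open S"
  shows "Ck_on k S f \<Longrightarrow> Ck_on k S g \<Longrightarrow> Ck_on k S (\<lambda>x. f x * g x)"
proof (induction k arbitrary: f g)
  case 0
  then show ?case by (auto intro: continuous_intros)
next
  case (Suc k)
  have "pd i (\<lambda>x. f x * g x) x = f x * pd i g x + pd i f x * g x" if "x \<in> S" for x i
  proof -
    have "((\<lambda>t. f (x + t *\<^sub>R axis i 1)) has_real_derivative pd i f x) (at 0)"
      "((\<lambda>t. g (x + t *\<^sub>R axis i 1)) has_real_derivative pd i g x) (at 0)"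
      using Suc.prems that by (auto intro: DERIV_pd)
    from DERIV_mult'[OF this] show ?thesis by (intro pd_eqI) simp
  qed
  then have "Ck_on k S (pd i (\<lambda>x. f x * g x)) \<longleftrightarrow> Ck_on k S (\<lambda>x. f x * pd i g x + pd i f x * g x)" for i
    by (intro Ck_on_cong assms) auto
  moreover have "Ck_on k S f" "Ck_on k S g" using Suc.prems Ck_on_SucD by auto
  ultimately show ?case using Suc by (auto intro!: Ck_on_add assms)
qed

lemma Ck_on_inverse:
  assumes "open S" "\<And>x. x \<in> S \<Longrightarrow> f x \<noteq> 0"
  shows "Ck_on k S f \<Longrightarrow> Ck_on k S (\<lambda>x. inverse (f x))"
proof (induction k)
  case 0
  then show ?case using assms(2) by (auto intro: continuous_intros)
next
  case (Suc k)
  have "pd i (\<lambda>x. inverse (f x)) x = - 1 * pd i f x * (inverse (f x) * inverse (f x))" if "x \<in> S" for x i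
  proof -
    have "((\<lambda>t. f (x + t *\<^sub>R axis i 1)) has_real_derivative pd i f x) (at 0)"
      using Suc.prems that by (auto intro: DERIV_pd)
    from DERIV_inverse_fun[OF this] that assms show ?thesis by (intro pd_eqI) simp
  qed
  then have "Ck_on k S (pd i (\<lambda>x. inverse (f x))) \<longleftrightarrow>
      Ck_on k S (\<lambda>x. - 1 * pd i f x * (inverse (f x) * inverse (f x)))" for i
    by (intro Ck_on_cong assms) auto
  moreover have "Ck_on k S (\<lambda>x. - 1 * pd i f x * (inverse (f x) * inverse (f x)))" for i
    using Suc Ck_on_SucD[OF Suc.prems] by (intro Ck_on_mult Ck_on_const assms(1)) auto
  ultimately have "Ck_on k S (pd i (\<lambda>x. inverse (f x)))" for i by blast
  then show ?case using Suc.prems assms(2) by (auto intro!: differentiable_inverse)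
qed

lemma smooth_const [simp]: "smooth_fun_on S (\<lambda>x. c)"
  by (simp add: smooth_fun_on_def Ck_on_const)

lemma smooth_add: "open S \<Longrightarrow> smooth_fun_on S f \<Longrightarrow> smooth_fun_on S g \<Longrightarrow> smooth_fun_on S (\<lambda>x. f x + g x)"
  by (simp add: smooth_fun_on_def Ck_on_add)

lemma smooth_mult: "open S \<Longrightarrow> smooth_fun_on S f \<Longrightarrow> smooth_fun_on S g \<Longrightarrow> smooth_fun_on S (\<lambda>x. f x * g x)"
  by (simp add: smooth_fun_on_def Ck_on_mult)

lemma smooth_inverse:
  "open S \<Longrightarrow> (\<And>x. x \<in> S \<Longrightarrow> f x \<noteq> 0) \<Longrightarrow> smooth_fun_on S f \<Longrightarrow> smooth_fun_on S (\<lambda>x. inverse (f x))"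
  by (simp add: smooth_fun_on_def Ck_on_inverse)

lemma smooth_divide:
  "open S \<Longrightarrow> smooth_fun_on S f \<Longrightarrow> smooth_fun_on S g \<Longrightarrow> (\<And>x. x \<in> S \<Longrightarrow> g x \<noteq> 0) \<Longrightarrow>
    smooth_fun_on S (\<lambda>x. f x / g x)"
  by (simp add: divide_inverse smooth_mult smooth_inverse)

lemma smooth_diff: "open S \<Longrightarrow> smooth_fun_on S f \<Longrightarrow> smooth_fun_on S g \<Longrightarrow> smooth_fun_on S (\<lambda>x. f x - g x)"
  using smooth_add[of S f "\<lambda>x. (- 1) * g x"] smooth_mult[of S "\<lambda>x. - 1" g] by simp

lemma smooth_sum:
  "open S \<Longrightarrow> (\<And>i. i \<in> I \<Longrightarrow> smooth_fun_on S (f i)) \<Longrightarrow> smooth_fun_on S (\<lambda>x. \<Sum>i\<in>I. f i x)"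
  by (induction I rule: infinite_finite_induct) (auto intro: smooth_add)

lemma smooth_prod:
  "open S \<Longrightarrow> (\<And>i. i \<in> I \<Longrightarrow> smooth_fun_on S (f i)) \<Longrightarrow> smooth_fun_on S (\<lambda>x. \<Prod>i\<in>I. f i x)"
  by (induction I rule: infinite_finite_induct) (auto intro: smooth_mult)

lemma smooth_cong: "open S \<Longrightarrow> (\<And>z. z \<in> S \<Longrightarrow> f z = g z) \<Longrightarrow> smooth_fun_on S f \<Longrightarrow> smooth_fun_on S g"
  unfolding smooth_fun_on_def using Ck_on_cong by blast

lemma smooth_pd: "smooth_fun_on S f \<Longrightarrow> smooth_fun_on S (pd i f)"
  unfolding smooth_fun_on_def by (metis Ck_on.simps(2))

lemma smooth_differentiable: "smooth_fun_on S f \<Longrightarrow> x \<in> S \<Longrightarrow> f differentiable (at x)"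
  unfolding smooth_fun_on_def by (metis Ck_on.simps(2))

lemma smooth_continuous_on: "smooth_fun_on S f \<Longrightarrow> continuous_on S f"
  unfolding smooth_fun_on_def by (metis Ck_on.simps(1))

lemma smooth_DERIV:
  "smooth_fun_on S f \<Longrightarrow> x \<in> S \<Longrightarrow>
    ((\<lambda>t. f (x + t *\<^sub>R axis i 1)) has_real_derivative pd i f x) (at 0)"
  by (intro DERIV_pd smooth_differentiable)

section \<open>Determinants and inverses of smooth matrix fields\<close>

lemma smooth_det:
  assumes "open S" "\<And>i j. smooth_fun_on S (\<lambda>x. M x $ i $ j)"
  shows "smooth_fun_on S (\<lambda>x. det (M x :: real^'n^'n))"
  unfolding det_def by (intro smooth_sum smooth_mult smooth_prod smooth_const assms)

lemma matrix_inv_mult: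
  assumes "invertible (M::real^'n^'n)"
  shows "M ** matrix_inv M = mat 1" "matrix_inv M ** M = mat 1"
  using someI_ex[of "\<lambda>A'. M ** A' = mat 1 \<and> A' ** M = mat 1"] assms
  by (auto simp: invertible_def matrix_inv_def)

text \<open>By Cramer's rule every entry of the inverse is a quotient of two determinants, so no
  derivative of a matrix inverse has to be computed. Off \<open>S\<close> the quotient and
  \<open>matrix_inv\<close> may differ, hence the detour over \<open>smooth_cong\<close>.\<close>

lemma smooth_matrix_inv:
  assumes "open S" "\<And>i j. smooth_fun_on S (\<lambda>x. M x $ i $ j)"
    and inv: "\<And>x. x \<in> S \<Longrightarrow> invertible (M x :: real^'n^'n)"
  shows "smooth_fun_on S (\<lambda>x. matrix_inv (M x) $ k $ l)"
proof (rule smooth_cong[OF assms(1)])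
  let ?g = "\<lambda>x. det (\<chi> i j. if j = k then axis l 1 $ i else M x $ i $ j) / det (M x)"
  show "smooth_fun_on S ?g"
  proof (intro smooth_divide smooth_det assms(1,2))
    show "smooth_fun_on S (\<lambda>x. (\<chi> i j. if j = k then axis l 1 $ i else M x $ i $ j) $ i $ j)" for i j
      by (cases "j = k") (auto simp: assms)
    show "det (M x) \<noteq> 0" if "x \<in> S" for x
      using inv[OF that] invertible_det_nz by blast
  qed
  fix x assume x: "x \<in> S"
  have "M x *v (matrix_inv (M x) *v axis l 1) = axis l 1"
    by (simp add: matrix_vector_mul_assoc matrix_inv_mult inv x)
  then have "matrix_inv (M x) *v axis l 1 =
      (\<chi> k. det (\<chi> i j. if j = k then axis l 1 $ i else M x $ i $ j) / det (M x))"
    using cramer[of "M x"] inv[OF x] by (simp add: invertible_det_nz)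
  then show "?g x = matrix_inv (M x) $ k $ l"
    by (simp add: matrix_vector_mul_component vec_eq_iff matrix_vector_mult_basis column_def)
qed

text \<open>Both iterated partial derivatives are limits of the same second difference quotient.\<close>

lemma second_difference:
  fixes f :: "real^'n \<Rightarrow> real"
  assumes "open S" "x \<in> S" "smooth_fun_on S f" "e > 0"
  shows "\<exists>d>0. \<forall>s. 0 < s \<and> s < d \<longrightarrow>
    \<bar>(f (x + s *\<^sub>R axis i 1 + s *\<^sub>R axis j 1) - f (x + s *\<^sub>R axis i 1) - f (x + s *\<^sub>R axis j 1) + f x)
      - s * s * pd j (pd i f) x\<bar> \<le> e * (s * s)"
proof -
  let ?g = "pd j (pd i f)"
  have sm: "smooth_fun_on S (pd i f)" "smooth_fun_on S ?g" using assms smooth_pd by blast+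
  have "continuous_on S ?g" using sm smooth_continuous_on by blast
  then have "isCont ?g x" using assms continuous_on_eq_continuous_at by blast
  then obtain d1 where d1: "d1 > 0" "\<And>z. dist z x < d1 \<Longrightarrow> \<bar>?g z - ?g x\<bar> < e"
    unfolding continuous_at_eps_delta using assms(4) by (auto simp: dist_real_def)
  obtain d2 where d2: "d2 > 0" "ball x d2 \<subseteq> S" using assms openE by blast
  \<comment> \<open>Halved because the point moves in two directions at once, by up to
    \<open>a + b\<close>.\<close>
  define d where "d = min d1 d2 / 2"
  have dpos: "d > 0" using d1 d2 by (simp add: d_def)
  have near: "dist (x + a *\<^sub>R axis i 1 + b *\<^sub>R axis j 1) x < min d1 d2"
    if "0 \<le> a" "a < d" "0 \<le> b" "b < d" for a b
  proof -
    have "dist (x + a *\<^sub>R axis i 1 + b *\<^sub>R axis j 1) x = norm (a *\<^sub>R axis i (1::real) + b *\<^sub>R axis j 1)"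
      by (simp add: dist_norm add.assoc)
    also have "\<dots> \<le> a + b" using norm_triangle_ineq[of "a *\<^sub>R axis i (1::real)" "b *\<^sub>R axis j 1"] that by simp
    also have "\<dots> < min d1 d2" using that by (simp add: d_def)
    finally show ?thesis .
  qed
  have inS: "x + a *\<^sub>R axis i 1 + b *\<^sub>R axis j 1 \<in> S" if "0 \<le> a" "a < d" "0 \<le> b" "b < d" for a b
    using near[OF that] d2(2) by (auto simp: dist_commute subset_iff)
  have der: "((\<lambda>a. k (z + a *\<^sub>R axis m 1)) has_real_derivative pd m k (z + a *\<^sub>R axis m 1)) (at a)"
    if "smooth_fun_on S k" "z + a *\<^sub>R axis m 1 \<in> S" for k z m a
  proof -
    have "((\<lambda>t. k ((z + a *\<^sub>R axis m 1) + t *\<^sub>R axis m 1)) has_real_derivative pd m k (z + a *\<^sub>R axis m 1)) (at 0)"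
      using that smooth_DERIV by blast
    then have "((\<lambda>t. k (z + (t + a) *\<^sub>R axis m 1)) has_real_derivative pd m k (z + a *\<^sub>R axis m 1)) (at 0)"
      by (simp add: algebra_simps)
    then show ?thesis using DERIV_shift[of "\<lambda>t. k (z + t *\<^sub>R axis m 1)" _ 0 a] by simp
  qed
  show ?thesis
  proof (intro exI[of _ d] conjI dpos allI impI)
    fix s :: real assume s: "0 < s \<and> s < d"
    \<comment> \<open>\<open>u\<close> is the first difference in direction \<open>j\<close>, and
      \<open>u s - u 0\<close> the second difference. The mean value theorem is applied to
      \<open>u\<close> and then to the resulting difference of values of
      \<open>pd i f\<close>.\<close>
    define u where "u a = f ((x + s *\<^sub>R axis j 1) + a *\<^sub>R axis i 1) - f (x + a *\<^sub>R axis i 1)" for a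
    have "\<exists>z. 0 < z \<and> z < s \<and> u s - u 0 = (s - 0) *
        (pd i f ((x + s *\<^sub>R axis j 1) + z *\<^sub>R axis i 1) - pd i f (x + z *\<^sub>R axis i 1))"
    proof (rule MVT2)
      fix a assume a: "0 \<le> a" "a \<le> s"
      show "(u has_real_derivative pd i f ((x + s *\<^sub>R axis j 1) + a *\<^sub>R axis i 1) - pd i f (x + a *\<^sub>R axis i 1)) (at a)"
        unfolding u_def using inS[of a s] inS[of a 0] a s
        by (intro DERIV_diff der assms(3)) (auto simp: algebra_simps)
    qed (use s in auto)
    then obtain z where z: "0 < z" "z < s" "u s - u 0 = s *
        (pd i f ((x + z *\<^sub>R axis i 1) + s *\<^sub>R axis j 1) - pd i f ((x + z *\<^sub>R axis i 1) + 0 *\<^sub>R axis j 1))"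
      by (auto simp: algebra_simps)
    have "\<exists>y. 0 < y \<and> y < s \<and> pd i f ((x + z *\<^sub>R axis i 1) + s *\<^sub>R axis j 1) - pd i f ((x + z *\<^sub>R axis i 1) + 0 *\<^sub>R axis j 1)
       = (s - 0) * ?g ((x + z *\<^sub>R axis i 1) + y *\<^sub>R axis j 1)"
    proof (rule MVT2)
      fix a assume a: "0 \<le> a" "a \<le> s"
      show "((\<lambda>a. pd i f ((x + z *\<^sub>R axis i 1) + a *\<^sub>R axis j 1)) has_real_derivative ?g ((x + z *\<^sub>R axis i 1) + a *\<^sub>R axis j 1)) (at a)"
        using inS[of z a] a s z by (intro der sm) auto
    qed (use s in auto)
    then obtain y where y: "0 < y" "y < s" "u s - u 0 = s * s * ?g (x + z *\<^sub>R axis i 1 + y *\<^sub>R axis j 1)"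
      using z by auto
    have "\<bar>?g (x + z *\<^sub>R axis i 1 + y *\<^sub>R axis j 1) - ?g x\<bar> \<le> e"
      using d1(2) near[of z y] z y s by (intro less_imp_le d1(2)) auto
    then have "s * s * \<bar>?g (x + z *\<^sub>R axis i 1 + y *\<^sub>R axis j 1) - ?g x\<bar> \<le> e * (s * s)"
      by (metis mult.commute mult_right_mono zero_le_square)
    moreover have "\<bar>(u s - u 0) - s * s * ?g x\<bar> = s * s * \<bar>?g (x + z *\<^sub>R axis i 1 + y *\<^sub>R axis j 1) - ?g x\<bar>"
      unfolding y(3) by (simp add: abs_mult flip: right_diff_distrib)
    moreover have "u s - u 0 = f (x + s *\<^sub>R axis i 1 + s *\<^sub>R axis j 1) - f (x + s *\<^sub>R axis i 1)
        - f (x + s *\<^sub>R axis j 1) + f x"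
      by (simp add: u_def algebra_simps)
    ultimately show "\<bar>(f (x + s *\<^sub>R axis i 1 + s *\<^sub>R axis j 1) - f (x + s *\<^sub>R axis i 1) - f (x + s *\<^sub>R axis j 1) + f x)
      - s * s * ?g x\<bar> \<le> e * (s * s)" by simp
  qed
qed

lemma pd_commute:
  assumes "open S" "x \<in> S" "smooth_fun_on S f"
  shows "pd i (pd j f) x = pd j (pd i f) x"
proof (rule ccontr)
  assume ne: "\<not> ?thesis"
  \<comment> \<open>A third of the gap: the two estimates allow an error of \<open>2 * e\<close> per
    \<open>s * s\<close>, against a gap of \<open>3 * e\<close>.\<close>
  define e where "e = \<bar>pd i (pd j f) x - pd j (pd i f) x\<bar> / 3"
  have e: "e > 0" using ne by (simp add: e_def)
  define \<Delta> where "\<Delta> s = f (x + s *\<^sub>R axis i 1 + s *\<^sub>R axis j 1) - f (x + s *\<^sub>R axis i 1)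
    - f (x + s *\<^sub>R axis j 1) + f x" for s
  obtain d1 where d1: "d1 > 0" "\<And>s. 0 < s \<Longrightarrow> s < d1 \<Longrightarrow> \<bar>\<Delta> s - s * s * pd j (pd i f) x\<bar> \<le> e * (s * s)"
    using second_difference[OF assms e, of i j] unfolding \<Delta>_def by blast
  obtain d2 where d2: "d2 > 0" "\<And>s. 0 < s \<Longrightarrow> s < d2 \<Longrightarrow> \<bar>\<Delta> s - s * s * pd i (pd j f) x\<bar> \<le> e * (s * s)"
    using second_difference[OF assms e, of j i] unfolding \<Delta>_def by (auto simp: algebra_simps)
  define s where "s = min d1 d2 / 2"
  have s: "0 < s" "s < d1" "s < d2" using d1 d2 by (auto simp: s_def)
  have "\<bar>s * s * pd i (pd j f) x - s * s * pd j (pd i f) x\<bar> \<le> 2 * e * (s * s)"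
    using d1(2)[of s] d2(2)[of s] s by linarith
  moreover have "\<bar>s * s * pd i (pd j f) x - s * s * pd j (pd i f) x\<bar> = 3 * e * (s * s)"
    by (simp add: e_def abs_mult flip: right_diff_distrib)
  ultimately show False using e s by simp
qed

section \<open>Riemannian metrics in a coordinate domain\<close>

abbreviation "kron i j \<equiv> (if i = j then 1 else (0::real))"

lemma sum_kron [simp]:
  fixes f :: "'n::finite \<Rightarrow> real"
  shows "(\<Sum>m\<in>UNIV. kron i m * f m) = f i" "(\<Sum>m\<in>UNIV. kron m i * f m) = f i"
    "(\<Sum>m\<in>UNIV. f m * kron i m) = f i" "(\<Sum>m\<in>UNIV. f m * kron m i) = f i"
  by (simp_all add: if_distrib[of "\<lambda>x. x * _"] if_distrib[of "\<lambda>x. _ * x"] cong: if_cong)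

text \<open>Associativity of contraction. It moves a raised or lowered index from one factor to the
  other, and is used in both directions.\<close>

lemma sum_contract_swap:
  fixes f :: "'n::finite \<Rightarrow> real"
  shows "(\<Sum>i\<in>UNIV. f i * (\<Sum>j\<in>UNIV. g i j * e j)) = (\<Sum>j\<in>UNIV. (\<Sum>i\<in>UNIV. f i * g i j) * e j)"
  by (simp add: sum_distrib_left sum_distrib_right mult.assoc) (rule sum.swap)

abbreviation contract :: "('n::finite \<Rightarrow> real) \<Rightarrow> ('n \<Rightarrow> real) \<Rightarrow> real" (infixl "\<odot>" 70)
  where "f \<odot> g \<equiv> \<Sum>i\<in>UNIV. f i * g i"

text \<open>Collects sums, factors and quotients under one summation sign. An identity between
  combinations of contractions is afterwards checked term by term with \<open>sum.cong\<close>, as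
  plain ring algebra.\<close>

lemmas sum_collect = sum_distrib_left sum_distrib_right sum_divide_distrib sum.distrib[symmetric]
  sum_subtractf[symmetric]

section \<open>Inverse metric, Christoffel symbols and curvature tensor\<close>

locale local_metric =
  fixes U :: "(real^'n::finite) set" and h :: "real^'n \<Rightarrow> real^'n^'n"
  assumes openU: "open U"
    and smooth_h: "\<And>i j. smooth_fun_on U (\<lambda>x. h x $ i $ j)"
    and h_sym: "\<And>x i j. x \<in> U \<Longrightarrow> h x $ i $ j = h x $ j $ i"
    and h_pos: "\<And>x y. x \<in> U \<Longrightarrow> y \<noteq> 0 \<Longrightarrow> y \<bullet> (h x *v y) > 0"
begin

abbreviation "H i j x \<equiv> h x $ i $ j"
abbreviation "hi i j x \<equiv> matrix_inv (h x) $ i $ j"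
abbreviation "Gm \<equiv> christoffel h"

lemma h_invertible: assumes "x \<in> U" shows "invertible (h x)"
proof -
  have "h x *v y = 0 \<Longrightarrow> y = 0" for y using h_pos[OF assms, of y] by force
  then show ?thesis using matrix_left_invertible_ker invertible_left_inverse by blast
qed

lemma hi_H: assumes "x \<in> U" shows "(\<Sum>m\<in>UNIV. hi i m x * H m j x) = kron i j"
proof -
  have "(matrix_inv (h x) ** h x) $ i $ j = (mat 1 :: real^'n^'n) $ i $ j"
    using matrix_inv_mult(2)[OF h_invertible[OF assms]] by simp
  then show ?thesis by (simp add: matrix_matrix_mult_def mat_def)
qed

lemma H_hi: assumes "x \<in> U" shows "(\<Sum>m\<in>UNIV. H i m x * hi m j x) = kron i j"
proof -
  have "(h x ** matrix_inv (h x)) $ i $ j = (mat 1 :: real^'n^'n) $ i $ j"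
    using matrix_inv_mult(1)[OF h_invertible[OF assms]] by simp
  then show ?thesis by (simp add: matrix_matrix_mult_def mat_def)
qed

lemma H_hi_cancel: "x \<in> U \<Longrightarrow> (\<Sum>l\<in>UNIV. H i l x * (\<Sum>m\<in>UNIV. hi l m x * f m)) = f i"
  by (simp add: sum_contract_swap H_hi)

lemma hi_H_cancel: "x \<in> U \<Longrightarrow> (\<Sum>l\<in>UNIV. hi i l x * (\<Sum>m\<in>UNIV. H l m x * f m)) = f i"
  by (simp add: sum_contract_swap hi_H)

lemma lower_cancel:
  assumes "x \<in> U" "\<And>i. (\<Sum>l\<in>UNIV. H i l x * f l) = (\<Sum>l\<in>UNIV. H i l x * g l)"
  shows "f i = g i"
  using hi_H_cancel[OF assms(1), of i f] hi_H_cancel[OF assms(1), of i g] assms(2) by simp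

lemma hi_sym: assumes "x \<in> U" shows "hi i j x = hi j i x"
proof -
  have "(\<Sum>m\<in>UNIV. H l m x * hi j m x) = kron j l" for l
    using hi_H[OF assms, of j l] by (simp add: h_sym[OF assms, of l] mult.commute)
  then show ?thesis using hi_H_cancel[OF assms, of i "\<lambda>m. hi j m x"] by simp
qed

lemma smooth_hi: "smooth_fun_on U (hi i j)"
  by (intro smooth_matrix_inv openU smooth_h h_invertible)

lemma smooth_Gm: "smooth_fun_on U (Gm k i j)"
  unfolding christoffel_def
  by (intro smooth_mult smooth_const smooth_sum smooth_hi smooth_add smooth_diff smooth_pd openU smooth_h)

lemma pd_H_sym: "x \<in> U \<Longrightarrow> pd k (H i j) x = pd k (H j i) x"
  by (rule pd_cong_open[OF openU]) (auto simp: h_sym)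

lemma Gm_sym: "x \<in> U \<Longrightarrow> Gm k i j x = Gm k j i x"
  unfolding christoffel_def by (simp add: pd_H_sym[of x _ i j] algebra_simps)

lemma low_Gm: "x \<in> U \<Longrightarrow>
  (\<Sum>m\<in>UNIV. H l m x * Gm m i j x) = (pd i (H l j) x + pd j (H l i) x - pd l (H i j) x) / 2"
  unfolding christoffel_def
  using H_hi_cancel[of x l "\<lambda>l. (pd i (H l j) x + pd j (H l i) x - pd l (H i j) x) / 2"]
  by (simp add: sum_distrib_left sum_divide_distrib[symmetric] mult.assoc)

text \<open>The metric is parallel: in the sum of the two lowered Christoffel symbols four of the
  six derivatives of the metric cancel.\<close>

lemma metric_compat: "x \<in> U \<Longrightarrow>
  pd k (H i j) x = (\<Sum>m\<in>UNIV. H i m x * Gm m k j x) + (\<Sum>m\<in>UNIV. H j m x * Gm m k i x)"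
  using low_Gm[of x i k j] low_Gm[of x j k i] pd_H_sym[of x k i j] pd_H_sym[of x i k j] pd_H_sym[of x j k i]
  by simp

text \<open>\<open>c1 s j k\<close> is the Christoffel symbol \<open>[jk, s]\<close> of the first kind, and \<open>Rm s k i j\<close> is
  \<open>\<langle>R(\<partial>\<^sub>i, \<partial>\<^sub>j) \<partial>\<^sub>k, \<partial>\<^sub>s\<rangle>\<close>.\<close>

definition c1 :: "'n \<Rightarrow> 'n \<Rightarrow> 'n \<Rightarrow> real^'n \<Rightarrow> real"
  where "c1 s j k x = (\<Sum>m\<in>UNIV. H s m x * Gm m j k x)"

definition Rm :: "'n \<Rightarrow> 'n \<Rightarrow> 'n \<Rightarrow> 'n \<Rightarrow> real^'n \<Rightarrow> real"
  where "Rm s k i j x = (\<Sum>l\<in>UNIV. H s l x * riem h l k i j x)"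

lemma pd_c1: assumes "x \<in> U"
  shows "pd i (c1 s j k) x = (\<Sum>m\<in>UNIV. H s m x * pd i (Gm m j k) x) + (\<Sum>m\<in>UNIV. pd i (H s m) x * Gm m j k x)"
  unfolding c1_def sum.distrib[symmetric]
  by (rule pd_eqI)
    (auto intro!: derivative_eq_intros smooth_DERIV[OF smooth_h assms] smooth_DERIV[OF smooth_Gm assms]
      sum.cong simp: algebra_simps)

text \<open>Moving the lowered index under the derivative costs a derivative of the metric. By
  \<open>metric_compat\<close> this splits in two: one part cancels the quadratic terms of
  \<open>riem\<close>, the other leaves quadratic terms of the opposite sign.\<close>

lemma Rm_c1: assumes x: "x \<in> U"
  shows "Rm s k i j x = pd i (c1 s j k) x - pd j (c1 s i k) x
    - (\<Sum>m\<in>UNIV. c1 m i s x * Gm m j k x) + (\<Sum>m\<in>UNIV. c1 m j s x * Gm m i k x)"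
proof -
  have 1: "(\<Sum>l\<in>UNIV. H s l x * (\<Sum>m\<in>UNIV. Gm l i m x * Gm m j k x)) = (\<Sum>m\<in>UNIV. c1 s i m x * Gm m j k x)" for i j
    by (simp add: sum_contract_swap c1_def)
  have 2: "(\<Sum>m\<in>UNIV. pd i (H s m) x * Gm m j k x)
      = (\<Sum>m\<in>UNIV. c1 s i m x * Gm m j k x) + (\<Sum>m\<in>UNIV. c1 m i s x * Gm m j k x)" for i j
    by (simp add: metric_compat[OF x] c1_def[symmetric] sum.distrib distrib_right)
  have "Rm s k i j x = (\<Sum>l\<in>UNIV. H s l x * pd i (Gm l j k) x) - (\<Sum>l\<in>UNIV. H s l x * pd j (Gm l i k) x)
     + ((\<Sum>l\<in>UNIV. H s l x * (\<Sum>m\<in>UNIV. Gm l i m x * Gm m j k x))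
      - (\<Sum>l\<in>UNIV. H s l x * (\<Sum>m\<in>UNIV. Gm l j m x * Gm m i k x)))"
    unfolding Rm_def riem_def
    by (simp add: ring_distribs sum.distrib sum_subtractf)
  then show ?thesis using pd_c1[OF x, of i s j k] pd_c1[OF x, of j s i k] unfolding 1 2 by simp
qed

lemma smooth_c1: "smooth_fun_on U (c1 s j k)"
  unfolding c1_def by (intro smooth_sum smooth_mult openU smooth_h smooth_Gm)

text \<open>The part of \<open>c1 s j k\<close> symmetric in \<open>s\<close> and \<open>k\<close>
  is a derivative of the metric. Hence the derivative terms of the symmetrised tensor form a
  commutator of second partial derivatives, and its quadratic terms cancel in pairs.\<close>

lemma Rm_skew12: assumes x: "x \<in> U" shows "Rm s k i j x = - Rm k s i j x"
proof -
  have 1: "pd i (c1 s j k) x + pd i (c1 k j s) x = pd i (pd j (H s k)) x" for i j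
  proof -
    have "pd i (c1 s j k) x + pd i (c1 k j s) x = pd i (\<lambda>x. c1 s j k x + c1 k j s x) x"
      by (rule sym, rule pd_eqI, rule DERIV_add) (rule smooth_DERIV[OF smooth_c1 x])+
    also have "\<dots> = pd i (pd j (H s k)) x"
      by (rule pd_cong_open[OF openU x]) (simp add: c1_def metric_compat)
    finally show ?thesis .
  qed
  have 2: "(\<Sum>m\<in>UNIV. c1 m i s x * Gm m j k x) = (\<Sum>m\<in>UNIV. c1 m j k x * Gm m i s x)" for i j s k
  proof -
    have "(\<Sum>m\<in>UNIV. c1 m i s x * Gm m j k x) = (\<Sum>m\<in>UNIV. Gm m j k x * (\<Sum>r\<in>UNIV. H m r x * Gm r i s x))"
      by (simp add: c1_def mult.commute)
    also have "\<dots> = (\<Sum>r\<in>UNIV. (\<Sum>m\<in>UNIV. Gm m j k x * H m r x) * Gm r i s x)"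
      by (rule sum_contract_swap)
    also have "\<dots> = (\<Sum>r\<in>UNIV. c1 r j k x * Gm r i s x)"
      by (simp add: c1_def h_sym[OF x] mult.commute)
    finally show ?thesis .
  qed
  show ?thesis
    using 1[of i j] 1[of j i] 2[of i s j k] 2[of j s i k] pd_commute[OF openU x smooth_h, of i j s k]
    by (simp add: Rm_c1[OF x])
qed

lemma riem_skew34: "riem h l k i j x = - riem h l k j i x"
  by (simp add: riem_def sum_subtractf)

lemma Rm_skew34: "Rm s k i j x = - Rm s k j i x"
  using riem_skew34[of _ k i j x] by (simp add: Rm_def sum_negf)

lemma riem_bianchi: assumes x: "x \<in> U"
  shows "riem h l k i j x + riem h l i j k x + riem h l j k i x = 0"
proof -
  have "pd a (Gm l b c) x = pd a (Gm l c b) x" for a b c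
    by (rule pd_cong_open[OF openU x]) (rule Gm_sym)
  then show ?thesis
    by (simp add: riem_def sum_subtractf Gm_sym[OF x, of _ j k] Gm_sym[OF x, of _ i k] Gm_sym[OF x, of _ j i])
qed

lemma Rm_bianchi: assumes x: "x \<in> U"
  shows "Rm s k i j x + Rm s i j k x + Rm s j k i x = 0"
  unfolding Rm_def by (simp add: sum.distrib[symmetric] distrib_left[symmetric] riem_bianchi[OF x])

end

lemma sum2_axis:
  fixes M :: "'n::finite \<Rightarrow> 'n \<Rightarrow> real"
  shows "(\<Sum>i\<in>UNIV. \<Sum>j\<in>UNIV. M i j * (axis p 1 :: real^'n) $ i * (axis q 1 :: real^'n) $ j) = M p q"
proof -
  have "(\<Sum>j\<in>UNIV. M i j * (axis p 1 :: real^'n) $ i * (axis q 1 :: real^'n) $ j) = M i q * kron i p" for i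
    unfolding axis_def by (simp del: mult_cancel_left mult_cancel_right)
  then show ?thesis by simp
qed

lemma sum3_rotate:
  fixes f :: "'n::finite \<Rightarrow> 'n \<Rightarrow> 'n \<Rightarrow> real"
  shows "(\<Sum>i\<in>UNIV. \<Sum>j\<in>UNIV. \<Sum>k\<in>UNIV. f i j k) = (\<Sum>j\<in>UNIV. \<Sum>k\<in>UNIV. \<Sum>i\<in>UNIV. f i j k)"
  by (subst sum.swap, rule sum.cong[OF refl], rule sum.swap)

lemma sum4_rotate:
  fixes f :: "'n::finite \<Rightarrow> 'n \<Rightarrow> 'n \<Rightarrow> 'n \<Rightarrow> real"
  shows "(\<Sum>l\<in>UNIV. \<Sum>k\<in>UNIV. \<Sum>i\<in>UNIV. \<Sum>j\<in>UNIV. f l k i j)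
    = (\<Sum>k\<in>UNIV. \<Sum>i\<in>UNIV. \<Sum>j\<in>UNIV. \<Sum>l\<in>UNIV. f l k i j)"
  by (subst sum.swap, rule sum.cong[OF refl], rule sum3_rotate)

text \<open>Polarisation on two basis vectors and their sum. A quadratic form sees only the
  symmetric part of \<open>M\<close>, hence the shape of the conclusion.\<close>

lemma quadratic_zero_imp:
  fixes M :: "'n::finite \<Rightarrow> 'n \<Rightarrow> real"
  assumes "\<And>y::real^'n. (\<Sum>i\<in>UNIV. \<Sum>j\<in>UNIV. M i j * y $ i * y $ j) = 0"
  shows "M p q + M q p = 0"
proof -
  have "(\<Sum>i\<in>UNIV. \<Sum>j\<in>UNIV. M i j * (axis p 1 + axis q 1 :: real^'n) $ i * (axis p 1 + axis q 1 :: real^'n) $ j)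
     = M p p + M p q + M q p + M q q"
    by (simp add: ring_distribs sum.distrib sum2_axis)
  moreover have "M p p = 0" "M q q = 0"
    using assms[of "axis p 1"] assms[of "axis q 1"] by (simp_all only: sum2_axis)
  ultimately show ?thesis using assms[of "axis p 1 + axis q 1"] by simp
qed

section \<open>Norm, Jacobi operator and sectional curvature\<close>

context local_metric begin

definition low :: "real^'n \<Rightarrow> real^'n \<Rightarrow> 'n \<Rightarrow> real"
  where "low x y i = (\<Sum>j\<in>UNIV. H i j x * y $ j)"

definition g2 :: "real^'n \<Rightarrow> real^'n \<Rightarrow> real^'n \<Rightarrow> real"
  where "g2 x u v = (\<Sum>i\<in>UNIV. u $ i * low x v i)"

lemma g2_inner: "g2 x u v = u \<bullet> (h x *v v)"
  by (simp add: g2_def low_def inner_vec_def matrix_vector_mult_def)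

lemma low_mult: "low x v i = (h x *v v) $ i"
  by (simp add: low_def matrix_vector_mult_def)

lemma g2_bilinear:
  "g2 x (u + u') v = g2 x u v + g2 x u' v" "g2 x u (v + v') = g2 x u v + g2 x u v'"
  "g2 x (c *\<^sub>R u) v = c * g2 x u v" "g2 x u (c *\<^sub>R v) = c * g2 x u v"
  "g2 x (u - u') v = g2 x u v - g2 x u' v" "g2 x u (v - v') = g2 x u v - g2 x u v'"
  by (simp_all add: g2_inner algebra_simps matrix_vector_mult_scaleR)

lemma low_linear:
  "low x (u + v) i = low x u i + low x v i" "low x (c *\<^sub>R u) i = c * low x u i"
  "low x (u - v) i = low x u i - low x v i"
  by (simp_all add: low_mult algebra_simps matrix_vector_mult_scaleR)

lemma g2_sym: "x \<in> U \<Longrightarrow> g2 x u v = g2 x v u"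
  unfolding g2_def low_def by (subst sum_contract_swap) (simp add: h_sym[of x] mult.commute)

lemma g2_pos: "x \<in> U \<Longrightarrow> y \<noteq> 0 \<Longrightarrow> g2 x y y > 0"
  by (simp add: g2_inner h_pos)

text \<open>\<open>Jac s i x v\<close> is \<open>\<langle>R(\<partial>\<^sub>i, v) v, \<partial>\<^sub>s\<rangle>\<close>.\<close>

definition Jac :: "'n \<Rightarrow> 'n \<Rightarrow> real^'n \<Rightarrow> real^'n \<Rightarrow> real"
  where "Jac s i x v = (\<Sum>k\<in>UNIV. \<Sum>j\<in>UNIV. Rm s k i j x * v $ k * v $ j)"

text \<open>The octahedron argument: after the skew symmetries, four Bianchi identities involve six
  components in all, and the first two minus the last two leave twice the difference of the two
  sides.\<close>

lemma Rm_pair: assumes x: "x \<in> U" shows "Rm s k i j x = Rm i j s k x"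
proof -
  note sk = Rm_skew12[OF x] and sk' = Rm_skew34[of _ _ _ _ x]
  have "Rm s k i j x + Rm s i j k x + Rm s j k i x = 0" using Rm_bianchi[OF x] .
  moreover have "Rm s k i j x + Rm j k s i x + Rm k i s j x = 0"
    using Rm_bianchi[OF x, of k i j s] sk'[of k i j s] sk[of k j s i] sk[of k s i j] by linarith
  moreover have "Rm i j s k x + Rm s i j k x + Rm k i s j x = 0"
    using Rm_bianchi[OF x, of i j s k] sk[of i s k j] sk'[of s i k j] sk[of i k j s] sk'[of k i j s] by linarith
  moreover have "Rm i j s k x + Rm j k s i x + Rm s j k i x = 0"
    using Rm_bianchi[OF x, of j s k i] sk[of j s k i] sk'[of j k i s] sk[of j i s k] by linarith
  ultimately show ?thesis by linarith
qed

lemma Jac_sym: assumes x: "x \<in> U" shows "Jac s i x v = Jac i s x v"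
proof -
  have "Jac s i x v = (\<Sum>k\<in>UNIV. \<Sum>j\<in>UNIV. Rm i j s k x * v $ j * v $ k)"
    unfolding Jac_def by (simp add: Rm_pair[OF x, of s _ i _] mult_ac)
  also have "\<dots> = Jac i s x v" unfolding Jac_def by (rule sum.swap)
  finally show ?thesis .
qed

lemma Jac_self: "(\<Sum>i\<in>UNIV. Jac s i x v * v $ i) = 0"
proof -
  have *: "(\<Sum>i\<in>UNIV. \<Sum>j\<in>UNIV. Rm s k i j x * v $ j * v $ i) = 0" for k
  proof -
    have "(\<Sum>i\<in>UNIV. \<Sum>j\<in>UNIV. Rm s k i j x * v $ j * v $ i)
       = - (\<Sum>i\<in>UNIV. \<Sum>j\<in>UNIV. Rm s k j i x * v $ i * v $ j)"
      unfolding sum_negf[symmetric] by (intro sum.cong refl, subst Rm_skew34) simp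
    also have "\<dots> = - (\<Sum>i\<in>UNIV. \<Sum>j\<in>UNIV. Rm s k i j x * v $ j * v $ i)"
      by (subst sum.swap) simp
    finally show ?thesis by simp
  qed
  have "(\<Sum>i\<in>UNIV. Jac s i x v * v $ i) = (\<Sum>k\<in>UNIV. v $ k * (\<Sum>i\<in>UNIV. \<Sum>j\<in>UNIV. Rm s k i j x * v $ j * v $ i))"
    unfolding Jac_def sum_distrib_right sum_distrib_left
    by (subst sum.swap) (simp add: mult_ac)
  then show ?thesis by (simp add: *)
qed

lemma sectional_Jac:
  "sectional_curvature h x u v =
    (\<Sum>s\<in>UNIV. \<Sum>i\<in>UNIV. Jac s i x v * u $ s * u $ i) / (g2 x u u * g2 x v v - (g2 x u v)\<^sup>2)"
proof -
  have "(\<Sum>l\<in>UNIV. \<Sum>k\<in>UNIV. \<Sum>i\<in>UNIV. \<Sum>j\<in>UNIV. h x $ s $ l * riem h l k i j x * u $ i * v $ j * v $ k * u $ s)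
     = (\<Sum>i\<in>UNIV. Jac s i x v * u $ s * u $ i)" for s
  proof -
    have "(\<Sum>l\<in>UNIV. \<Sum>k\<in>UNIV. \<Sum>i\<in>UNIV. \<Sum>j\<in>UNIV. h x $ s $ l * riem h l k i j x * u $ i * v $ j * v $ k * u $ s)
      = (\<Sum>k\<in>UNIV. \<Sum>i\<in>UNIV. \<Sum>j\<in>UNIV. \<Sum>l\<in>UNIV. h x $ s $ l * riem h l k i j x * u $ i * v $ j * v $ k * u $ s)"
      by (rule sum4_rotate)
    also have "\<dots> = (\<Sum>k\<in>UNIV. \<Sum>i\<in>UNIV. \<Sum>j\<in>UNIV. Rm s k i j x * v $ k * v $ j * u $ s * u $ i)"
      unfolding Rm_def sum_distrib_right by (simp add: mult_ac)
    also have "\<dots> = (\<Sum>i\<in>UNIV. \<Sum>k\<in>UNIV. \<Sum>j\<in>UNIV. Rm s k i j x * v $ k * v $ j * u $ s * u $ i)"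
      by (rule sum.swap)
    finally show ?thesis by (simp add: Jac_def sum_distrib_right)
  qed
  then show ?thesis by (simp add: sectional_curvature_def g2_inner)
qed

text \<open>The Gram determinant is \<open>g2 x v v\<close> times the squared norm of the component
  of \<open>u\<close> orthogonal to \<open>v\<close>; \<open>c\<close> is the projection
  coefficient.\<close>

lemma g2_gram_pos:
  assumes x: "x \<in> U" and uv: "u \<noteq> v" "independent {u, v}"
  shows "g2 x u u * g2 x v v - (g2 x u v)\<^sup>2 > 0"
proof -
  have v0: "v \<noteq> 0" and us: "u \<notin> span {v}"
    using uv by (auto simp: independent_insert dependent_zero)
  define c where "c = g2 x u v / g2 x v v"
  have pv: "g2 x v v > 0" using g2_pos[OF x v0] .
  have "u - c *\<^sub>R v \<noteq> 0" using us by (auto simp: span_singleton)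
  then have "0 < g2 x v v * g2 x (u - c *\<^sub>R v) (u - c *\<^sub>R v)" using g2_pos[OF x] pv by simp
  also have "\<dots> = g2 x v v * (g2 x u u - 2 * c * g2 x u v + c * c * g2 x v v)"
    using g2_sym[OF x, of v u] by (simp add: g2_bilinear algebra_simps)
  also have "\<dots> = g2 x u u * g2 x v v - (g2 x u v)\<^sup>2"
    using pv by (simp add: c_def field_simps power2_eq_square)
  finally show ?thesis .
qed

lemma sum2_g2:
  "(\<Sum>s\<in>UNIV. \<Sum>i\<in>UNIV. K * (g2 x v v * H s i x - low x v s * low x v i) * u $ s * u $ i)
    = K * (g2 x u u * g2 x v v - (g2 x u v)\<^sup>2)"
proof -
  have "(\<Sum>s\<in>UNIV. \<Sum>i\<in>UNIV. K * (g2 x v v * H s i x - low x v s * low x v i) * u $ s * u $ i)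
    = K * (g2 x v v * (\<Sum>s\<in>UNIV. u $ s * (\<Sum>i\<in>UNIV. H s i x * u $ i))
        - (\<Sum>s\<in>UNIV. u $ s * low x v s) * (\<Sum>i\<in>UNIV. u $ i * low x v i))"
    by (simp add: sum_distrib_left sum_distrib_right sum_subtractf algebra_simps)
  then show ?thesis by (simp add: low_def[symmetric] g2_def[symmetric] power2_eq_square)
qed

text \<open>Sectional curvature fixes only the quadratic form of the Jacobi operator, but the
  operator is symmetric by \<open>Jac_sym\<close>, so polarisation recovers it. For dependent
  vectors, about which sectional curvature says nothing, both quadratic forms vanish.\<close>

lemma sectional_iff_Jac:
  assumes x: "x \<in> U"
  shows "(\<forall>u v. u \<noteq> v \<and> independent {u, v} \<longrightarrow> sectional_curvature h x u v = K) \<longleftrightarrow>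
    (\<forall>v s i. Jac s i x v = K * (g2 x v v * H s i x - low x v s * low x v i))" (is "?L \<longleftrightarrow> ?R")
proof
  assume R: ?R
  have "sectional_curvature h x u v = K" if "u \<noteq> v" "independent {u, v}" for u v
    using g2_gram_pos[OF x that] by (simp add: sectional_Jac R sum2_g2)
  then show ?L by blast
next
  assume L: ?L
  show ?R
  proof (intro allI)
    fix v s i
    define M where "M s i = Jac s i x v - K * (g2 x v v * H s i x - low x v s * low x v i)" for s i
    have Msum: "(\<Sum>s\<in>UNIV. \<Sum>i\<in>UNIV. M s i * u $ s * u $ i)
       = (\<Sum>s\<in>UNIV. \<Sum>i\<in>UNIV. Jac s i x v * u $ s * u $ i) - K * (g2 x u u * g2 x v v - (g2 x u v)\<^sup>2)" for u
      unfolding M_def sum2_g2[symmetric] by (simp add: sum_subtractf left_diff_distrib)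
    have "(\<Sum>s\<in>UNIV. \<Sum>i\<in>UNIV. M s i * u $ s * u $ i) = 0" for u :: "real^'n"
    proof (cases "u \<noteq> v \<and> independent {u, v}")
      case True
      then have "sectional_curvature h x u v = K" using L by blast
      moreover have "g2 x u u * g2 x v v - (g2 x u v)\<^sup>2 > 0" using g2_gram_pos[OF x] True by blast
      ultimately show ?thesis unfolding Msum sectional_Jac by (simp add: field_simps)
    next
      case False
      \<comment> \<open>For \<open>u = v\<close> the set \<open>{u, v}\<close> is a singleton and
        can be independent; this case goes with the multiples of \<open>v\<close>.\<close>
      then consider (a) c where "u = c *\<^sub>R v" | (b) "v = 0"
        by (cases "v = 0"; cases "u = v") (auto simp: independent_insert span_singleton, metis scaleR_one)
      then show ?thesis
      proof cases
        case a
        have "(\<Sum>s\<in>UNIV. \<Sum>i\<in>UNIV. Jac s i x v * v $ s * v $ i) = (\<Sum>s\<in>UNIV. v $ s * (\<Sum>i\<in>UNIV. Jac s i x v * v $ i))"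
          by (simp add: sum_distrib_left mult_ac)
        then have "(\<Sum>s\<in>UNIV. \<Sum>i\<in>UNIV. Jac s i x v * v $ s * v $ i) = 0" by (simp add: Jac_self)
        then have "c * c * (\<Sum>s\<in>UNIV. \<Sum>i\<in>UNIV. Jac s i x v * v $ s * v $ i) = 0" by simp
        then have "(\<Sum>s\<in>UNIV. \<Sum>i\<in>UNIV. Jac s i x v * u $ s * u $ i) = 0"
          unfolding sum_distrib_left by (simp add: a mult_ac)
        then show ?thesis unfolding Msum using a by (simp add: g2_bilinear power2_eq_square)
      next
        case b
        then show ?thesis by (simp add: M_def Jac_def low_def g2_def)
      qed
    qed
    then have "M s i + M i s = 0" by (rule quadratic_zero_imp)
    moreover have "M s i = M i s" unfolding M_def by (simp add: Jac_sym[OF x, of s i] h_sym[OF x, of s i])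
    ultimately show "Jac s i x v = K * (g2 x v v * H s i x - low x v s * low x v i)"
      by (simp add: M_def)
  qed
qed

text \<open>The difference \<open>D\<close> from the constant curvature tensor has vanishing Jacobi
  operator, hence is skew in \<open>k\<close> and \<open>j\<close>. Being also skew in
  \<open>i\<close> and \<open>j\<close>, it is totally skew in these three indices, and the Bianchi
  identity becomes \<open>3 * D = 0\<close>.\<close>

lemma Jac_imp_Rm:
  assumes x: "x \<in> U" and J: "\<And>v s i. Jac s i x v = K * (g2 x v v * H s i x - low x v s * low x v i)"
  shows "Rm s k i j x = K * (H s i x * H k j x - H s j x * H k i x)"
proof -
  define D where "D s k i j = Rm s k i j x - K * (H s i x * H k j x - H s j x * H k i x)" for s k i j
  have "D s k i j + D s j i k = 0" for s k i j
  proof (rule quadratic_zero_imp)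
    fix v :: "real^'n"
    have 1: "(\<Sum>k\<in>UNIV. H k i x * v $ k) * (\<Sum>j\<in>UNIV. H s j x * v $ j)
      = (\<Sum>k\<in>UNIV. \<Sum>j\<in>UNIV. H s j x * H k i x * v $ k * v $ j)"
      by (simp add: sum_product mult_ac)
    have "(\<Sum>k\<in>UNIV. \<Sum>j\<in>UNIV. (K * (H s i x * H k j x - H s j x * H k i x)) * v $ k * v $ j)
      = K * (H s i x * (\<Sum>k\<in>UNIV. v $ k * (\<Sum>j\<in>UNIV. H k j x * v $ j))
         - (\<Sum>k\<in>UNIV. H k i x * v $ k) * (\<Sum>j\<in>UNIV. H s j x * v $ j))"
      unfolding 1 by (simp add: sum_distrib_left sum_distrib_right sum_subtractf algebra_simps)
    also have "\<dots> = K * (g2 x v v * H s i x - low x v s * low x v i)"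
      by (simp add: g2_def low_def h_sym[OF x, of _ i] mult.commute)
    finally show "(\<Sum>k\<in>UNIV. \<Sum>j\<in>UNIV. D s k i j * v $ k * v $ j) = 0"
      unfolding D_def using J[of s i v] by (simp add: Jac_def sum_subtractf left_diff_distrib)
  qed
  then have "D s k i j = - D s j i k" "D s j k i = - D s i k j" "D s i j k = - D s k j i" by (smt (verit))+
  moreover have "D s k i j = - D s k j i" for s k i j
    using Rm_skew34[of s k i j x] by (simp add: D_def algebra_simps)
  moreover have "D s k i j + D s i j k + D s j k i = 0"
    using Rm_bianchi[OF x, of s k i j]
    by (simp add: D_def algebra_simps h_sym[OF x, of i k] h_sym[OF x, of j k] h_sym[OF x, of j i])
  ultimately have "D s k i j = 0" by (smt (verit))
  then show ?thesis by (simp add: D_def)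
qed

end

section \<open>Unit covector fields\<close>

locale unit_covector = local_metric U h for U :: "(real^'n::finite) set" and h +
  fixes w :: "real^'n \<Rightarrow> real^'n"
  assumes smooth_w: "\<And>i. smooth_fun_on U (\<lambda>x. w x $ i)"
    and w_unit: "\<And>x. x \<in> U \<Longrightarrow> covector_norm_sq (h x) (w x) = 1"
begin

abbreviation "cov i j x \<equiv> covd h w i j x"

text \<open>\<open>Sl\<close> and \<open>Rl\<close> are the skew and the symmetric part of \<open>W\<^sub>i\<^sub>|\<^sub>|\<^sub>j\<close>, \<open>Su i j\<close> is \<open>S\<^sup>i\<^sub>j\<close>, and
  \<open>ddw k j i\<close> is \<open>W\<^sub>k\<^sub>|\<^sub>|\<^sub>j\<^sub>|\<^sub>|\<^sub>i\<close>.\<close>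

definition Wu :: "'n \<Rightarrow> real^'n \<Rightarrow> real"
  where "Wu i x = (\<Sum>m\<in>UNIV. hi i m x * w x $ m)"

definition Sl :: "'n \<Rightarrow> 'n \<Rightarrow> real^'n \<Rightarrow> real"
  where "Sl i j x = (cov i j x - cov j i x) / 2"

definition Rl :: "'n \<Rightarrow> 'n \<Rightarrow> real^'n \<Rightarrow> real"
  where "Rl i j x = (cov i j x + cov j i x) / 2"

definition Su :: "'n \<Rightarrow> 'n \<Rightarrow> real^'n \<Rightarrow> real"
  where "Su i j x = (\<Sum>m\<in>UNIV. hi i m x * Sl m j x)"

definition ddw :: "'n \<Rightarrow> 'n \<Rightarrow> 'n \<Rightarrow> real^'n \<Rightarrow> real"
  where "ddw k j i x = pd i (cov k j) x - (\<Sum>m\<in>UNIV. Gm m k i x * cov m j x)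
    - (\<Sum>m\<in>UNIV. Gm m j i x * cov k m x)"

lemma smooth_cov: "smooth_fun_on U (cov i j)"
  unfolding covd_def by (intro smooth_diff smooth_pd smooth_w smooth_sum smooth_mult openU smooth_Gm)

lemma smooth_Wu: "smooth_fun_on U (Wu i)"
  unfolding Wu_def by (intro smooth_sum smooth_mult openU smooth_hi smooth_w)

lemma smooth_Sl: "smooth_fun_on U (Sl i j)"
  unfolding Sl_def by (intro smooth_divide smooth_diff smooth_cov openU smooth_const) simp

lemma smooth_Rl: "smooth_fun_on U (Rl i j)"
  unfolding Rl_def by (intro smooth_divide smooth_add smooth_cov openU smooth_const) simp

lemma smooth_Su: "smooth_fun_on U (Su i j)"
  unfolding Su_def by (intro smooth_sum smooth_mult openU smooth_hi smooth_Sl)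

lemma H_Wu: "x \<in> U \<Longrightarrow> (\<Sum>m\<in>UNIV. H i m x * Wu m x) = w x $ i"
  unfolding Wu_def by (rule H_hi_cancel)

lemma H_Su: "x \<in> U \<Longrightarrow> (\<Sum>m\<in>UNIV. H i m x * Su m j x) = Sl i j x"
  unfolding Su_def by (rule H_hi_cancel)

lemma w_Wu: "x \<in> U \<Longrightarrow> (\<Sum>i\<in>UNIV. w x $ i * Wu i x) = 1"
  using w_unit[of x] unfolding covector_norm_sq_def Wu_def
  by (simp add: sum_distrib_left mult_ac)

lemma Su_w: assumes "x \<in> U" shows "(\<Sum>i\<in>UNIV. w x $ i * Su i j x) = (\<Sum>i\<in>UNIV. Wu i x * Sl i j x)"
  unfolding Su_def sum_contract_swap by (simp add: Wu_def hi_sym[OF assms] mult.commute)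

text \<open>As the metric is parallel, lowering commutes with covariant differentiation: the
  derivative of the metric turns the connection term of a vector into that of a covector.\<close>

lemma lower_covariant_derivative:
  assumes x: "x \<in> U" and V: "\<And>i. smooth_fun_on U (V i)"
  shows "(\<Sum>s\<in>UNIV. H i s x * (pd k (V s) x + (\<Sum>m\<in>UNIV. Gm s k m x * V m x)))
    = pd k (\<lambda>x. \<Sum>m\<in>UNIV. H i m x * V m x) x - (\<Sum>r\<in>UNIV. Gm r i k x * (\<Sum>m\<in>UNIV. H r m x * V m x))"
proof -
  have 1: "pd k (\<lambda>x. \<Sum>m\<in>UNIV. H i m x * V m x) x
     = (\<Sum>m\<in>UNIV. pd k (H i m) x * V m x) + (\<Sum>m\<in>UNIV. H i m x * pd k (V m) x)"
    unfolding sum.distrib[symmetric]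
    by (rule pd_eqI)
      (auto intro!: derivative_eq_intros smooth_DERIV[OF smooth_h x] smooth_DERIV[OF V x] sum.cong)
  have 2: "(\<Sum>m\<in>UNIV. pd k (H i m) x * V m x)
     = (\<Sum>s\<in>UNIV. H i s x * (\<Sum>m\<in>UNIV. Gm s k m x * V m x))
      + (\<Sum>r\<in>UNIV. Gm r i k x * (\<Sum>m\<in>UNIV. H r m x * V m x))"
    unfolding sum_contract_swap
    by (simp add: metric_compat[OF x] distrib_right distrib_left sum.distrib Gm_sym[OF x, of _ i k] h_sym[OF x] mult.commute)
  show ?thesis unfolding 1 2 by (simp add: distrib_left sum.distrib)
qed

lemma pd_w_Wu:
  assumes x: "x \<in> U"
  shows "(\<Sum>s\<in>UNIV. H i s x * (pd k (Wu s) x + (\<Sum>m\<in>UNIV. Gm s k m x * Wu m x))) = cov i k x"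
proof -
  have "pd k (\<lambda>x. \<Sum>m\<in>UNIV. H i m x * Wu m x) x = pd k (\<lambda>x. w x $ i) x"
    by (rule pd_cong_open[OF openU x]) (rule H_Wu)
  then show ?thesis
    by (simp add: lower_covariant_derivative[OF x smooth_Wu] H_Wu[OF x] covd_def)
qed

lemma DWu:
  assumes x: "x \<in> U"
  shows "pd k (Wu s) x = (\<Sum>m\<in>UNIV. hi s m x * cov m k x) - (\<Sum>m\<in>UNIV. Gm s k m x * Wu m x)"
  using hi_H_cancel[OF x, of s "\<lambda>s. pd k (Wu s) x + (\<Sum>m\<in>UNIV. Gm s k m x * Wu m x)"]
  by (simp add: pd_w_Wu[OF x])

text \<open>Derivative of |W|^2 = 1. The Christoffel terms cancel, and the factors \<open>w\<close>
  and \<open>Wu\<close> contribute equally.\<close>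

lemma Wu_cov: assumes x: "x \<in> U" shows "(\<Sum>i\<in>UNIV. Wu i x * cov i k x) = 0"
proof -
  have "pd k (\<lambda>x. \<Sum>i\<in>UNIV. w x $ i * Wu i x) x = pd k (\<lambda>x. 1) x"
    by (rule pd_cong_open[OF openU x]) (rule w_Wu)
  also have "pd k (\<lambda>x. 1) x = 0" by (rule pd_eqI) simp
  also have "pd k (\<lambda>x. \<Sum>i\<in>UNIV. w x $ i * Wu i x) x
     = (\<Sum>i\<in>UNIV. pd k (\<lambda>x. w x $ i) x * Wu i x) + (\<Sum>i\<in>UNIV. w x $ i * pd k (Wu i) x)"
    unfolding sum.distrib[symmetric]
    by (rule pd_eqI)
      (auto intro!: derivative_eq_intros smooth_DERIV[OF smooth_w x] smooth_DERIV[OF smooth_Wu x] sum.cong)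
  finally have 0: "(\<Sum>i\<in>UNIV. pd k (\<lambda>x. w x $ i) x * Wu i x) + (\<Sum>i\<in>UNIV. w x $ i * pd k (Wu i) x) = 0" .
  have 1: "(\<Sum>i\<in>UNIV. w x $ i * (\<Sum>m\<in>UNIV. hi i m x * cov m k x)) = (\<Sum>i\<in>UNIV. Wu i x * cov i k x)"
    unfolding sum_contract_swap by (simp add: Wu_def hi_sym[OF x] mult.commute)
  have 2: "(\<Sum>i\<in>UNIV. w x $ i * (\<Sum>m\<in>UNIV. Gm i k m x * Wu m x)) = (\<Sum>i\<in>UNIV. Wu i x * (\<Sum>m\<in>UNIV. Gm m i k x * w x $ m))"
    by (subst sum_contract_swap) (simp add: Gm_sym[OF x, of _ k] mult.commute)
  have 3: "(\<Sum>i\<in>UNIV. w x $ i * pd k (Wu i) x)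
     = (\<Sum>i\<in>UNIV. Wu i x * cov i k x) - (\<Sum>i\<in>UNIV. Wu i x * (\<Sum>m\<in>UNIV. Gm m i k x * w x $ m))"
    by (simp add: DWu[OF x] right_diff_distrib sum_subtractf 1 2)
  have 4: "(\<Sum>i\<in>UNIV. pd k (\<lambda>x. w x $ i) x * Wu i x)
     = (\<Sum>i\<in>UNIV. Wu i x * cov i k x) + (\<Sum>i\<in>UNIV. Wu i x * (\<Sum>m\<in>UNIV. Gm m i k x * w x $ m))"
    unfolding covd_def by (simp add: right_diff_distrib sum_subtractf mult.commute)
  show ?thesis using 0 3 4 by simp
qed

text \<open>Second partial derivatives commute, and the terms with one derivative of
  \<open>w\<close> are symmetric in \<open>i\<close> and \<open>j\<close>; the Christoffel terms
  that remain form \<open>riem\<close>.\<close>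

lemma ricci_identity:
  assumes x: "x \<in> U"
  shows "ddw k j i x - ddw k i j x = - (\<Sum>m\<in>UNIV. riem h m k i j x * w x $ m)"
proof -
  have pdc: "pd i (cov k j) x = pd i (pd j (\<lambda>x. w x $ k)) x
      - ((\<Sum>m\<in>UNIV. pd i (Gm m k j) x * w x $ m) + (\<Sum>m\<in>UNIV. Gm m k j x * pd i (\<lambda>x. w x $ m) x))" for i j
    unfolding sum.distrib[symmetric] covd_def
    by (rule pd_eqI)
      (auto intro!: derivative_eq_intros smooth_DERIV[OF smooth_pd[OF smooth_w] x] smooth_DERIV[OF smooth_Gm x]
        smooth_DERIV[OF smooth_w x] sum.cong)
  have pdG: "pd a (Gm l b c) x = pd a (Gm l c b) x" for a b c l
    by (rule pd_cong_open[OF openU x]) (rule Gm_sym)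
  have cd: "(\<Sum>m\<in>UNIV. Gm m k i x * cov m j x) = (\<Sum>m\<in>UNIV. Gm m k i x * pd j (\<lambda>x. w x $ m) x)
      - (\<Sum>r\<in>UNIV. (\<Sum>m\<in>UNIV. Gm r j m x * Gm m i k x) * w x $ r)" for i j
  proof -
    have "(\<Sum>m\<in>UNIV. Gm m k i x * (\<Sum>r\<in>UNIV. Gm r m j x * w x $ r))
       = (\<Sum>r\<in>UNIV. (\<Sum>m\<in>UNIV. Gm r j m x * Gm m i k x) * w x $ r)"
      unfolding sum_contract_swap by (simp add: Gm_sym[OF x, of _ _ j] Gm_sym[OF x, of _ k] mult.commute)
    then show ?thesis unfolding covd_def by (simp add: right_diff_distrib sum_subtractf)
  qed
  have "(\<Sum>m\<in>UNIV. riem h m k i j x * w x $ m)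
    = (\<Sum>m\<in>UNIV. pd i (Gm m k j) x * w x $ m) - (\<Sum>m\<in>UNIV. pd j (Gm m k i) x * w x $ m)
      + (\<Sum>r\<in>UNIV. (\<Sum>m\<in>UNIV. Gm r i m x * Gm m j k x) * w x $ r)
      - (\<Sum>r\<in>UNIV. (\<Sum>m\<in>UNIV. Gm r j m x * Gm m i k x) * w x $ r)"
    unfolding riem_def pdG[of i _ j k] pdG[of j _ i k]
    by (simp add: left_diff_distrib distrib_right sum_subtractf sum.distrib)
  then show ?thesis
    unfolding ddw_def pdc cd
    using pd_commute[OF openU x smooth_w, of i j k] by (simp add: Gm_sym[OF x, of _ j i])
qed

text \<open>The derivative of \<open>W\<^sup>s W\<^sub>s\<^sub>|\<^sub>|\<^sub>l = 0\<close>.\<close>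

lemma Wu_ddw:
  assumes x: "x \<in> U"
  shows "(\<Sum>s\<in>UNIV. Wu s x * ddw s l k x) = - (\<Sum>s\<in>UNIV. (\<Sum>m\<in>UNIV. hi s m x * cov m k x) * cov s l x)"
proof -
  have "pd k (\<lambda>x. \<Sum>i\<in>UNIV. Wu i x * cov i l x) x = pd k (\<lambda>x. 0) x"
    by (rule pd_cong_open[OF openU x]) (rule Wu_cov)
  also have "pd k (\<lambda>x. 0) x = 0" by (rule pd_eqI) simp
  also have "pd k (\<lambda>x. \<Sum>i\<in>UNIV. Wu i x * cov i l x) x
     = (\<Sum>i\<in>UNIV. pd k (Wu i) x * cov i l x) + (\<Sum>i\<in>UNIV. Wu i x * pd k (cov i l) x)"
    unfolding sum.distrib[symmetric]
    by (rule pd_eqI)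
      (auto intro!: derivative_eq_intros smooth_DERIV[OF smooth_cov x] smooth_DERIV[OF smooth_Wu x] sum.cong)
  finally have 0: "(\<Sum>i\<in>UNIV. pd k (Wu i) x * cov i l x) + (\<Sum>i\<in>UNIV. Wu i x * pd k (cov i l) x) = 0" .
  have 1: "(\<Sum>i\<in>UNIV. Wu i x * (\<Sum>m\<in>UNIV. Gm m l k x * cov i m x)) = 0"
  proof -
    have "(\<Sum>i\<in>UNIV. Wu i x * (\<Sum>m\<in>UNIV. Gm m l k x * cov i m x)) = (\<Sum>i\<in>UNIV. Wu i x * (\<Sum>m\<in>UNIV. cov i m x * Gm m l k x))"
      by (simp add: mult.commute)
    then show ?thesis unfolding sum_contract_swap by (simp add: Wu_cov[OF x])
  qed
  have 2: "(\<Sum>i\<in>UNIV. (\<Sum>m\<in>UNIV. Gm i k m x * Wu m x) * cov i l x) = (\<Sum>i\<in>UNIV. Wu i x * (\<Sum>m\<in>UNIV. Gm m i k x * cov m l x))"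
    by (subst sum_contract_swap) (simp add: Gm_sym[OF x, of _ k] mult.commute)
  show ?thesis using 0 unfolding ddw_def DWu[OF x]
    by (simp add: right_diff_distrib left_diff_distrib sum_subtractf 1 2)
qed

section \<open>Second covariant derivatives of Killing fields\<close>

definition killing_at :: "real^'n \<Rightarrow> bool"
  where "killing_at x \<longleftrightarrow> (\<forall>i j. cov i j x + cov j i x = 0)"

lemma Sl_killing: "killing_at x \<Longrightarrow> Sl i j x = cov i j x"
  by (simp add: killing_at_def Sl_def) (metis add.commute add_diff_cancel_left' add_eq_0_iff diff_minus_eq_add field_sum_of_halves mult_2 mult_2_right)

lemma Su_killing: "killing_at x \<Longrightarrow> Su i j x = (\<Sum>m\<in>UNIV. hi i m x * cov m j x)"
  by (simp add: Su_def Sl_killing)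

text \<open>The Killing equation is differentiated here, so it is assumed on all of \<open>U\<close>
  and not only at \<open>x\<close>.\<close>

lemma ddw_skew:
  assumes kill: "\<forall>x\<in>U. killing_at x" and x: "x \<in> U"
  shows "ddw k j i x = - ddw j k i x"
proof -
  have sk: "cov a b z = - cov b a z" if "z \<in> U" for a b z
    using bspec[OF kill that] unfolding killing_at_def by (metis add_eq_0_iff)
  have "pd i (cov k j) x = pd i (\<lambda>z. - cov j k z) x"
    by (rule pd_cong_open[OF openU x]) (rule sk)
  also have "\<dots> = - pd i (cov j k) x" by (rule pd_eqI) (rule DERIV_minus, rule smooth_DERIV[OF smooth_cov x])
  finally show ?thesis
    unfolding ddw_def using sk[OF x, of _ j] sk[OF x, of k] by (simp add: sum_negf)
qed

text \<open>Kostant's formula. The Ricci identities for the three cyclic permutations of the indices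
  are solved for one second derivative by skewness, as Koszul's formula isolates the connection; the
  Bianchi identity merges the curvature terms into one.\<close>

lemma ddw_killing:
  assumes kill: "\<forall>x\<in>U. killing_at x" and x: "x \<in> U"
  shows "ddw k j i x = (\<Sum>m\<in>UNIV. riem h m i j k x * w x $ m)"
proof -
  define \<rho> where "\<rho> k i j = (\<Sum>m\<in>UNIV. riem h m k i j x * w x $ m)" for k i j
  have "\<rho> i j k + \<rho> j k i + \<rho> k i j = 0"
    unfolding \<rho>_def sum.distrib[symmetric] distrib_right[symmetric] by (simp add: riem_bianchi[OF x])
  then show ?thesis
    using ricci_identity[OF x, of k j i] ricci_identity[OF x, of i k j] ricci_identity[OF x, of j i k]
      ddw_skew[OF assms, of k j i] ddw_skew[OF assms, of k i j] ddw_skew[OF assms, of j i k]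
    unfolding \<rho>_def by linarith
qed

lemma low_w_riem:
  assumes x: "x \<in> U"
  shows "(\<Sum>m\<in>UNIV. riem h m i j k x * w x $ m) = (\<Sum>s\<in>UNIV. Wu s x * Rm s i j k x)"
proof -
  have "(\<Sum>s\<in>UNIV. Wu s x * Rm s i j k x) = (\<Sum>m\<in>UNIV. (\<Sum>s\<in>UNIV. Wu s x * H s m x) * riem h m i j k x)"
    unfolding Rm_def by (rule sum_contract_swap)
  also have "\<dots> = (\<Sum>m\<in>UNIV. w x $ m * riem h m i j k x)"
    using H_Wu[OF x] by (simp add: h_sym[OF x, of _] mult.commute)
  finally show ?thesis by (simp add: mult.commute)
qed

text \<open>By Kostant's formula the contraction inserts \<open>W\<close> twice into the first pair
  of \<open>Rm\<close>, which is skew.\<close>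

lemma ddw_killing_W:
  assumes kill: "\<forall>x\<in>U. killing_at x" and x: "x \<in> U"
  shows "(\<Sum>i\<in>UNIV. ddw k j i x * Wu i x) = 0"
proof -
  have "(\<Sum>i\<in>UNIV. ddw k j i x * Wu i x) = (\<Sum>i\<in>UNIV. \<Sum>s\<in>UNIV. Wu i x * Wu s x * Rm s i j k x)"
  proof -
    have "ddw k j i x = (\<Sum>s\<in>UNIV. Wu s x * Rm s i j k x)" for i
      using ddw_killing[OF kill x, of k j i] low_w_riem[OF x] by simp
    then show ?thesis by (simp add: sum_distrib_right sum_distrib_left mult_ac)
  qed
  moreover have "(\<Sum>i\<in>UNIV. \<Sum>s\<in>UNIV. Wu i x * Wu s x * Rm s i j k x) = - (\<Sum>i\<in>UNIV. \<Sum>s\<in>UNIV. Wu i x * Wu s x * Rm s i j k x)"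
  proof -
    have "(\<Sum>i\<in>UNIV. \<Sum>s\<in>UNIV. Wu i x * Wu s x * Rm s i j k x) = (\<Sum>s\<in>UNIV. \<Sum>i\<in>UNIV. Wu i x * Wu s x * Rm s i j k x)"
      by (rule sum.swap)
    also have "\<dots> = (\<Sum>s\<in>UNIV. \<Sum>i\<in>UNIV. - (Wu s x * Wu i x * Rm i s j k x))"
      by (intro sum.cong refl, subst Rm_skew12[OF x]) simp
    finally show ?thesis by (simp add: sum_negf)
  qed
  ultimately show ?thesis by simp
qed

lemma lower_DSu:
  assumes kill: "\<forall>x\<in>U. killing_at x" and x: "x \<in> U"
  shows "(\<Sum>i\<in>UNIV. H s i x * (pd k (Su i l) x + (\<Sum>m\<in>UNIV. Gm i k m x * Su m l x)
    - (\<Sum>m\<in>UNIV. Gm m k l x * Su i m x))) = ddw s l k x"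
proof -
  have HS: "(\<Sum>m\<in>UNIV. H i m z * Su m j z) = cov i j z" if "z \<in> U" for i j z
    using H_Su[OF that] Sl_killing[OF bspec[OF kill that]] by simp
  have "pd k (\<lambda>x. \<Sum>m\<in>UNIV. H s m x * Su m l x) x = pd k (cov s l) x"
    by (rule pd_cong_open[OF openU x]) (rule HS)
  moreover have "(\<Sum>i\<in>UNIV. H s i x * (\<Sum>m\<in>UNIV. Gm m k l x * Su i m x)) = (\<Sum>m\<in>UNIV. Gm m l k x * cov s m x)"
  proof -
    have "(\<Sum>i\<in>UNIV. H s i x * (\<Sum>m\<in>UNIV. Gm m k l x * Su i m x)) = (\<Sum>i\<in>UNIV. H s i x * (\<Sum>m\<in>UNIV. Su i m x * Gm m k l x))"
      by (simp add: mult.commute)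
    then show ?thesis unfolding sum_contract_swap HS[OF x] by (simp add: Gm_sym[OF x, of _ k] mult.commute)
  qed
  ultimately show ?thesis
    using lower_covariant_derivative[of x "\<lambda>i. Su i l" s k, OF x smooth_Su]
    unfolding ddw_def by (simp add: HS[OF x] right_diff_distrib sum_subtractf)
qed

end

section \<open>The spray of a Kropina metric\<close>

text \<open>\<open>pdx\<close> and \<open>pdy\<close> move one variable along one coordinate line,
  so this weak form of openness already makes them depend only on values in
  \<open>D\<close>.\<close>

definition slice_open :: "((real^'n::finite) \<times> (real^'n)) set \<Rightarrow> bool"
  where "slice_open D \<longleftrightarrow> (\<forall>x y k. (x, y) \<in> D \<longrightarrow>
    (\<forall>\<^sub>F t in nhds 0. (x + t *\<^sub>R axis k 1, y) \<in> D) \<and> (\<forall>\<^sub>F t in nhds 0. (x, y + t *\<^sub>R axis k 1) \<in> D))"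

lemma pdx_cong:
  assumes "slice_open D" "(x, y) \<in> D" "\<And>x y. (x, y) \<in> D \<Longrightarrow> f x y = g x y"
  shows "pdx k f x y = pdx k g x y"
  unfolding pdx_def pd_def
proof (rule deriv_cong_ev)
  have "\<forall>\<^sub>F t in nhds 0. (x + t *\<^sub>R axis k 1, y) \<in> D"
    using assms(1,2) by (auto simp: slice_open_def)
  then show "\<forall>\<^sub>F t in nhds 0. f (x + t *\<^sub>R axis k 1) y = g (x + t *\<^sub>R axis k 1) y"
    by (rule eventually_mono) (rule assms(3))
qed simp

lemma pdy_cong:
  assumes "slice_open D" "(x, y) \<in> D" "\<And>x y. (x, y) \<in> D \<Longrightarrow> f x y = g x y"
  shows "pdy k f x y = pdy k g x y"
  unfolding pdy_def pd_def
proof (rule deriv_cong_ev)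
  have "\<forall>\<^sub>F t in nhds 0. (x, y + t *\<^sub>R axis k 1) \<in> D"
    using assms(1,2) by (auto simp: slice_open_def)
  then show "\<forall>\<^sub>F t in nhds 0. f x (y + t *\<^sub>R axis k 1) = g x (y + t *\<^sub>R axis k 1)"
    by (rule eventually_mono) (rule assms(3))
qed simp

lemma pdx_eqI: "((\<lambda>t. f (x + t *\<^sub>R axis k 1) y) has_real_derivative d) (at 0) \<Longrightarrow> pdx k f x y = d"
  unfolding pdx_def by (rule pd_eqI)

lemma pdy_eqI: "((\<lambda>t. f x (y + t *\<^sub>R axis k 1)) has_real_derivative d) (at 0) \<Longrightarrow> pdy k f x y = d"
  unfolding pdy_def by (rule pd_eqI)

lemma DERIV_coord: "((\<lambda>t. (y + t *\<^sub>R axis k 1) $ i) has_real_derivative kron i k) (at 0)"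
  by (auto intro!: derivative_eq_intros simp: axis_def)

text \<open>Lets the solution of a linear system be guessed and verified, instead of computing the
  inverse matrix. The spray is identified in this way.\<close>

lemma matrix_inv_solve:
  assumes "invertible (M::real^'n^'n)" "\<And>l. (\<Sum>i\<in>UNIV. M $ l $ i * v i) = r l"
  shows "(\<Sum>l\<in>UNIV. matrix_inv M $ k $ l * r l) = v k"
proof -
  have "(\<Sum>l\<in>UNIV. matrix_inv M $ k $ l * r l) = (\<Sum>i\<in>UNIV. (matrix_inv M ** M) $ k $ i * v i)"
    by (simp add: assms(2)[symmetric] sum_contract_swap matrix_matrix_mult_def)
  also have "\<dots> = v k" by (simp add: matrix_inv_mult(2)[OF assms(1)] mat_def)
  finally show ?thesis .
qed

section \<open>The function F and its derivatives\<close>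

context unit_covector begin

text \<open>\<open>Fl\<close> and \<open>Fll\<close> are the first and second \<open>y\<close>-derivatives of \<open>F = \<alpha>\<^sup>2 / (2 W(y))\<close>; \<open>dA\<close>, \<open>dB\<close>, \<open>dF\<close>
  and \<open>dFl\<close> are \<open>x\<close>-derivatives. Here \<open>\<alpha>\<close> is the norm of \<open>h\<close>.\<close>

definition bet :: "'n tbfun" where "bet x y = (\<Sum>i\<in>UNIV. w x $ i * y $ i)"
definition Dom :: "((real^'n) \<times> (real^'n)) set" where "Dom = {(x, y). x \<in> U \<and> bet x y > 0}"
definition Fk :: "'n tbfun" where "Fk x y = g2 x y y / (2 * bet x y)"
definition Fl :: "'n \<Rightarrow> 'n tbfun" where "Fl l x y = (low x y l - Fk x y * w x $ l) / bet x y"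
definition Fll :: "'n \<Rightarrow> 'n \<Rightarrow> 'n tbfun"
  where "Fll l i x y = (H l i x - Fl i x y * w x $ l - Fl l x y * w x $ i) / bet x y"
definition dA :: "'n \<Rightarrow> 'n tbfun"
  where "dA k x y = (\<Sum>i\<in>UNIV. \<Sum>j\<in>UNIV. pd k (H i j) x * y $ i * y $ j)"
definition dB :: "'n \<Rightarrow> 'n tbfun" where "dB k x y = (\<Sum>i\<in>UNIV. pd k (\<lambda>x. w x $ i) x * y $ i)"
definition dF :: "'n \<Rightarrow> 'n tbfun" where "dF k x y = (dA k x y / 2 - Fk x y * dB k x y) / bet x y"
definition dFl :: "'n \<Rightarrow> 'n \<Rightarrow> 'n tbfun"
  where "dFl l k x y = ((\<Sum>j\<in>UNIV. pd k (H l j) x * y $ j) - dF k x y * w x $ l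
    - Fk x y * pd k (\<lambda>x. w x $ l) x - Fl l x y * dB k x y) / bet x y"

lemma DX_bet: "x \<in> U \<Longrightarrow> ((\<lambda>t. bet (x + t *\<^sub>R axis k 1) y) has_real_derivative dB k x y) (at 0)"
  unfolding bet_def dB_def
  by (auto intro!: derivative_eq_intros smooth_DERIV[OF smooth_w])

lemma DY_bet: "((\<lambda>t. bet x (y + t *\<^sub>R axis k 1)) has_real_derivative w x $ k) (at 0)"
  unfolding bet_def by (auto intro!: derivative_eq_intros DERIV_coord simp del: vector_add_component)

lemma DX_low: "x \<in> U \<Longrightarrow>
  ((\<lambda>t. low (x + t *\<^sub>R axis k 1) y l) has_real_derivative (\<Sum>j\<in>UNIV. pd k (H l j) x * y $ j)) (at 0)"
  unfolding low_def by (auto intro!: derivative_eq_intros smooth_DERIV[OF smooth_h])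

lemma DY_low: "((\<lambda>t. low x (y + t *\<^sub>R axis k 1) l) has_real_derivative H l k x) (at 0)"
  unfolding low_def by (auto intro!: derivative_eq_intros DERIV_coord simp del: vector_add_component)

lemma DX_A: assumes "x \<in> U"
  shows "((\<lambda>t. g2 (x + t *\<^sub>R axis k 1) y y) has_real_derivative dA k x y) (at 0)"
proof -
  have "((\<lambda>t. g2 (x + t *\<^sub>R axis k 1) y y) has_real_derivative
    (\<Sum>i\<in>UNIV. y $ i * (\<Sum>j\<in>UNIV. pd k (H i j) x * y $ j))) (at 0)"
    unfolding g2_def by (auto intro!: derivative_eq_intros DX_low[OF assms] simp: mult.commute)
  then show ?thesis by (simp add: dA_def sum_distrib_left mult_ac)
qed

lemma DY_A: assumes "x \<in> U"
  shows "((\<lambda>t. g2 x (y + t *\<^sub>R axis k 1) (y + t *\<^sub>R axis k 1)) has_real_derivative 2 * low x y k) (at 0)"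
proof -
  have "((\<lambda>t. g2 x (y + t *\<^sub>R axis k 1) (y + t *\<^sub>R axis k 1)) has_real_derivative
    (\<Sum>i\<in>UNIV. kron i k * low x y i + y $ i * H i k x)) (at 0)"
    unfolding g2_def
    by (auto intro!: derivative_eq_intros DERIV_coord DY_low simp del: vector_add_component)
      (auto simp: mult.commute add.commute intro!: sum.cong)
  moreover have "(\<Sum>i\<in>UNIV. kron i k * low x y i + y $ i * H i k x) = 2 * low x y k"
    by (simp only: sum.distrib sum_kron) (simp add: low_def h_sym[OF assms, of _ k] mult.commute)
  ultimately show ?thesis by simp
qed

lemma Dom_iff: "(x, y) \<in> Dom \<longleftrightarrow> x \<in> U \<and> bet x y > 0" by (simp add: Dom_def)

lemma Dom_pos:
  assumes "(x, y) \<in> Dom"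
  shows "x \<in> U" "bet x y > 0" "y \<noteq> 0" "g2 x y y > 0" "Fk x y > 0" "g2 x y y = 2 * bet x y * Fk x y"
proof -
  show 1: "x \<in> U" "bet x y > 0" using assms by (auto simp: Dom_iff)
  then show 2: "y \<noteq> 0" by (auto simp: bet_def)
  then show "g2 x y y > 0" using g2_pos 1 by blast
  then show "Fk x y > 0" "g2 x y y = 2 * bet x y * Fk x y" using 1 by (simp_all add: Fk_def)
qed

lemma slice_open_Dom: "slice_open Dom"
  unfolding slice_open_def
proof (intro allI impI conjI)
  fix x y k assume xy: "(x, y) \<in> Dom"
  note D = Dom_pos[OF xy]
  have pos: "\<forall>\<^sub>F t in nhds 0. 0 < f t" if "(f has_real_derivative d) (at 0)" "0 < f 0" for f d
    using DERIV_isCont[OF that(1)] that(2) order_tendstoD(1)[of f "f 0" "nhds 0" 0]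
    by (simp add: isCont_def tendsto_nhds_iff)
  have "\<forall>\<^sub>F t in nhds 0. 0 < bet (x + t *\<^sub>R axis k 1) y"
    by (rule pos[OF DX_bet]) (simp_all add: D)
  with eventually_line_in_open[OF openU D(1), of "axis k 1"]
  show "\<forall>\<^sub>F t in nhds 0. (x + t *\<^sub>R axis k 1, y) \<in> Dom"
    by eventually_elim (simp add: Dom_iff)
  have "\<forall>\<^sub>F t in nhds 0. 0 < bet x (y + t *\<^sub>R axis k 1)"
    by (rule pos[OF DY_bet]) (simp_all add: D)
  then show "\<forall>\<^sub>F t in nhds 0. (x, y + t *\<^sub>R axis k 1) \<in> Dom"
    by eventually_elim (simp add: Dom_iff D)
qed

lemma DX_F: assumes "(x, y) \<in> Dom"
  shows "((\<lambda>t. Fk (x + t *\<^sub>R axis k 1) y) has_real_derivative dF k x y) (at 0)"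
  unfolding Fk_def using Dom_pos[OF assms]
  by (auto intro!: derivative_eq_intros DX_A DX_bet simp: dF_def field_simps)

lemma DY_F: assumes "(x, y) \<in> Dom"
  shows "((\<lambda>t. Fk x (y + t *\<^sub>R axis k 1)) has_real_derivative Fl k x y) (at 0)"
  unfolding Fk_def using Dom_pos[OF assms]
  by (auto intro!: derivative_eq_intros DY_A DY_bet simp: Fl_def field_simps)

lemma DX_Fl: assumes "(x, y) \<in> Dom"
  shows "((\<lambda>t. Fl l (x + t *\<^sub>R axis k 1) y) has_real_derivative dFl l k x y) (at 0)"
proof -
  have "((\<lambda>t. Fl l (x + t *\<^sub>R axis k 1) y) has_real_derivative
     (((\<Sum>j\<in>UNIV. pd k (H l j) x * y $ j) - (dF k x y * w x $ l + Fk x y * pd k (\<lambda>x. w x $ l) x)) * bet x y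
     - (low x y l - Fk x y * w x $ l) * dB k x y) / (bet x y * bet x y)) (at 0)"
    unfolding Fl_def using Dom_pos[OF assms]
    by (auto intro!: derivative_eq_intros DX_low DX_bet DX_F[OF assms] smooth_DERIV[OF smooth_w])
  also have "(((\<Sum>j\<in>UNIV. pd k (H l j) x * y $ j) - (dF k x y * w x $ l + Fk x y * pd k (\<lambda>x. w x $ l) x)) * bet x y
     - (low x y l - Fk x y * w x $ l) * dB k x y) / (bet x y * bet x y) = dFl l k x y"
    unfolding dFl_def using Dom_pos[OF assms] by (simp add: Fl_def field_simps)
  finally show ?thesis .
qed

lemma DY_Fl: assumes "(x, y) \<in> Dom"
  shows "((\<lambda>t. Fl l x (y + t *\<^sub>R axis k 1)) has_real_derivative Fll l k x y) (at 0)"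
proof -
  have "((\<lambda>t. Fl l x (y + t *\<^sub>R axis k 1)) has_real_derivative
     ((H l k x - Fl k x y * w x $ l) * bet x y
     - (low x y l - Fk x y * w x $ l) * w x $ k) / (bet x y * bet x y)) (at 0)"
    unfolding Fl_def[of l] using Dom_pos[OF assms]
    by (auto intro!: derivative_eq_intros DY_low DY_bet DY_F[OF assms])
  also have "((H l k x - Fl k x y * w x $ l) * bet x y
     - (low x y l - Fk x y * w x $ l) * w x $ k) / (bet x y * bet x y) = Fll l k x y"
    unfolding Fll_def using Dom_pos[OF assms] by (simp add: Fl_def[of l] field_simps)
  finally show ?thesis .
qed

lemma Fll_sym: "x \<in> U \<Longrightarrow> Fll l i x y = Fll i l x y"
  unfolding Fll_def by (simp add: h_sym[of x l i] algebra_simps)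

section \<open>Candidate for the spray, and its contractions\<close>

definition Gy :: "'n \<Rightarrow> 'n tbfun"
  where "Gy i x y = (\<Sum>j\<in>UNIV. \<Sum>k\<in>UNIV. Gm i j k x * y $ j * y $ k)"
definition sv :: "'n \<Rightarrow> 'n tbfun" where "sv i x y = (\<Sum>j\<in>UNIV. Su i j x * y $ j)"
definition S0 :: "'n tbfun" where "S0 x y = (\<Sum>i\<in>UNIV. w x $ i * sv i x y)"
definition R00 :: "'n tbfun" where "R00 x y = (\<Sum>i\<in>UNIV. \<Sum>j\<in>UNIV. Rl i j x * y $ i * y $ j)"
text \<open>Lowered with \<open>h\<close>, the vector \<open>y - F W\<close> in \<open>qv\<close> is
  \<open>bet\<close> times the \<open>y\<close>-derivative \<open>Fl\<close> of \<open>F\<close>.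
  Its multiplier \<open>mu\<close> is the value for which \<open>w\<close> contracted with
  \<open>qv\<close> gives \<open>mu * bet - R00\<close>, as the Euler-Lagrange equations
  demand.\<close>

definition mu :: "'n tbfun" where "mu x y = (R00 x y + 2 * Fk x y * S0 x y) / Fk x y"
definition qv :: "'n \<Rightarrow> 'n tbfun"
  where "qv i x y = mu x y * (y $ i - Fk x y * Wu i x) + 2 * Fk x y * sv i x y"

lemma bet_Wu: "x \<in> U \<Longrightarrow> (\<Sum>i\<in>UNIV. Wu i x * low x y i) = bet x y"
  unfolding low_def by (subst sum_contract_swap) (use H_Wu in \<open>simp add: bet_def h_sym[of x] mult.commute\<close>)

lemma low_alt: "x \<in> U \<Longrightarrow> (\<Sum>i\<in>UNIV. y $ i * H i j x) = low x y j"
  by (simp add: low_def h_sym[of x j] mult.commute)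

lemma low_Gy:
  assumes x: "x \<in> U"
  shows "(\<Sum>i\<in>UNIV. H l i x * Gy i x y)
    = (\<Sum>k\<in>UNIV. y $ k * (\<Sum>j\<in>UNIV. pd k (H l j) x * y $ j)) - dA l x y / 2"
proof -
  have "(\<Sum>i\<in>UNIV. H l i x * Gy i x y) = (\<Sum>i\<in>UNIV. \<Sum>j\<in>UNIV. \<Sum>k\<in>UNIV. H l i x * Gm i j k x * y $ j * y $ k)"
    unfolding Gy_def by (simp add: sum_distrib_left mult_ac)
  also have "\<dots> = (\<Sum>j\<in>UNIV. \<Sum>k\<in>UNIV. \<Sum>i\<in>UNIV. H l i x * Gm i j k x * y $ j * y $ k)"
    by (rule sum3_rotate)
  also have "\<dots> = (\<Sum>j\<in>UNIV. \<Sum>k\<in>UNIV. (\<Sum>i\<in>UNIV. H l i x * Gm i j k x) * y $ j * y $ k)"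
    by (simp add: sum_distrib_right)
  also have "\<dots> = (\<Sum>j\<in>UNIV. \<Sum>k\<in>UNIV. pd j (H l k) x * y $ j * y $ k) / 2
      + (\<Sum>j\<in>UNIV. \<Sum>k\<in>UNIV. pd k (H l j) x * y $ j * y $ k) / 2 - dA l x y / 2"
    unfolding dA_def sum_collect low_Gm[OF x]
    by (intro sum.cong refl) (simp add: field_simps)
  also have "(\<Sum>j\<in>UNIV. \<Sum>k\<in>UNIV. pd k (H l j) x * y $ j * y $ k) = (\<Sum>j\<in>UNIV. \<Sum>k\<in>UNIV. pd j (H l k) x * y $ j * y $ k)"
    by (subst sum.swap) (simp add: mult_ac)
  finally show ?thesis by (simp add: sum_distrib_left mult_ac)
qed

lemma y_Gy:
  assumes x: "x \<in> U"
  shows "(\<Sum>i\<in>UNIV. low x y i * Gy i x y) = (\<Sum>k\<in>UNIV. dA k x y * y $ k) / 2"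
proof -
  have "(\<Sum>i\<in>UNIV. low x y i * Gy i x y) = (\<Sum>l\<in>UNIV. y $ l * (\<Sum>i\<in>UNIV. H l i x * Gy i x y))"
    unfolding sum_contract_swap low_alt[OF x] ..
  also have "\<dots> = (\<Sum>l\<in>UNIV. \<Sum>k\<in>UNIV. \<Sum>j\<in>UNIV. pd k (H l j) x * y $ j * y $ k * y $ l) - (\<Sum>l\<in>UNIV. dA l x y * y $ l) / 2"
    unfolding low_Gy[OF x] by (simp add: right_diff_distrib sum_subtractf sum_distrib_left sum_divide_distrib mult_ac)
  also have "(\<Sum>l\<in>UNIV. \<Sum>k\<in>UNIV. \<Sum>j\<in>UNIV. pd k (H l j) x * y $ j * y $ k * y $ l) = (\<Sum>k\<in>UNIV. dA k x y * y $ k)"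
  proof -
    have "(\<Sum>l\<in>UNIV. \<Sum>k\<in>UNIV. \<Sum>j\<in>UNIV. pd k (H l j) x * y $ j * y $ k * y $ l) = (\<Sum>k\<in>UNIV. \<Sum>l\<in>UNIV. \<Sum>j\<in>UNIV. pd k (H l j) x * y $ j * y $ k * y $ l)"
      by (rule sum.swap)
    then show ?thesis by (simp add: dA_def sum_distrib_right sum_distrib_left mult_ac)
  qed
  finally show ?thesis by simp
qed

text \<open>The rate of change of W(y) along geodesics of \<open>h\<close>; the skew part of the
  covariant derivative drops out against the two factors \<open>y\<close>.\<close>

lemma w_Gy:
  assumes x: "x \<in> U"
  shows "(\<Sum>k\<in>UNIV. dB k x y * y $ k) - (\<Sum>i\<in>UNIV. w x $ i * Gy i x y) = R00 x y"
proof -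
  have 1: "(\<Sum>i\<in>UNIV. w x $ i * Gy i x y) = (\<Sum>j\<in>UNIV. \<Sum>k\<in>UNIV. (\<Sum>i\<in>UNIV. Gm i j k x * w x $ i) * y $ j * y $ k)"
  proof -
    have "(\<Sum>i\<in>UNIV. w x $ i * Gy i x y) = (\<Sum>i\<in>UNIV. \<Sum>j\<in>UNIV. \<Sum>k\<in>UNIV. w x $ i * Gm i j k x * y $ j * y $ k)"
      unfolding Gy_def by (simp add: sum_distrib_left mult_ac)
    also have "\<dots> = (\<Sum>j\<in>UNIV. \<Sum>k\<in>UNIV. \<Sum>i\<in>UNIV. w x $ i * Gm i j k x * y $ j * y $ k)"
      by (rule sum3_rotate)
    finally show ?thesis by (simp add: sum_distrib_right sum_distrib_left mult_ac)
  qed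
  have 2: "(\<Sum>k\<in>UNIV. dB k x y * y $ k) = (\<Sum>i\<in>UNIV. \<Sum>k\<in>UNIV. pd k (\<lambda>x. w x $ i) x * y $ i * y $ k)"
    unfolding dB_def sum_distrib_right by (subst sum.swap) simp
  have 3: "(\<Sum>k\<in>UNIV. dB k x y * y $ k) - (\<Sum>i\<in>UNIV. w x $ i * Gy i x y) = (\<Sum>i\<in>UNIV. \<Sum>k\<in>UNIV. cov i k x * y $ i * y $ k)"
    unfolding 1 2 covd_def by (simp add: left_diff_distrib sum_subtractf)
  have "R00 x y = (\<Sum>i\<in>UNIV. \<Sum>k\<in>UNIV. cov i k x * y $ i * y $ k) / 2 + (\<Sum>i\<in>UNIV. \<Sum>k\<in>UNIV. cov k i x * y $ i * y $ k) / 2"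
    unfolding R00_def Rl_def sum_collect
    by (intro sum.cong refl) (simp add: field_simps)
  also have "(\<Sum>i\<in>UNIV. \<Sum>k\<in>UNIV. cov k i x * y $ i * y $ k) = (\<Sum>i\<in>UNIV. \<Sum>k\<in>UNIV. cov i k x * y $ i * y $ k)"
    by (subst sum.swap) (simp add: mult_ac)
  finally show ?thesis unfolding 3 by simp
qed

lemma Sl_pd: "x \<in> U \<Longrightarrow> Sl l k x = (pd k (\<lambda>x. w x $ l) x - pd l (\<lambda>x. w x $ k) x) / 2"
  unfolding Sl_def covd_def by (simp add: Gm_sym[of x _ l k])

lemma H_sv: "x \<in> U \<Longrightarrow> (\<Sum>i\<in>UNIV. H l i x * sv i x y) = (\<Sum>k\<in>UNIV. Sl l k x * y $ k)"
  unfolding sv_def sum_contract_swap by (simp add: H_Su)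

lemma low_sv: assumes x: "x \<in> U" shows "(\<Sum>i\<in>UNIV. low x y i * sv i x y) = 0"
proof -
  have "(\<Sum>i\<in>UNIV. low x y i * sv i x y) = (\<Sum>l\<in>UNIV. y $ l * (\<Sum>i\<in>UNIV. H l i x * sv i x y))"
    unfolding sum_contract_swap low_alt[OF x] ..
  also have "\<dots> = (\<Sum>l\<in>UNIV. \<Sum>k\<in>UNIV. Sl l k x * y $ l * y $ k)"
    unfolding H_sv[OF x] by (simp add: sum_distrib_left mult_ac)
  finally have 1: "(\<Sum>i\<in>UNIV. low x y i * sv i x y) = (\<Sum>l\<in>UNIV. \<Sum>k\<in>UNIV. Sl l k x * y $ l * y $ k)" .
  also have "\<dots> = (\<Sum>k\<in>UNIV. \<Sum>l\<in>UNIV. Sl l k x * y $ l * y $ k)" by (rule sum.swap)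
  also have "\<dots> = (\<Sum>k\<in>UNIV. \<Sum>l\<in>UNIV. - (Sl k l x * y $ k * y $ l))"
    by (intro sum.cong refl) (simp add: Sl_def field_simps)
  also have "\<dots> = - (\<Sum>l\<in>UNIV. \<Sum>k\<in>UNIV. Sl l k x * y $ l * y $ k)" by (simp add: sum_negf)
  finally show ?thesis unfolding 1 by linarith
qed

lemma low_Wu: "x \<in> U \<Longrightarrow> (\<Sum>i\<in>UNIV. low x y i * Wu i x) = bet x y"
  using bet_Wu[of x y] by (simp add: mult.commute)

lemma low_y: "(\<Sum>i\<in>UNIV. low x y i * y $ i) = g2 x y y"
  by (simp add: g2_def mult.commute)

lemma qv_contractions:
  assumes D: "(x, y) \<in> Dom"
  shows "(\<Sum>i\<in>UNIV. w x $ i * qv i x y) = mu x y * bet x y - R00 x y"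
    and "(\<Sum>i\<in>UNIV. low x y i * qv i x y) = Fk x y * mu x y * bet x y"
    and "(\<Sum>i\<in>UNIV. H l i x * qv i x y) = mu x y * bet x y * Fl l x y + 2 * Fk x y * (\<Sum>k\<in>UNIV. Sl l k x * y $ k)"
proof -
  note P = Dom_pos[OF D]
  have split: "(\<Sum>i\<in>UNIV. f i * qv i x y) = mu x y * ((\<Sum>i\<in>UNIV. f i * y $ i) - Fk x y * (\<Sum>i\<in>UNIV. f i * Wu i x))
      + 2 * Fk x y * (\<Sum>i\<in>UNIV. f i * sv i x y)" for f
    unfolding qv_def by (simp add: sum_distrib_left sum.distrib sum_subtractf algebra_simps)
  have muF: "mu x y * Fk x y = R00 x y + 2 * Fk x y * S0 x y" using P by (simp add: mu_def)
  show "(\<Sum>i\<in>UNIV. w x $ i * qv i x y) = mu x y * bet x y - R00 x y"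
    unfolding split w_Wu[OF P(1)] S0_def[symmetric] bet_def[symmetric] using muF by (simp add: algebra_simps)
  show "(\<Sum>i\<in>UNIV. low x y i * qv i x y) = Fk x y * mu x y * bet x y"
    unfolding split low_sv[OF P(1)] low_Wu[OF P(1)] low_y P(6) by (simp add: algebra_simps)
  show "(\<Sum>i\<in>UNIV. H l i x * qv i x y) = mu x y * bet x y * Fl l x y + 2 * Fk x y * (\<Sum>k\<in>UNIV. Sl l k x * y $ k)"
    unfolding split H_sv[OF P(1)] H_Wu[OF P(1)] low_def[symmetric] using P by (simp add: Fl_def)
qed

lemma Fl_contract:
  "(\<Sum>i\<in>UNIV. Fl i x y * v i) = ((\<Sum>i\<in>UNIV. low x y i * v i) - Fk x y * (\<Sum>i\<in>UNIV. w x $ i * v i)) / bet x y"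
  unfolding Fl_def
  unfolding sum_collect
  by (intro sum.cong refl) (simp add: algebra_simps)

lemma Fll_contract:
  "(\<Sum>i\<in>UNIV. Fll l i x y * v i) = ((\<Sum>i\<in>UNIV. H l i x * v i) - (\<Sum>i\<in>UNIV. Fl i x y * v i) * w x $ l
    - Fl l x y * (\<Sum>i\<in>UNIV. w x $ i * v i)) / bet x y"
  unfolding Fll_def
  unfolding sum_collect
  by (intro sum.cong refl) (simp add: algebra_simps)

lemma Fl_y: assumes "(x, y) \<in> Dom" shows "(\<Sum>i\<in>UNIV. Fl i x y * y $ i) = Fk x y"
  unfolding Fl_contract low_y bet_def[symmetric] using Dom_pos[OF assms] by (simp add: field_simps)

definition Gk :: "'n \<Rightarrow> 'n tbfun" where "Gk i x y = (Gy i x y - qv i x y) / 2"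

lemma Gk_contract: "(\<Sum>i\<in>UNIV. f i * Gk i x y) = ((\<Sum>i\<in>UNIV. f i * Gy i x y) - (\<Sum>i\<in>UNIV. f i * qv i x y)) / 2"
  unfolding Gk_def by (simp add: sum_subtractf sum_divide_distrib right_diff_distrib diff_divide_distrib)

text \<open>The Finsler function is constant along its geodesic spray.\<close>

lemma spray_F:
  assumes D: "(x, y) \<in> Dom"
  shows "(\<Sum>k\<in>UNIV. dF k x y * y $ k) = 2 * (\<Sum>i\<in>UNIV. Fl i x y * Gk i x y)"
proof -
  note P = Dom_pos[OF D]
  have "(\<Sum>k\<in>UNIV. dF k x y * y $ k) = ((\<Sum>k\<in>UNIV. dA k x y * y $ k) / 2 - Fk x y * (\<Sum>k\<in>UNIV. dB k x y * y $ k)) / bet x y"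
    unfolding dF_def sum_collect
    by (intro sum.cong refl) (simp add: algebra_simps)
  also have "\<dots> = ((\<Sum>i\<in>UNIV. low x y i * Gy i x y) - Fk x y * (R00 x y + (\<Sum>i\<in>UNIV. w x $ i * Gy i x y))) / bet x y"
    using y_Gy[OF P(1), of y] w_Gy[OF P(1), of y] by (simp add: algebra_simps)
  also have "\<dots> = 2 * (\<Sum>i\<in>UNIV. Fl i x y * Gk i x y)"
    unfolding Gk_contract Fl_contract qv_contractions[OF D] by (simp add: algebra_simps add_divide_distrib diff_divide_distrib)
  finally show ?thesis .
qed

text \<open>These are the Euler-Lagrange equations of \<open>F\<close> itself. Together with
  \<open>spray_F\<close> they give those of F^2/2, because the Hessian of F^2/2 is
  \<open>Fl i * Fl l + F * Fll i l\<close>.\<close>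

lemma spray_Fl:
  assumes D: "(x, y) \<in> Dom"
  shows "(\<Sum>k\<in>UNIV. dFl l k x y * y $ k) - dF l x y = 2 * (\<Sum>i\<in>UNIV. Fll l i x y * Gk i x y)"
proof -
  note P = Dom_pos[OF D]
  \<comment> \<open>A ring identity with every contraction replaced by a variable: \<open>LG\<close>
    and \<open>wG\<close> stand for \<open>Gy\<close> contracted with \<open>H\<close> and
    \<open>w\<close>, \<open>FG\<close> for \<open>Gk\<close> contracted with
    \<open>Fl\<close>.\<close>
  have alg: "LG + a / 2 - 2 * FG * wl - f * (2 * S + b) - fl * (R + wG) - (a / 2 - f * b)
      = 2 * ((LG - (m * c * fl + 2 * f * S)) / 2 - FG * wl - fl * (wG - (m * c - R)) / 2)"
    for LG a FG wl f S b fl R wG m c :: real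
    by (simp add: algebra_simps diff_divide_distrib add_divide_distrib)
  have S: "2 * (\<Sum>k\<in>UNIV. Sl l k x * y $ k) = (\<Sum>k\<in>UNIV. pd k (\<lambda>x. w x $ l) x * y $ k) - dB l x y"
    unfolding dB_def sum_collect
    by (intro sum.cong refl) (simp add: Sl_pd[OF P(1)] field_simps)
  have "(\<Sum>k\<in>UNIV. dFl l k x y * y $ k) = ((\<Sum>k\<in>UNIV. y $ k * (\<Sum>j\<in>UNIV. pd k (H l j) x * y $ j))
     - (\<Sum>k\<in>UNIV. dF k x y * y $ k) * w x $ l - Fk x y * (\<Sum>k\<in>UNIV. pd k (\<lambda>x. w x $ l) x * y $ k)
     - Fl l x y * (\<Sum>k\<in>UNIV. dB k x y * y $ k)) / bet x y"
    unfolding dFl_def sum_collect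
    by (intro sum.cong refl) (simp add: sum_distrib_left algebra_simps)
  also have "\<dots> = ((\<Sum>i\<in>UNIV. H l i x * Gy i x y) + dA l x y / 2
     - 2 * (\<Sum>i\<in>UNIV. Fl i x y * Gk i x y) * w x $ l - Fk x y * (2 * (\<Sum>k\<in>UNIV. Sl l k x * y $ k) + dB l x y)
     - Fl l x y * (R00 x y + (\<Sum>i\<in>UNIV. w x $ i * Gy i x y))) / bet x y"
    using low_Gy[OF P(1), of l y] spray_F[OF D] w_Gy[OF P(1), of y] S by (simp add: algebra_simps)
  finally have eq: "(\<Sum>k\<in>UNIV. dFl l k x y * y $ k) = ((\<Sum>i\<in>UNIV. H l i x * Gy i x y) + dA l x y / 2
     - 2 * (\<Sum>i\<in>UNIV. Fl i x y * Gk i x y) * w x $ l - Fk x y * (2 * (\<Sum>k\<in>UNIV. Sl l k x * y $ k) + dB l x y)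
     - Fl l x y * (R00 x y + (\<Sum>i\<in>UNIV. w x $ i * Gy i x y))) / bet x y" .
  show ?thesis
    unfolding eq Fll_contract Gk_contract[of "\<lambda>i. H l i x"] Gk_contract[of "\<lambda>i. w x $ i"] qv_contractions[OF D] dF_def
      times_divide_eq_right diff_divide_distrib[symmetric]
    by (rule arg_cong[where f="\<lambda>z. z / bet x y"], rule alg)
qed

text \<open>The function of the theorem agrees with \<open>Fk\<close> only on \<open>Dom\<close>;
  \<open>slice_open_Dom\<close> transfers its derivatives.\<close>

context
  fixes F :: "'n tbfun"
  assumes F: "\<And>x y. (x, y) \<in> Dom \<Longrightarrow> F x y = Fk x y"
begin

lemma pdy_F2: assumes "(x, y) \<in> Dom" shows "pdy l (\<lambda>x y. (F x y)\<^sup>2) x y = 2 * Fk x y * Fl l x y"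
proof -
  have "pdy l (\<lambda>x y. (F x y)\<^sup>2) x y = pdy l (\<lambda>x y. (Fk x y)\<^sup>2) x y"
    by (rule pdy_cong[OF slice_open_Dom assms]) (simp add: F)
  also have "\<dots> = 2 * Fk x y * Fl l x y"
    by (rule pdy_eqI) (auto intro!: derivative_eq_intros DY_F[OF assms])
  finally show ?thesis .
qed

lemma pdx_F2: assumes "(x, y) \<in> Dom" shows "pdx l (\<lambda>x y. (F x y)\<^sup>2) x y = 2 * Fk x y * dF l x y"
proof -
  have "pdx l (\<lambda>x y. (F x y)\<^sup>2) x y = pdx l (\<lambda>x y. (Fk x y)\<^sup>2) x y"
    by (rule pdx_cong[OF slice_open_Dom assms]) (simp add: F)
  also have "\<dots> = 2 * Fk x y * dF l x y"
    by (rule pdx_eqI) (auto intro!: derivative_eq_intros DX_F[OF assms])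
  finally show ?thesis .
qed

lemma pdx_pdy_F2: assumes "(x, y) \<in> Dom"
  shows "pdx k (pdy l (\<lambda>x y. (F x y)\<^sup>2)) x y = 2 * (dF k x y * Fl l x y + Fk x y * dFl l k x y)"
proof -
  have "pdx k (pdy l (\<lambda>x y. (F x y)\<^sup>2)) x y = pdx k (\<lambda>x y. 2 * Fk x y * Fl l x y) x y"
    by (rule pdx_cong[OF slice_open_Dom assms]) (rule pdy_F2)
  also have "\<dots> = 2 * (dF k x y * Fl l x y + Fk x y * dFl l k x y)"
    by (rule pdx_eqI) (auto intro!: derivative_eq_intros DX_F[OF assms] DX_Fl[OF assms])
  finally show ?thesis .
qed

lemma fundamental_tensor_F: assumes "(x, y) \<in> Dom"
  shows "fundamental_tensor F x y $ i $ l = Fl i x y * Fl l x y + Fk x y * Fll i l x y"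
proof -
  have "pdy i (pdy l (\<lambda>x y. (F x y)\<^sup>2)) x y = pdy i (\<lambda>x y. 2 * Fk x y * Fl l x y) x y"
    by (rule pdy_cong[OF slice_open_Dom assms]) (rule pdy_F2)
  also have "\<dots> = 2 * (Fl i x y * Fl l x y + Fk x y * Fll l i x y)"
    by (rule pdy_eqI) (auto intro!: derivative_eq_intros DY_F[OF assms] DY_Fl[OF assms])
  finally show ?thesis
    using Dom_pos(1)[OF assms] by (simp add: fundamental_tensor_def Fll_sym[of x l i])
qed

lemma fundamental_tensor_contract: assumes "(x, y) \<in> Dom"
  shows "(\<Sum>l\<in>UNIV. fundamental_tensor F x y $ i $ l * v l) =
    Fl i x y * (\<Sum>l\<in>UNIV. Fl l x y * v l) + Fk x y * (\<Sum>l\<in>UNIV. Fll i l x y * v l)"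
  unfolding fundamental_tensor_F[OF assms]
  by (simp add: distrib_right sum.distrib sum_distrib_left mult.assoc)

text \<open>Completing the square shows definiteness: on \<open>v\<close> the form is
  \<open>f * f\<close> plus \<open>F / bet\<close> times the squared norm of \<open>v - c y\<close>.
  If both vanish, then \<open>v = c y\<close> and \<open>f = c F\<close>, so
  \<open>c = 0\<close>.\<close>

lemma fundamental_tensor_invertible: assumes D: "(x, y) \<in> Dom"
  shows "invertible (fundamental_tensor F x y)"
proof -
  note P = Dom_pos[OF D]
  have "v = 0" if v: "fundamental_tensor F x y *v v = 0" for v
  proof -
    define f where "f = (\<Sum>l\<in>UNIV. Fl l x y * v $ l)"
    \<comment> \<open>The choice for which \<open>bet\<close> vanishes on
      \<open>v - c y\<close>.\<close>
    define c where "c = bet x v / bet x y"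
    have fy: "g2 x y v = bet x y * f + Fk x y * bet x v"
      using P(2) unfolding f_def Fl_contract g2_sym[OF P(1), of y v] by (simp add: g2_def bet_def mult.commute)
    have "(\<Sum>i\<in>UNIV. v $ i * (fundamental_tensor F x y *v v) $ i) = 0" by (simp add: v)
    then have 0: "(\<Sum>i\<in>UNIV. v $ i * (Fl i x y * f + Fk x y * (\<Sum>l\<in>UNIV. Fll i l x y * v $ l))) = 0"
      by (simp add: matrix_vector_mult_def fundamental_tensor_contract[OF D] f_def)
    have 1: "(\<Sum>i\<in>UNIV. v $ i * (\<Sum>l\<in>UNIV. Fll i l x y * v $ l)) = (g2 x v v - 2 * f * bet x v) / bet x y"
    proof -
      have "(\<Sum>i\<in>UNIV. v $ i * ((low x v i - f * w x $ i - Fl i x y * bet x v) / bet x y))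
        = ((\<Sum>i\<in>UNIV. v $ i * low x v i) - f * (\<Sum>i\<in>UNIV. w x $ i * v $ i) - (\<Sum>i\<in>UNIV. Fl i x y * v $ i) * bet x v) / bet x y"
        unfolding sum_collect
        by (intro sum.cong refl) (simp add: algebra_simps)
      then show ?thesis
        unfolding Fll_contract f_def[symmetric] low_def[symmetric] bet_def[symmetric] g2_def[symmetric] by simp
    qed
    have 2: "(\<Sum>i\<in>UNIV. v $ i * (Fl i x y * f + Fk x y * (\<Sum>l\<in>UNIV. Fll i l x y * v $ l)))
      = f * f + Fk x y * (\<Sum>i\<in>UNIV. v $ i * (\<Sum>l\<in>UNIV. Fll i l x y * v $ l))"
      unfolding f_def by (simp add: distrib_left sum.distrib sum_distrib_left sum_distrib_right mult_ac)
    have 3: "g2 x (v - c *\<^sub>R y) (v - c *\<^sub>R y) = g2 x v v - 2 * f * bet x v"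
      using P(2) fy g2_sym[OF P(1), of v y] P(6) by (simp add: g2_bilinear c_def field_simps)
    have "f * f + Fk x y * (g2 x (v - c *\<^sub>R y) (v - c *\<^sub>R y) / bet x y) = 0"
      using 0 unfolding 2 1 3 by simp
    moreover have "g2 x (v - c *\<^sub>R y) (v - c *\<^sub>R y) \<ge> 0"
      using g2_pos[OF P(1), of "v - c *\<^sub>R y"] by (cases "v - c *\<^sub>R y = 0") (auto simp: g2_def low_def)
    ultimately have "f * f = 0" "Fk x y * (g2 x (v - c *\<^sub>R y) (v - c *\<^sub>R y) / bet x y) = 0"
      using P by (smt (verit) divide_nonneg_pos mult_nonneg_nonneg zero_le_square)+
    then have f0: "f = 0" and "g2 x (v - c *\<^sub>R y) (v - c *\<^sub>R y) = 0" using P by auto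
    then have vc: "v = c *\<^sub>R y" using g2_pos[OF P(1), of "v - c *\<^sub>R y"] by fastforce
    have "f = c * Fk x y"
      unfolding f_def vc using Fl_y[OF D] by (simp add: sum_distrib_left[symmetric] mult.left_commute)
    then show "v = 0" using f0 P vc by simp
  qed
  then show ?thesis using matrix_left_invertible_ker invertible_left_inverse by blast
qed

lemma spray_eq: assumes D: "(x, y) \<in> Dom" shows "spray F i x y = Gk i x y"
proof -
  have "(\<Sum>l\<in>UNIV. matrix_inv (fundamental_tensor F x y) $ i $ l *
      ((\<Sum>k\<in>UNIV. pdx k (pdy l (\<lambda>x y. (F x y)\<^sup>2)) x y * y $ k)
        - pdx l (\<lambda>x y. (F x y)\<^sup>2) x y)) = 4 * Gk i x y"
  proof (rule matrix_inv_solve[OF fundamental_tensor_invertible[OF D]])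
    fix l
    have 1: "(\<Sum>k\<in>UNIV. pdx k (pdy l (\<lambda>x y. (F x y)\<^sup>2)) x y * y $ k)
       = 2 * Fl l x y * (\<Sum>k\<in>UNIV. dF k x y * y $ k) + 2 * Fk x y * (\<Sum>k\<in>UNIV. dFl l k x y * y $ k)"
      unfolding pdx_pdy_F2[OF D] by (simp add: sum_distrib_left sum.distrib algebra_simps)
    have 2: "(\<Sum>i\<in>UNIV. f i * (4 * Gk i x y)) = 4 * (\<Sum>i\<in>UNIV. f i * Gk i x y)" for f
      by (simp add: sum_distrib_left mult_ac)
    show "(\<Sum>i\<in>UNIV. fundamental_tensor F x y $ l $ i * (4 * Gk i x y))
      = (\<Sum>k\<in>UNIV. pdx k (pdy l (\<lambda>x y. (F x y)\<^sup>2)) x y * y $ k) - pdx l (\<lambda>x y. (F x y)\<^sup>2) x y"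
      unfolding 1 fundamental_tensor_contract[OF D] pdx_F2[OF D] 2
      using spray_F[OF D] spray_Fl[OF D, of l] by (simp add: algebra_simps)
  qed
  then show ?thesis unfolding spray_def by simp
qed

end

end

section \<open>Constant curvature forces a Killing field\<close>

text \<open>The expression \<open>finsler_curv\<close> for an arbitrary spray, so that it also
  applies to the part \<open>Ep\<close> of the spray of \<open>F\<close>.\<close>

definition spray_curv :: "('n::finite \<Rightarrow> 'n tbfun) \<Rightarrow> 'n \<Rightarrow> 'n \<Rightarrow> 'n tbfun"
  where "spray_curv G i l x y = 2 * pdx l (G i) x y - (\<Sum>k\<in>UNIV. y $ k * pdx k (pdy l (G i)) x y)
    + 2 * (\<Sum>r\<in>UNIV. G r x y * pdy l (pdy r (G i)) x y) - (\<Sum>r\<in>UNIV. pdy r (G i) x y * pdy l (G r) x y)"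

lemma finsler_curv_spray_curv: "finsler_curv F = spray_curv (spray F)"
  by (intro ext) (simp add: finsler_curv_def spray_curv_def spray1_def spray2_def)

lemma spray_curv_cong:
  assumes D: "slice_open D" "(x, y) \<in> D" and G: "\<And>i x y. (x, y) \<in> D \<Longrightarrow> G i x y = G' i x y"
  shows "spray_curv G i l x y = spray_curv G' i l x y"
proof -
  have 1: "pdy r (G i) x y = pdy r (G' i) x y" if "(x, y) \<in> D" for r i x y
    by (rule pdy_cong[OF D(1) that G])
  have "pdx l (G i) x y = pdx l (G' i) x y" by (rule pdx_cong[OF D G])
  moreover have "pdx k (pdy l (G i)) x y = pdx k (pdy l (G' i)) x y" for k by (rule pdx_cong[OF D 1])
  moreover have "pdy l (pdy r (G i)) x y = pdy l (pdy r (G' i)) x y" for r by (rule pdy_cong[OF D 1])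
  ultimately show ?thesis unfolding spray_curv_def using 1[OF D(2)] G[OF D(2)] by simp
qed

section \<open>Rational functions on the domain of F\<close>

context unit_covector begin

text \<open>Rational functions of \<open>y\<close> with smooth coefficients and denominator a power of \<open>\<beta>\<close>; powers of
  \<open>\<alpha>\<^sup>2\<close> are admitted in the denominator if the flag is set.\<close>

inductive ratl :: "bool \<Rightarrow> 'n tbfun \<Rightarrow> bool" for d where
  ratl_coef: "smooth_fun_on U c \<Longrightarrow> ratl d (\<lambda>x y. c x)"
| ratl_coord: "ratl d (\<lambda>x y. y $ i)"
| ratl_add: "ratl d f \<Longrightarrow> ratl d g \<Longrightarrow> ratl d (\<lambda>x y. f x y + g x y)"
| ratl_mult: "ratl d f \<Longrightarrow> ratl d g \<Longrightarrow> ratl d (\<lambda>x y. f x y * g x y)"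
| ratl_inv_bet: "ratl d (\<lambda>x y. inverse (bet x y))"
| ratl_inv_A: "d \<Longrightarrow> ratl d (\<lambda>x y. inverse (g2 x y y))"
| ratl_cong: "ratl d f \<Longrightarrow> (\<And>x y. (x, y) \<in> Dom \<Longrightarrow> f x y = g x y) \<Longrightarrow> ratl d g"

lemma ratl_const: "ratl d (\<lambda>x y. c)" by (rule ratl_coef) simp

lemma ratl_sum: "(\<And>i. i \<in> I \<Longrightarrow> ratl d (f i)) \<Longrightarrow> ratl d (\<lambda>x y. \<Sum>i\<in>I. f i x y)"
  by (induction I rule: infinite_finite_induct) (auto intro: ratl_const ratl_add)

lemma ratl_uminus: "ratl d f \<Longrightarrow> ratl d (\<lambda>x y. - f x y)"
  using ratl_mult[OF ratl_const[of d "- 1"]] by simp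

lemma ratl_diff: "ratl d f \<Longrightarrow> ratl d g \<Longrightarrow> ratl d (\<lambda>x y. f x y - g x y)"
  using ratl_add[OF _ ratl_uminus] by simp

lemma ratl_low: "ratl d (\<lambda>x y. low x y i)"
  unfolding low_def by (intro ratl_sum ratl_mult ratl_coef ratl_coord smooth_h)

lemma ratl_A: "ratl d (\<lambda>x y. g2 x y y)"
  unfolding g2_def by (intro ratl_sum ratl_mult ratl_low ratl_coord)

lemma ratl_bet: "ratl d bet"
  unfolding bet_def[abs_def] by (intro ratl_sum ratl_mult ratl_coef ratl_coord smooth_w)

lemma ratl_Fk: "ratl d Fk"
proof -
  have "ratl d (\<lambda>x y. g2 x y y * inverse (bet x y) * (1 / 2))"
    by (intro ratl_mult ratl_const ratl_inv_bet ratl_A)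
  then show ?thesis by (rule ratl_cong) (simp add: Fk_def field_simps)
qed

abbreviation "has_dx k f f' \<equiv> \<forall>x y. (x, y) \<in> Dom \<longrightarrow>
  ((\<lambda>t. f (x + t *\<^sub>R axis k 1) y) has_real_derivative f' x y) (at 0)"
abbreviation "has_dy k f f' \<equiv> \<forall>x y. (x, y) \<in> Dom \<longrightarrow>
  ((\<lambda>t. f x (y + t *\<^sub>R axis k 1)) has_real_derivative f' x y) (at 0)"

text \<open>Closure under differentiation without a formula for the derivative. With the flag
  \<open>False\<close>, it shows that iterated derivatives of \<open>Ep\<close> have only powers of
  \<open>bet\<close> in their denominators.\<close>

lemma ratl_derivatives:
  assumes "ratl d f"
  shows "(\<exists>f'. ratl d f' \<and> has_dx k f f') \<and> (\<exists>f'. ratl d f' \<and> has_dy k f f')"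
  using assms
proof (induction rule: ratl.induct)
  case (ratl_coef c)
  have "ratl d (\<lambda>x y. pd k c x)" by (intro ratl.ratl_coef smooth_pd ratl_coef)
  moreover have "\<forall>x y. (x, y) \<in> Dom \<longrightarrow>
      ((\<lambda>t. c (x + t *\<^sub>R axis k 1)) has_real_derivative (\<lambda>x y. pd k c x) x y) (at 0)"
    using Dom_pos(1) smooth_DERIV[OF ratl_coef] by blast
  moreover have "ratl d (\<lambda>x y. 0)" by (rule ratl_const)
  moreover have "\<forall>x y. (x, y) \<in> Dom \<longrightarrow>
      ((\<lambda>t. c x) has_real_derivative (\<lambda>x y. 0) x y) (at 0)"
    by simp
  ultimately show ?case by blast
next
  case (ratl_coord i)
  show ?case
    by (intro conjI exI[of _ "\<lambda>x y. 0"] exI[of _ "\<lambda>x y. kron i k"] allI impI ratl_const DERIV_coord DERIV_const)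
next
  case (ratl_add f g)
  then obtain fx gx fy gy where
    "ratl d fx" "has_dx k f fx"
    "ratl d gx" "has_dx k g gx"
    "ratl d fy" "has_dy k f fy"
    "ratl d gy" "has_dy k g gy"
    by auto
  then show ?case
    by (intro conjI exI[of _ "\<lambda>x y. fx x y + gx x y"] exI[of _ "\<lambda>x y. fy x y + gy x y"])
      (auto intro: ratl.ratl_add DERIV_add)
next
  case (ratl_mult f g)
  then obtain fx gx fy gy where *:
    "ratl d fx" "has_dx k f fx"
    "ratl d gx" "has_dx k g gx"
    "ratl d fy" "has_dy k f fy"
    "ratl d gy" "has_dy k g gy"
    by auto
  have "ratl d (\<lambda>x y. f x y * gx x y + fx x y * g x y)" "ratl d (\<lambda>x y. f x y * gy x y + fy x y * g x y)"
    by (intro ratl.ratl_add ratl.ratl_mult ratl_mult.hyps *)+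
  moreover have "((\<lambda>t. f (x + t *\<^sub>R axis k 1) y * g (x + t *\<^sub>R axis k 1) y) has_real_derivative
        (\<lambda>x y. f x y * gx x y + fx x y * g x y) x y) (at 0)" if "(x, y) \<in> Dom" for x y
    using DERIV_mult'[of "\<lambda>t. f (x + t *\<^sub>R axis k 1) y" "fx x y" 0 UNIV "\<lambda>t. g (x + t *\<^sub>R axis k 1) y" "gx x y"] * that
    by simp
  moreover have "((\<lambda>t. f x (y + t *\<^sub>R axis k 1) * g x (y + t *\<^sub>R axis k 1)) has_real_derivative
        (\<lambda>x y. f x y * gy x y + fy x y * g x y) x y) (at 0)" if "(x, y) \<in> Dom" for x y
    using DERIV_mult'[of "\<lambda>t. f x (y + t *\<^sub>R axis k 1)" "fy x y" 0 UNIV "\<lambda>t. g x (y + t *\<^sub>R axis k 1)" "gy x y"] * that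
    by simp
  ultimately show ?case by blast
next
  case ratl_inv_bet
  have "ratl d (\<lambda>x y. - (dB k x y * (inverse (bet x y) * inverse (bet x y))))"
    "ratl d (\<lambda>x y. - (w x $ k * (inverse (bet x y) * inverse (bet x y))))"
    unfolding dB_def
    by (intro ratl_uminus ratl.ratl_mult ratl.ratl_inv_bet ratl_sum ratl_coef ratl_coord smooth_pd smooth_w)+
  moreover have "((\<lambda>t. inverse (bet (x + t *\<^sub>R axis k 1) y)) has_real_derivative
      - (dB k x y * (inverse (bet x y) * inverse (bet x y)))) (at 0)"
    "((\<lambda>t. inverse (bet x (y + t *\<^sub>R axis k 1))) has_real_derivative
      - (w x $ k * (inverse (bet x y) * inverse (bet x y)))) (at 0)" if "(x, y) \<in> Dom" for x y
    using Dom_pos[OF that] by (auto intro!: derivative_eq_intros DX_bet DY_bet)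
  ultimately show ?case by blast
next
  case ratl_inv_A
  have "ratl d (\<lambda>x y. - (dA k x y * (inverse (g2 x y y) * inverse (g2 x y y))))"
    "ratl d (\<lambda>x y. - (2 * low x y k * (inverse (g2 x y y) * inverse (g2 x y y))))"
    unfolding dA_def
    by (intro ratl_uminus ratl.ratl_mult ratl.ratl_inv_A ratl_sum ratl_coef ratl_coord smooth_pd smooth_h
        ratl_inv_A ratl_const ratl_low)+
  moreover have "((\<lambda>t. inverse (g2 (x + t *\<^sub>R axis k 1) y y)) has_real_derivative
      - (dA k x y * (inverse (g2 x y y) * inverse (g2 x y y)))) (at 0)"
    "((\<lambda>t. inverse (g2 x (y + t *\<^sub>R axis k 1) (y + t *\<^sub>R axis k 1))) has_real_derivative
      - (2 * low x y k * (inverse (g2 x y y) * inverse (g2 x y y)))) (at 0)" if "(x, y) \<in> Dom" for x y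
    using Dom_pos[OF that] by (auto intro!: derivative_eq_intros DX_A DY_A)
  ultimately show ?case by blast
next
  case (ratl_cong f g)
  have so: "\<forall>\<^sub>F t in nhds 0. (x + t *\<^sub>R axis k 1, y) \<in> Dom" "\<forall>\<^sub>F t in nhds 0. (x, y + t *\<^sub>R axis k 1) \<in> Dom"
    if "(x, y) \<in> Dom" for x y
    using slice_open_Dom that by (auto simp: slice_open_def)
  have "((\<lambda>t. g (x + t *\<^sub>R axis k 1) y) has_real_derivative f') (at 0)"
    if "((\<lambda>t. f (x + t *\<^sub>R axis k 1) y) has_real_derivative f') (at 0)" "(x, y) \<in> Dom" for x y f'
  proof -
    have "\<forall>\<^sub>F t in nhds 0. f (x + t *\<^sub>R axis k 1) y = g (x + t *\<^sub>R axis k 1) y"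
      by (rule eventually_mono[OF so(1)[OF that(2)]]) (rule ratl_cong.hyps)
    from DERIV_cong_ev[OF refl this refl, THEN iffD1, OF that(1)] show ?thesis .
  qed
  moreover have "((\<lambda>t. g x (y + t *\<^sub>R axis k 1)) has_real_derivative f') (at 0)"
    if "((\<lambda>t. f x (y + t *\<^sub>R axis k 1)) has_real_derivative f') (at 0)" "(x, y) \<in> Dom" for x y f'
  proof -
    have "\<forall>\<^sub>F t in nhds 0. f x (y + t *\<^sub>R axis k 1) = g x (y + t *\<^sub>R axis k 1)"
      by (rule eventually_mono[OF so(2)[OF that(2)]]) (rule ratl_cong.hyps)
    from DERIV_cong_ev[OF refl this refl, THEN iffD1, OF that(1)] show ?thesis .
  qed
  ultimately show ?case using ratl_cong.IH by meson
qed

lemma ratl_pdx: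
  assumes "ratl d f"
  shows "ratl d (pdx k f)"
    and "(x, y) \<in> Dom \<Longrightarrow> ((\<lambda>t. f (x + t *\<^sub>R axis k 1) y) has_real_derivative pdx k f x y) (at 0)"
proof -
  obtain f' where f': "ratl d f'" "\<And>x y. (x, y) \<in> Dom \<Longrightarrow>
    ((\<lambda>t. f (x + t *\<^sub>R axis k 1) y) has_real_derivative f' x y) (at 0)"
    using ratl_derivatives[OF assms] by blast
  then have eq: "f' x y = pdx k f x y" if "(x, y) \<in> Dom" for x y
    using pdx_eqI that by metis
  then show "ratl d (pdx k f)" using f'(1) ratl_cong by blast
  show "((\<lambda>t. f (x + t *\<^sub>R axis k 1) y) has_real_derivative pdx k f x y) (at 0)" if "(x, y) \<in> Dom"
    using f'(2)[OF that] eq[OF that] by simp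
qed

lemma ratl_pdy:
  assumes "ratl d f"
  shows "ratl d (pdy k f)"
    and "(x, y) \<in> Dom \<Longrightarrow> ((\<lambda>t. f x (y + t *\<^sub>R axis k 1)) has_real_derivative pdy k f x y) (at 0)"
proof -
  obtain f' where f': "ratl d f'" "\<And>x y. (x, y) \<in> Dom \<Longrightarrow>
    ((\<lambda>t. f x (y + t *\<^sub>R axis k 1)) has_real_derivative f' x y) (at 0)"
    using ratl_derivatives[OF assms] by blast
  then have eq: "f' x y = pdy k f x y" if "(x, y) \<in> Dom" for x y
    using pdy_eqI that by metis
  then show "ratl d (pdy k f)" using f'(1) ratl_cong by blast
  show "((\<lambda>t. f x (y + t *\<^sub>R axis k 1)) has_real_derivative pdy k f x y) (at 0)" if "(x, y) \<in> Dom"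
    using f'(2)[OF that] eq[OF that] by simp
qed

lemma ratl_spray_curv: "(\<And>i. ratl d (G i)) \<Longrightarrow> ratl d (spray_curv G i l)"
  unfolding spray_curv_def[abs_def]
  by (intro ratl_diff ratl_add ratl_mult ratl_sum ratl_const ratl_coord ratl_pdx ratl_pdy)

subsection \<open>Homogeneity\<close>

text \<open>Homogeneity in the infinitesimal form of Euler's relation, in which the projective
  change uses it; \<open>ratl True\<close> provides the derivatives.\<close>

definition homog :: "real \<Rightarrow> 'n tbfun \<Rightarrow> bool"
  where "homog e f \<longleftrightarrow> ratl True f \<and>
    (\<forall>x y. (x, y) \<in> Dom \<longrightarrow> (\<Sum>r\<in>UNIV. y $ r * pdy r f x y) = e * f x y)"

lemma homog_ratl: "homog e f \<Longrightarrow> ratl True f" by (simp add: homog_def)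

lemma homog_coef: "smooth_fun_on U c \<Longrightarrow> homog 0 (\<lambda>x y. c x)"
proof -
  assume c: "smooth_fun_on U c"
  have "pdy r (\<lambda>x y. c x) x y = 0" for r x y by (rule pdy_eqI) simp
  then show ?thesis using c by (simp add: homog_def ratl_coef)
qed

lemma homog_coord: "homog 1 (\<lambda>x y. y $ i)"
  unfolding homog_def using pdy_eqI[of "\<lambda>x y. y $ i", OF DERIV_coord]
  by (simp add: ratl_coord)

lemma homog_add: assumes "homog e f" "homog e g" shows "homog e (\<lambda>x y. f x y + g x y)"
  unfolding homog_def
proof (intro conjI allI impI)
  show "ratl True (\<lambda>x y. f x y + g x y)" using assms by (intro ratl_add homog_ratl)
  fix x y assume D: "(x, y) \<in> Dom"
  have "pdy r (\<lambda>x y. f x y + g x y) x y = pdy r f x y + pdy r g x y" for r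
    by (rule pdy_eqI, rule DERIV_add) (rule ratl_pdy(2)[OF homog_ratl D], rule assms)+
  then show "(\<Sum>r\<in>UNIV. y $ r * pdy r (\<lambda>x y. f x y + g x y) x y) = e * (f x y + g x y)"
    using assms D by (simp add: homog_def distrib_left sum.distrib)
qed

lemma homog_mult: assumes "homog e f" "homog e' g" shows "homog (e + e') (\<lambda>x y. f x y * g x y)"
  unfolding homog_def
proof (intro conjI allI impI)
  show "ratl True (\<lambda>x y. f x y * g x y)" using assms by (intro ratl_mult homog_ratl)
  fix x y assume D: "(x, y) \<in> Dom"
  have *: "pdy r (\<lambda>x y. f x y * g x y) x y = f x y * pdy r g x y + pdy r f x y * g x y" for r
    using DERIV_mult'[OF ratl_pdy(2)[OF homog_ratl[OF assms(1)] D] ratl_pdy(2)[OF homog_ratl[OF assms(2)] D]]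
    by (intro pdy_eqI) simp
  have "(\<Sum>r\<in>UNIV. y $ r * pdy r (\<lambda>x y. f x y * g x y) x y)
     = f x y * (\<Sum>r\<in>UNIV. y $ r * pdy r g x y) + (\<Sum>r\<in>UNIV. y $ r * pdy r f x y) * g x y"
    unfolding * by (simp add: distrib_left sum.distrib sum_distrib_left sum_distrib_right mult_ac)
  then show "(\<Sum>r\<in>UNIV. y $ r * pdy r (\<lambda>x y. f x y * g x y) x y) = (e + e') * (f x y * g x y)"
    using assms D by (simp add: homog_def algebra_simps)
qed

lemma homog_sum:
  assumes "finite I" "I \<noteq> {}" "\<And>i. i \<in> I \<Longrightarrow> homog e (f i)"
  shows "homog e (\<lambda>x y. \<Sum>i\<in>I. f i x y)"
  using assms by (induction I rule: finite_ne_induct) (auto intro: homog_add)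

lemma homog_cmult: "homog e f \<Longrightarrow> homog e (\<lambda>x y. c * f x y)"
  using homog_mult[OF homog_coef[OF smooth_const, of c]] by simp

lemma homog_diff: "homog e f \<Longrightarrow> homog e g \<Longrightarrow> homog e (\<lambda>x y. f x y - g x y)"
  using homog_add[OF _ homog_cmult[of e g "- 1"]] by simp

lemma homog_inv_bet: "homog (- 1) (\<lambda>x y. inverse (bet x y))"
  unfolding homog_def
proof (intro conjI allI impI ratl_inv_bet)
  fix x y assume D: "(x, y) \<in> Dom"
  note P = Dom_pos[OF D]
  have *: "pdy r (\<lambda>x y. inverse (bet x y)) x y = - (w x $ r / (bet x y * bet x y))" for r
    using P by (intro pdy_eqI) (auto intro!: derivative_eq_intros DY_bet simp: field_simps)
  have "(\<Sum>r\<in>UNIV. y $ r * pdy r (\<lambda>x y. inverse (bet x y)) x y) = - (bet x y / (bet x y * bet x y))"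
    unfolding * by (simp add: sum_negf bet_def[of x y] sum_divide_distrib mult_ac)
  then show "(\<Sum>r\<in>UNIV. y $ r * pdy r (\<lambda>x y. inverse (bet x y)) x y) = - 1 * inverse (bet x y)"
    using P by (simp add: field_simps)
qed

lemma homog_inv_A: "homog (- 2) (\<lambda>x y. inverse (g2 x y y))"
  unfolding homog_def
proof (intro conjI allI impI ratl_inv_A)
  fix x y assume D: "(x, y) \<in> Dom"
  note P = Dom_pos[OF D]
  have *: "pdy r (\<lambda>x y. inverse (g2 x y y)) x y = - (2 * low x y r / (g2 x y y * g2 x y y))" for r
    using P by (intro pdy_eqI) (auto intro!: derivative_eq_intros DY_A simp: field_simps)
  have "(\<Sum>r\<in>UNIV. y $ r * pdy r (\<lambda>x y. inverse (g2 x y y)) x y)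
      = - (2 * (\<Sum>r\<in>UNIV. y $ r * low x y r) / (g2 x y y * g2 x y y))"
    unfolding * by (simp add: sum_negf sum_divide_distrib sum_distrib_left mult_ac)
  then show "(\<Sum>r\<in>UNIV. y $ r * pdy r (\<lambda>x y. inverse (g2 x y y)) x y) = - 2 * inverse (g2 x y y)"
    unfolding g2_def[symmetric] using P(4) by (simp add: field_simps)
qed simp

text \<open>Euler's relation differentiated in direction \<open>l\<close>; the product rule on
  \<open>y $ r\<close> lowers the degree by one.\<close>

lemma homog_pdy:
  assumes f: "homog e f" and D: "(x, y) \<in> Dom"
  shows "(\<Sum>r\<in>UNIV. y $ r * pdy l (pdy r f) x y) = (e - 1) * pdy l f x y"
proof -
  note R = homog_ratl[OF f]
  have "pdy l (\<lambda>x y. \<Sum>r\<in>UNIV. y $ r * pdy r f x y) x y = pdy l (\<lambda>x y. e * f x y) x y"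
    by (rule pdy_cong[OF slice_open_Dom D]) (use f in \<open>simp add: homog_def\<close>)
  also have "\<dots> = e * pdy l f x y"
    by (rule pdy_eqI, rule DERIV_cmult) (rule ratl_pdy(2)[OF R D])
  also have "pdy l (\<lambda>x y. \<Sum>r\<in>UNIV. y $ r * pdy r f x y) x y
     = (\<Sum>r\<in>UNIV. y $ r * pdy l (pdy r f) x y + kron r l * pdy r f x y)"
  proof (rule pdy_eqI, rule DERIV_sum)
    fix r
    show "((\<lambda>t. (y + t *\<^sub>R axis l 1) $ r * pdy r f x (y + t *\<^sub>R axis l 1)) has_real_derivative
      y $ r * pdy l (pdy r f) x y + kron r l * pdy r f x y) (at 0)"
      using DERIV_mult'[OF DERIV_coord[of y l r] ratl_pdy(2)[OF ratl_pdy(1)[OF R] D, of r l]] by simp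
  qed
  finally show ?thesis by (simp add: sum.distrib algebra_simps)
qed

subsection \<open>Projective change of a spray\<close>

text \<open>Up to multiples of \<open>y\<close>, adding \<open>P y\<close> to a spray \<open>E\<close> changes its curvature by this multiple
  of the identity.\<close>

definition pfactor :: "('n \<Rightarrow> 'n tbfun) \<Rightarrow> 'n tbfun \<Rightarrow> 'n tbfun"
  where "pfactor E P x y = P x y * P x y + 2 * (\<Sum>r\<in>UNIV. pdy r P x y * E r x y)
    - (\<Sum>k\<in>UNIV. y $ k * pdx k P x y)"

text \<open>Euler's relations for \<open>E\<close> and \<open>P\<close> evaluate the contractions of
  \<open>y\<close> with their \<open>y\<close>-derivatives. The coefficient \<open>X\<close> of
  \<open>y\<close> can stay implicit, because the covectors applied later annihilate
  \<open>y\<close>.\<close>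

lemma projective_change:
  assumes E: "\<And>i. homog 2 (E i)" and P: "homog 1 P" and D: "(x, y) \<in> Dom"
  shows "\<exists>X. \<forall>i. spray_curv (\<lambda>i x y. E i x y + P x y * y $ i) i l x y = spray_curv E i l x y + y $ i * X
    + kron i l * pfactor E P x y"
proof -
  let ?G = "\<lambda>i x y. E i x y + P x y * y $ i"
  note RE = homog_ratl[OF E] and RP = homog_ratl[OF P]
  have DE: "((\<lambda>t. E i x (y + t *\<^sub>R axis l 1)) has_real_derivative pdy l (E i) x y) (at 0)"
    "((\<lambda>t. E i (x + t *\<^sub>R axis l 1) y) has_real_derivative pdx l (E i) x y) (at 0)"
    "((\<lambda>t. pdy r (E i) x (y + t *\<^sub>R axis l 1)) has_real_derivative pdy l (pdy r (E i)) x y) (at 0)"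
    "((\<lambda>t. pdy r (E i) (x + t *\<^sub>R axis l 1) y) has_real_derivative pdx l (pdy r (E i)) x y) (at 0)"
    if "(x, y) \<in> Dom" for x y i l r
    using that by (auto intro!: ratl_pdy ratl_pdx RE)
  have DP: "((\<lambda>t. P x (y + t *\<^sub>R axis l 1)) has_real_derivative pdy l P x y) (at 0)"
    "((\<lambda>t. P (x + t *\<^sub>R axis l 1) y) has_real_derivative pdx l P x y) (at 0)"
    "((\<lambda>t. pdy r P x (y + t *\<^sub>R axis l 1)) has_real_derivative pdy l (pdy r P) x y) (at 0)"
    "((\<lambda>t. pdy r P (x + t *\<^sub>R axis l 1) y) has_real_derivative pdx l (pdy r P) x y) (at 0)"
    if "(x, y) \<in> Dom" for x y l r
    using that by (auto intro!: ratl_pdy ratl_pdx RP)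
  have Gx: "pdx l (?G i) x y = pdx l (E i) x y + pdx l P x y * y $ i" for i l
    by (rule pdx_eqI) (auto intro!: derivative_eq_intros DE DP D)
  have Gy: "pdy l (?G i) x y = pdy l (E i) x y + pdy l P x y * y $ i + P x y * kron i l"
    if "(x, y) \<in> Dom" for x y i l
    by (rule pdy_eqI)
      (auto intro!: derivative_eq_intros DE DP DERIV_coord that simp del: vector_add_component)
  have Gyx: "pdx k (pdy l (?G i)) x y = pdx k (pdy l (E i)) x y + pdx k (pdy l P) x y * y $ i + pdx k P x y * kron i l" for i k
  proof -
    have "pdx k (pdy l (?G i)) x y = pdx k (\<lambda>x y. pdy l (E i) x y + pdy l P x y * y $ i + P x y * kron i l) x y"
      by (rule pdx_cong[OF slice_open_Dom D Gy])
    also have "\<dots> = pdx k (pdy l (E i)) x y + pdx k (pdy l P) x y * y $ i + pdx k P x y * kron i l"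
      by (rule pdx_eqI) (auto intro!: derivative_eq_intros DE DP D)
    finally show ?thesis .
  qed
  have Gyy: "pdy l (pdy r (?G i)) x y = pdy l (pdy r (E i)) x y + pdy l (pdy r P) x y * y $ i
      + pdy r P x y * kron i l + pdy l P x y * kron i r" for i r
  proof -
    have "pdy l (pdy r (?G i)) x y = pdy l (\<lambda>x y. pdy r (E i) x y + pdy r P x y * y $ i + P x y * kron i r) x y"
      by (rule pdy_cong[OF slice_open_Dom D Gy])
    also have "\<dots> = pdy l (pdy r (E i)) x y + pdy l (pdy r P) x y * y $ i
      + pdy r P x y * kron i l + pdy l P x y * kron i r"
      by (rule pdy_eqI)
        (auto intro!: derivative_eq_intros DE DP DERIV_coord D simp del: vector_add_component)
    finally show ?thesis .
  qed
  define Pr El where "Pr r = pdy r P x y" and "El i r = pdy r (E i) x y" for i r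
  define Prl Erl where "Prl r = pdy l (pdy r P) x y" and "Erl i r = pdy l (pdy r (E i)) x y" for i r
  define e p where "e i = E i x y" and "p = P x y" for i
  have eu: "(\<Sum>r\<in>UNIV. y $ r * El i r) = 2 * e i" "(\<Sum>r\<in>UNIV. y $ r * Pr r) = p"
    "(\<Sum>r\<in>UNIV. y $ r * Erl i r) = El i l" for i
    using E[of i] P D homog_pdy[OF E D, of l i] by (auto simp: homog_def El_def Pr_def e_def p_def Erl_def)
  \<comment> \<open>Collects all terms with the factor \<open>y $ i\<close>.\<close>
  define X where "X = 2 * pdx l P x y - (\<Sum>k\<in>UNIV. y $ k * pdx k (pdy l P) x y)
     + 2 * (\<Sum>r\<in>UNIV. (e r + p * y $ r) * Prl r) + 2 * p * Pr l - (\<Sum>r\<in>UNIV. Pr r * El r l) - 3 * p * Pr l"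
  show ?thesis
  proof (intro exI[of _ X] allI)
    fix i
    have s1: "(\<Sum>k\<in>UNIV. y $ k * pdx k (pdy l (?G i)) x y) = (\<Sum>k\<in>UNIV. y $ k * pdx k (pdy l (E i)) x y)
       + y $ i * (\<Sum>k\<in>UNIV. y $ k * pdx k (pdy l P) x y) + kron i l * (\<Sum>k\<in>UNIV. y $ k * pdx k P x y)"
      unfolding Gyx sum_collect
      by (intro sum.cong refl) (simp add: algebra_simps)
    have k1: "(f \<odot> kron i) = f i" for f :: "'n \<Rightarrow> real" by (rule sum_kron)
    have k2: "(\<Sum>r\<in>UNIV. f r * kron r l) = f l" for f :: "'n \<Rightarrow> real" by (rule sum_kron)
    have "(\<Sum>r\<in>UNIV. ?G r x y * pdy l (pdy r (?G i)) x y)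
      = (e \<odot> Erl i) + p * (\<Sum>r\<in>UNIV. y $ r * Erl i r) + y $ i * (\<Sum>r\<in>UNIV. (e r + p * y $ r) * Prl r)
       + kron i l * ((Pr \<odot> e) + p * (\<Sum>r\<in>UNIV. y $ r * Pr r)) + Pr l * (\<Sum>r\<in>UNIV. (e r + p * y $ r) * kron i r)"
      unfolding Gyy sum_collect e_def[symmetric] p_def[symmetric]
        Pr_def[symmetric] El_def[symmetric] Prl_def[symmetric] Erl_def[symmetric]
      by (intro sum.cong refl) (simp add: algebra_simps)
    then have s2: "(\<Sum>r\<in>UNIV. ?G r x y * pdy l (pdy r (?G i)) x y)
      = (e \<odot> Erl i) + p * El i l + y $ i * (\<Sum>r\<in>UNIV. (e r + p * y $ r) * Prl r)
       + kron i l * ((Pr \<odot> e) + p * p) + Pr l * (e i + p * y $ i)"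
      unfolding eu k1 .
    have "(\<Sum>r\<in>UNIV. pdy r (?G i) x y * pdy l (?G r) x y)
      = (\<Sum>r\<in>UNIV. El i r * El r l) + Pr l * (\<Sum>r\<in>UNIV. y $ r * El i r) + p * (\<Sum>r\<in>UNIV. El i r * kron r l)
       + y $ i * ((\<Sum>r\<in>UNIV. Pr r * El r l) + Pr l * (\<Sum>r\<in>UNIV. y $ r * Pr r) + p * (\<Sum>r\<in>UNIV. Pr r * kron r l))
       + p * (\<Sum>r\<in>UNIV. (El r l + Pr l * y $ r + p * kron r l) * kron i r)"
      unfolding Gy[OF D] sum_collect e_def[symmetric] p_def[symmetric]
        Pr_def[symmetric] El_def[symmetric] Prl_def[symmetric] Erl_def[symmetric]
      by (intro sum.cong refl) (simp add: algebra_simps)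
    then have s3: "(\<Sum>r\<in>UNIV. pdy r (?G i) x y * pdy l (?G r) x y)
      = (\<Sum>r\<in>UNIV. El i r * El r l) + Pr l * (2 * e i) + p * El i l
       + y $ i * ((\<Sum>r\<in>UNIV. Pr r * El r l) + Pr l * p + p * Pr l)
       + p * (El i l + Pr l * y $ i + p * kron i l)"
      unfolding eu k1 k2 .
    show "spray_curv ?G i l x y = spray_curv E i l x y + y $ i * X
    + kron i l * pfactor E P x y"
      unfolding spray_curv_def[of ?G] s1 s2 s3 Gx
      unfolding spray_curv_def[of E] pfactor_def X_def e_def[symmetric] p_def[symmetric]
        Pr_def[symmetric] El_def[symmetric] Prl_def[symmetric] Erl_def[symmetric]
      by (simp add: algebra_simps)
  qed
qed

section \<open>The curvature equation on lines through W\<close>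

abbreviation cc_rhs :: "real \<Rightarrow> 'n \<Rightarrow> 'n \<Rightarrow> 'n tbfun"
  where "cc_rhs K i l x y \<equiv> K * (Fk x y)\<^sup>2 * (kron i l - y $ i / Fk x y * Fl l x y)"

definition curv_const :: "real \<Rightarrow> bool"
  where "curv_const K \<longleftrightarrow> (\<forall>x y i l. (x, y) \<in> Dom \<longrightarrow>
    spray_curv Gk i l x y = cc_rhs K i l x y)"

definition Wv :: "real^'n \<Rightarrow> real^'n" where "Wv x = (\<chi> i. Wu i x)"

lemma low_Wv: "x \<in> U \<Longrightarrow> low x (Wv x) i = w x $ i"
  by (simp add: low_def Wv_def H_Wu)

lemma bet_Wv: "x \<in> U \<Longrightarrow> bet x (Wv x) = 1"
  by (simp add: bet_def Wv_def w_Wu)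

lemma bet_linear:
  "bet x (u + v) = bet x u + bet x v" "bet x (c *\<^sub>R v) = c * bet x v" "bet x (u - v) = bet x u - bet x v"
  by (simp_all add: bet_def algebra_simps sum.distrib sum_subtractf sum_distrib_left)

lemma g2_Wv: "x \<in> U \<Longrightarrow> g2 x y (Wv x) = bet x y" "x \<in> U \<Longrightarrow> g2 x (Wv x) y = bet x y"
proof -
  show "x \<in> U \<Longrightarrow> g2 x y (Wv x) = bet x y" by (simp add: g2_def low_Wv bet_def mult.commute)
  then show "x \<in> U \<Longrightarrow> g2 x (Wv x) y = bet x y" by (simp add: g2_sym[of x "Wv x"])
qed

text \<open>On this line \<open>bet\<close> is constantly 1, so its inverses disappear; inverses of
  \<open>g2 x y y\<close> are excluded by the flag \<open>False\<close>.\<close>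

lemma ratl_line_poly:
  assumes "ratl False f" and x: "x \<in> U" and v: "bet x v = 0"
  shows "\<exists>p. \<forall>t. f x (Wv x + t *\<^sub>R v) = poly p t"
  using assms(1)
proof (induction rule: ratl.induct)
  case (ratl_coef c)
  show ?case by (intro exI[of _ "[:c x:]"]) simp
next
  case (ratl_coord i)
  show ?case by (intro exI[of _ "[:Wv x $ i, v $ i:]"]) simp
next
  case (ratl_add f g)
  then obtain p q where "\<forall>t. f x (Wv x + t *\<^sub>R v) = poly p t" "\<forall>t. g x (Wv x + t *\<^sub>R v) = poly q t" by blast
  then show ?case by (intro exI[of _ "p + q"]) simp
next
  case (ratl_mult f g)
  then obtain p q where "\<forall>t. f x (Wv x + t *\<^sub>R v) = poly p t" "\<forall>t. g x (Wv x + t *\<^sub>R v) = poly q t" by blast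
  then show ?case by (intro exI[of _ "p * q"]) simp
next
  case ratl_inv_bet
  show ?case by (intro exI[of _ "1"]) (simp add: bet_linear bet_Wv x v)
next
  case (ratl_cong f g)
  have "(x, Wv x + t *\<^sub>R v) \<in> Dom" for t by (simp add: Dom_iff x bet_linear bet_Wv v)
  then have "f x (Wv x + t *\<^sub>R v) = g x (Wv x + t *\<^sub>R v)" for t by (rule ratl_cong.hyps)
  then show ?case using ratl_cong.IH by simp
qed simp

lemma homog_Fk: "homog 1 Fk"
proof -
  have *: "homog (1 + 1) (\<lambda>x y. g2 x y y)"
    unfolding g2_def low_def
    by (intro homog_sum homog_mult homog_coord) (use homog_mult[OF homog_coef[OF smooth_h] homog_coord] in auto)
  have "homog (1 + 1 + - 1) (\<lambda>x y. g2 x y y * inverse (bet x y))"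
    by (intro homog_mult homog_inv_bet *)
  then have h: "homog 1 (\<lambda>x y. (1 / 2) * (g2 x y y * inverse (bet x y)))"
    using homog_cmult by fastforce
  have "Fk = (\<lambda>x y. (1 / 2) * (g2 x y y * inverse (bet x y)))"
    by (intro ext) (simp add: Fk_def field_simps)
  with h show ?thesis by simp
qed

lemma homog_linear: "(\<And>j. smooth_fun_on U (c j)) \<Longrightarrow> homog 1 (\<lambda>x y. \<Sum>j\<in>UNIV. c j x * y $ j)"
  using homog_sum[of UNIV 1 "\<lambda>j x y. c j x * y $ j"] homog_mult[OF homog_coef homog_coord] by simp

lemma homog_quadratic:
  assumes "\<And>i j. smooth_fun_on U (c i j)"
  shows "homog 2 (\<lambda>x y. \<Sum>i\<in>UNIV. \<Sum>j\<in>UNIV. c i j x * y $ i * y $ j)"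
proof -
  have "homog (0 + 1 + 1) (\<lambda>x y. c i j x * y $ i * y $ j)" for i j
    by (intro homog_mult homog_coef homog_coord assms)
  then show ?thesis by (intro homog_sum) auto
qed

lemma homog_sv: "homog 1 (sv i)"
  unfolding sv_def[abs_def] by (intro homog_linear smooth_Su)

lemma homog_S0: "homog 1 S0"
proof -
  have "homog (0 + 1) (\<lambda>x y. w x $ i * sv i x y)" for i
    by (intro homog_mult homog_coef homog_sv smooth_w)
  then show ?thesis unfolding S0_def[abs_def] by (intro homog_sum) auto
qed

text \<open>As \<open>1 / F\<close> is \<open>2 * bet / g2 x y y\<close>, the term of
  \<open>mu\<close> with \<open>R00\<close>, taken along \<open>y\<close>, is the only one with
  \<open>g2 x y y\<close> in its denominator. It becomes \<open>Pp\<close>, and all the others are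
  kept here.\<close>

definition Ep :: "'n \<Rightarrow> 'n tbfun"
  where "Ep i x y = Gy i x y / 2 + R00 x y * Wu i x / 2 - Fk x y * sv i x y - S0 x y * y $ i + Fk x y * S0 x y * Wu i x"

definition Np :: "'n tbfun" where "Np x y = - (R00 x y * bet x y)"

definition Pp :: "'n tbfun" where "Pp x y = Np x y * inverse (g2 x y y)"

lemma Gk_split: assumes "(x, y) \<in> Dom" shows "Gk i x y = Ep i x y + Pp x y * y $ i"
proof -
  note P = Dom_pos[OF assms]
  have "mu x y * y $ i / 2 = R00 x y * bet x y * inverse (g2 x y y) * y $ i + S0 x y * y $ i"
    using P by (simp add: mu_def field_simps)
  moreover have "mu x y * Fk x y * Wu i x = R00 x y * Wu i x + 2 * Fk x y * S0 x y * Wu i x"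
    using P by (simp add: mu_def field_simps)
  ultimately show ?thesis
    by (simp add: Gk_def Ep_def Pp_def Np_def qv_def field_simps)
qed

lemma ratl_Gy: "ratl d (Gy i)"
  unfolding Gy_def[abs_def] by (intro ratl_sum ratl_mult ratl_coef ratl_coord smooth_Gm)

lemma ratl_R00: "ratl d R00"
  unfolding R00_def[abs_def] by (intro ratl_sum ratl_mult ratl_coef ratl_coord smooth_Rl)

lemma ratl_sv: "ratl d (sv i)"
  unfolding sv_def[abs_def] by (intro ratl_sum ratl_mult ratl_coef ratl_coord smooth_Su)

lemma ratl_S0: "ratl d S0"
  unfolding S0_def[abs_def] by (intro ratl_sum ratl_mult ratl_coef ratl_sv smooth_w)

lemma ratl_Np: "ratl d Np"
  unfolding Np_def[abs_def] by (intro ratl_uminus ratl_mult ratl_R00 ratl_bet)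

lemma ratl_Ep: "ratl d (Ep i)"
proof -
  have "ratl d (\<lambda>x y. (1/2) * Gy i x y + (1/2) * (R00 x y * Wu i x) - Fk x y * sv i x y - S0 x y * y $ i + Fk x y * S0 x y * Wu i x)"
    by (intro ratl_add ratl_diff ratl_mult ratl_const ratl_Gy ratl_R00 ratl_coef smooth_Wu ratl_Fk ratl_sv ratl_S0 ratl_coord)
  then show ?thesis by (rule ratl_cong) (simp add: Ep_def)
qed

lemma homog_Ep: "homog 2 (Ep i)"
proof -
  have "homog 2 (Gy i)" unfolding Gy_def[abs_def] by (intro homog_quadratic smooth_Gm)
  moreover have "homog 2 (\<lambda>x y. R00 x y * Wu i x)"
    using homog_mult[OF homog_quadratic[OF smooth_Rl] homog_coef[OF smooth_Wu]]
    by (simp add: R00_def[abs_def])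
  moreover have "homog 2 (\<lambda>x y. Fk x y * sv i x y)" using homog_mult[OF homog_Fk homog_sv] by simp
  moreover have "homog 2 (\<lambda>x y. S0 x y * y $ i)" using homog_mult[OF homog_S0 homog_coord] by simp
  moreover have "homog 2 (\<lambda>x y. Fk x y * S0 x y * Wu i x)"
    using homog_mult[OF homog_mult[OF homog_Fk homog_S0] homog_coef[OF smooth_Wu]] by simp
  ultimately have h: "homog 2 (\<lambda>x y. (1/2) * Gy i x y + (1/2) * (R00 x y * Wu i x) - Fk x y * sv i x y - S0 x y * y $ i + Fk x y * S0 x y * Wu i x)"
    by (intro homog_add homog_diff homog_cmult)
  have "Ep i = (\<lambda>x y. (1/2) * Gy i x y + (1/2) * (R00 x y * Wu i x) - Fk x y * sv i x y - S0 x y * y $ i + Fk x y * S0 x y * Wu i x)"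
    by (intro ext) (simp add: Ep_def)
  with h show ?thesis by simp
qed

lemma homog_Pp: "homog 1 Pp"
proof -
  have "homog (2 + 1) (\<lambda>x y. R00 x y * bet x y)"
    unfolding R00_def[abs_def] bet_def[abs_def]
    by (intro homog_mult homog_quadratic smooth_Rl homog_linear smooth_w)
  then have "homog (2 + 1 + - 2) (\<lambda>x y. (- 1 * (R00 x y * bet x y)) * inverse (g2 x y y))"
    by (intro homog_mult[OF homog_cmult homog_inv_A])
  then show ?thesis by (simp add: Pp_def[abs_def] Np_def)
qed

text \<open>The spray of \<open>E\<close> applied to \<open>\<alpha>\<^sup>2\<close>.\<close>

lemma Ep_A:
  assumes D: "(x, y) \<in> Dom"
  shows "(\<Sum>k\<in>UNIV. y $ k * dA k x y) - 4 * (\<Sum>r\<in>UNIV. low x y r * Ep r x y)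
    = - 2 * R00 x y * bet x y + 2 * g2 x y y * S0 x y"
proof -
  note P = Dom_pos[OF D]
  have "(\<Sum>r\<in>UNIV. low x y r * Ep r x y) = (\<Sum>r\<in>UNIV. low x y r * Gy r x y) / 2
      + R00 x y * (\<Sum>r\<in>UNIV. low x y r * Wu r x) / 2 - Fk x y * (\<Sum>r\<in>UNIV. low x y r * sv r x y)
      - S0 x y * (\<Sum>r\<in>UNIV. low x y r * y $ r) + Fk x y * S0 x y * (\<Sum>r\<in>UNIV. low x y r * Wu r x)"
    unfolding Ep_def sum_collect
    by (intro sum.cong refl) (simp add: algebra_simps)
  then show ?thesis
    unfolding low_sv[OF P(1)] low_Wu[OF P(1)] low_y y_Gy[OF P(1)] using P(6)
    by (simp add: algebra_simps)
qed

lemma Pp_derivatives: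
  assumes D: "(x, y) \<in> Dom"
  shows "pdy k Pp x y = pdy k Np x y * inverse (g2 x y y) - 2 * Np x y * low x y k * (inverse (g2 x y y))\<^sup>2"
    and "pdx k Pp x y = pdx k Np x y * inverse (g2 x y y) - Np x y * dA k x y * (inverse (g2 x y y))\<^sup>2"
  unfolding Pp_def[abs_def] using Dom_pos[OF D]
  by (auto intro!: pdy_eqI pdx_eqI derivative_eq_intros DX_A DY_A ratl_pdx(2)[OF ratl_Np D] ratl_pdy(2)[OF ratl_Np D]
      simp: power2_eq_square)

text \<open>The coefficient 3 is one from the square of \<open>Pp\<close> plus two from
  differentiating \<open>1 / g2\<close> along the spray, which by \<open>Ep_A\<close> contributes
  \<open>2 * Np\<close> modulo \<open>g2 x y y\<close>.\<close>

lemma projective_factor: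
  assumes D: "(x, y) \<in> Dom"
  shows "(g2 x y y)\<^sup>2 * pfactor Ep Pp x y
    = 3 * (Np x y)\<^sup>2 + g2 x y y * (2 * (\<Sum>r\<in>UNIV. pdy r Np x y * Ep r x y) - (\<Sum>k\<in>UNIV. y $ k * pdx k Np x y)
       + 2 * Np x y * S0 x y)"
proof -
  note P = Dom_pos[OF D]
  define J where "J = inverse (g2 x y y)"
  have AJ: "g2 x y y * J = 1" using P(4) by (simp add: J_def)
  have 1: "(\<Sum>r\<in>UNIV. pdy r Pp x y * Ep r x y) = (\<Sum>r\<in>UNIV. pdy r Np x y * Ep r x y) * J
     - 2 * Np x y * (\<Sum>r\<in>UNIV. low x y r * Ep r x y) * J\<^sup>2"
    unfolding Pp_derivatives[OF D] J_def[symmetric] sum_collect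
    by (intro sum.cong refl) (simp add: algebra_simps)
  have 2: "(\<Sum>k\<in>UNIV. y $ k * pdx k Pp x y) = (\<Sum>k\<in>UNIV. y $ k * pdx k Np x y) * J
     - Np x y * (\<Sum>k\<in>UNIV. y $ k * dA k x y) * J\<^sup>2"
    unfolding Pp_derivatives[OF D] J_def[symmetric] sum_collect
    by (intro sum.cong refl) (simp add: algebra_simps)
  define M where "M = 2 * (\<Sum>r\<in>UNIV. pdy r Np x y * Ep r x y) - (\<Sum>k\<in>UNIV. y $ k * pdx k Np x y)"
  have Z: "pfactor Ep Pp x y
    = (Np x y)\<^sup>2 * J\<^sup>2 + M * J + Np x y * J\<^sup>2 * ((\<Sum>k\<in>UNIV. y $ k * dA k x y) - 4 * (\<Sum>r\<in>UNIV. low x y r * Ep r x y))"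
    unfolding pfactor_def 1 2 M_def Pp_def J_def[symmetric] by (simp add: algebra_simps power2_eq_square)
  have N: "- 2 * R00 x y * bet x y = 2 * Np x y" by (simp add: Np_def)
  have alg: "A\<^sup>2 * (n\<^sup>2 * J\<^sup>2 + m * J + n * J\<^sup>2 * (2 * n + 2 * A * S)) = n\<^sup>2 * (A * J)\<^sup>2 + A * m * (A * J)
      + n * (A * J)\<^sup>2 * (2 * n + 2 * A * S)" for A n m S :: real
    by (simp add: algebra_simps power2_eq_square)
  show ?thesis unfolding Z Ep_A[OF D] N alg AJ M_def by (simp add: algebra_simps power2_eq_square)
qed

text \<open>A covector annihilating \<open>y\<close> removes both the implicit multiple of
  \<open>y\<close> in \<open>projective_change\<close> and the term with l^i l_l in the curvature
  equation.\<close>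

lemma contracted_curvature:
  assumes C: "curv_const K" and D: "(x, y) \<in> Dom" and th: "(\<Sum>i\<in>UNIV. th i * y $ i) = 0"
  shows "(\<Sum>i\<in>UNIV. th i * spray_curv Ep i l x y) + th l * pfactor Ep Pp x y = K * (Fk x y)\<^sup>2 * th l"
proof -
  note P = Dom_pos[OF D]
  have "spray_curv Gk i l x y = spray_curv (\<lambda>i x y. Ep i x y + Pp x y * y $ i) i l x y" for i
    by (rule spray_curv_cong[OF slice_open_Dom D]) (rule Gk_split)
  then obtain X where X: "spray_curv Gk i l x y = spray_curv Ep i l x y + y $ i * X
      + kron i l * pfactor Ep Pp x y" for i
    using projective_change[of Ep Pp x y l, OF homog_Ep homog_Pp D] by auto
  have k: "(\<Sum>i\<in>UNIV. th i * kron i l) = th l" by (rule sum_kron)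
  have "(\<Sum>i\<in>UNIV. th i * spray_curv Gk i l x y) = (\<Sum>i\<in>UNIV. th i * spray_curv Ep i l x y)
      + (\<Sum>i\<in>UNIV. th i * y $ i) * X + (\<Sum>i\<in>UNIV. th i * kron i l) * pfactor Ep Pp x y"
    unfolding X sum_collect
    by (intro sum.cong refl) (simp add: algebra_simps)
  moreover have "(\<Sum>i\<in>UNIV. th i * spray_curv Gk i l x y)
     = K * (Fk x y)\<^sup>2 * (\<Sum>i\<in>UNIV. th i * kron i l) - K * Fk x y * Fl l x y * (\<Sum>i\<in>UNIV. th i * y $ i)"
  proof -
    have eq: "spray_curv Gk i l x y = K * (Fk x y)\<^sup>2 * kron i l - K * Fk x y * Fl l x y * y $ i" for i
    proof -
      have "spray_curv Gk i l x y = cc_rhs K i l x y"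
        using C D by (auto simp: curv_const_def)
      then show ?thesis using P(5) by (simp add: right_diff_distrib power2_eq_square del: mult_cancel_left)
    qed
    show ?thesis
      unfolding eq sum_collect
      by (intro sum.cong refl) (simp only: right_diff_distrib mult_ac)
  qed
  ultimately show ?thesis unfolding th k by simp
qed

text \<open>At the imaginary unit the identity says that a i - b squares to zero. In real terms, the
  remainder of the first summand modulo 1 + t^2 has degree below two and must vanish.\<close>

lemma dvd_one_plus_square:
  fixes a b :: real
  assumes "\<And>t. 3 * (a * t + b * t\<^sup>2)\<^sup>2 + (1 + t\<^sup>2) * poly q t = 0"
  shows "a = 0 \<and> b = 0"
proof -
  have "poly ([:1, 0, 1:] * (- q)) t = poly ([:0, 0, 3 * a * a, 6 * a * b, 3 * b * b:]) t" for t
    using assms[of t] by (simp add: algebra_simps power2_eq_square)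
  then have eq: "[:1, 0, 1:] * (- q) = [:0, 0, 3 * a * a, 6 * a * b, 3 * b * b:]"
    using poly_eq_poly_eq_iff by blast
  \<comment> \<open>The polynomial subtracted from \<open>- q\<close> is the quotient in the long
    division by 1 + t^2, and the right side is the remainder.\<close>
  have "[:1, 0, 1:] * (- q - [:3 * a * a - 3 * b * b, 6 * a * b, 3 * b * b:]) = [:3 * b * b - 3 * a * a, - (6 * a * b):]"
    unfolding right_diff_distrib eq by simp
  then have "[:1, 0, 1:] dvd [:3 * b * b - 3 * a * a, - (6 * a * b):]" by (metis dvd_triv_left)
  then have "[:3 * b * b - 3 * a * a, - (6 * a * b):] = 0"
    using dvd_imp_degree_le[of "[:1, 0, 1:]" "[:3 * b * b - 3 * a * a, - (6 * a * b):]"]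
    by (cases "[:3 * b * b - 3 * a * a, - (6 * a * b):] = 0") (auto split: if_splits)
  then have "b * b = a * a" "a * b = 0" by auto
  then show ?thesis by auto
qed

lemma R00_parts:
  assumes x: "x \<in> U"
  shows "R00 x (u + c *\<^sub>R v) = R00 x u + 2 * c * (\<Sum>i\<in>UNIV. \<Sum>j\<in>UNIV. Rl i j x * u $ i * v $ j) + c\<^sup>2 * R00 x v"
proof -
  have "(\<Sum>i\<in>UNIV. \<Sum>j\<in>UNIV. Rl i j x * v $ i * u $ j) = (\<Sum>i\<in>UNIV. \<Sum>j\<in>UNIV. Rl i j x * u $ i * v $ j)"
    by (subst sum.swap) (simp add: Rl_def add.commute mult_ac)
  moreover have "R00 x (u + c *\<^sub>R v) = R00 x u + c * (\<Sum>i\<in>UNIV. \<Sum>j\<in>UNIV. Rl i j x * v $ i * u $ j)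
      + c * (\<Sum>i\<in>UNIV. \<Sum>j\<in>UNIV. Rl i j x * u $ i * v $ j) + c\<^sup>2 * R00 x v"
    unfolding R00_def sum_collect
    by (intro sum.cong refl) (simp add: algebra_simps power2_eq_square)
  ultimately show ?thesis by simp
qed

lemma R00_Wv: assumes x: "x \<in> U" shows "R00 x (Wv x) = 0"
proof -
  have "(\<Sum>i\<in>UNIV. \<Sum>j\<in>UNIV. cov i j x * Wu i x * Wu j x) = (\<Sum>j\<in>UNIV. \<Sum>i\<in>UNIV. cov i j x * Wu i x * Wu j x)"
    by (rule sum.swap)
  also have "\<dots> = (\<Sum>j\<in>UNIV. (\<Sum>i\<in>UNIV. Wu i x * cov i j x) * Wu j x)"
    by (simp add: sum_distrib_right sum_distrib_left mult_ac)
  finally have 0: "(\<Sum>i\<in>UNIV. \<Sum>j\<in>UNIV. cov i j x * Wu i x * Wu j x) = 0" by (simp add: Wu_cov[OF x])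
  have "R00 x (Wv x) = (\<Sum>i\<in>UNIV. \<Sum>j\<in>UNIV. cov i j x * Wu i x * Wu j x) / 2 + (\<Sum>i\<in>UNIV. \<Sum>j\<in>UNIV. cov j i x * Wu i x * Wu j x) / 2"
    unfolding R00_def Wv_def Rl_def sum_collect
    by (intro sum.cong refl) (simp add: field_simps)
  also have "(\<Sum>i\<in>UNIV. \<Sum>j\<in>UNIV. cov j i x * Wu i x * Wu j x) = (\<Sum>i\<in>UNIV. \<Sum>j\<in>UNIV. cov i j x * Wu i x * Wu j x)"
    by (subst sum.swap) (simp add: mult_ac)
  finally show ?thesis unfolding 0 by simp
qed

lemma R00_on_plane:
  assumes C: "curv_const K" and x: "x \<in> U" and v: "bet x v = 0" "g2 x v v = 1"
  shows "(\<Sum>i\<in>UNIV. \<Sum>j\<in>UNIV. Rl i j x * Wv x $ i * v $ j) = 0 \<and> R00 x v = 0"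
proof -
  define y where "y t = Wv x + t *\<^sub>R v" for t
  \<comment> \<open>A quarter turn of \<open>y t\<close> in the plane of the orthonormal pair
    \<open>W\<close>, \<open>v\<close>, lowered to a covector. It annihilates \<open>y t\<close> and
    pairs to 1 with \<open>v\<close>, which leaves the projective factor with coefficient 1.\<close>
  define th where "th t i = low x (v - t *\<^sub>R Wv x) i" for t i
  have D: "(x, y t) \<in> Dom" for t by (simp add: Dom_iff x y_def bet_linear bet_Wv v)
  have by1: "bet x (y t) = 1" for t by (simp add: y_def bet_linear bet_Wv x v)
  have A: "g2 x (y t) (y t) = 1 + t\<^sup>2" for t
    using x v by (simp add: y_def g2_bilinear g2_Wv bet_Wv power2_eq_square)
  have thy: "(\<Sum>i\<in>UNIV. th t i * y t $ i) = 0" for t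
  proof -
    have "(\<Sum>i\<in>UNIV. th t i * y t $ i) = g2 x (y t) (v - t *\<^sub>R Wv x)"
      by (simp add: g2_def th_def mult.commute)
    also have "\<dots> = 0" using x v by (simp add: y_def g2_bilinear g2_Wv bet_Wv)
    finally show ?thesis .
  qed
  have thv: "(\<Sum>l\<in>UNIV. th t l * v $ l) = 1" for t
  proof -
    have "(\<Sum>i\<in>UNIV. th t i * v $ i) = g2 x v (v - t *\<^sub>R Wv x)"
      by (simp add: g2_def th_def mult.commute)
    also have "\<dots> = 1" using x v by (simp add: g2_bilinear g2_Wv)
    finally show ?thesis .
  qed
  \<comment> \<open>\<open>th t\<close> depends on \<open>t\<close>, so the contracted curvature is
    split as \<open>g1 - t * g2'\<close>: here the covectors are constants and the sums belong to
    \<open>ratl False\<close>.\<close>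
  define g1 where "g1 = (\<lambda>x' y'. \<Sum>l\<in>UNIV. \<Sum>i\<in>UNIV. low x v i * spray_curv Ep i l x' y' * v $ l)"
  define g2' where "g2' = (\<lambda>x' y'. \<Sum>l\<in>UNIV. \<Sum>i\<in>UNIV. low x (Wv x) i * spray_curv Ep i l x' y' * v $ l)"
  define g3 where "g3 = (\<lambda>x y. 2 * (\<Sum>r\<in>UNIV. pdy r Np x y * Ep r x y) - (\<Sum>k\<in>UNIV. y $ k * pdx k Np x y)
       + 2 * Np x y * S0 x y)"
  have "ratl False g1" "ratl False g2'" "ratl False g3"
    unfolding g1_def g2'_def g3_def
    by (intro ratl_sum ratl_add ratl_diff ratl_mult ratl_const ratl_spray_curv ratl_Ep ratl_pdy ratl_pdx ratl_Np
        ratl_coord ratl_S0)+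
  then obtain p1 p2 p3 pF where p: "\<And>t. g1 x (y t) = poly p1 t" "\<And>t. g2' x (y t) = poly p2 t"
    "\<And>t. g3 x (y t) = poly p3 t" "\<And>t. Fk x (y t) = poly pF t"
    unfolding y_def using ratl_line_poly[OF _ x v(1)] ratl_Fk by metis
  define a where "a = 2 * (\<Sum>i\<in>UNIV. \<Sum>j\<in>UNIV. Rl i j x * Wv x $ i * v $ j)"
  define b where "b = R00 x v"
  have Ny: "Np x (y t) = - (a * t + b * t\<^sup>2)" for t
  proof -
    have "R00 x (y t) = a * t + b * t\<^sup>2"
      unfolding y_def a_def b_def R00_parts[OF x, of "Wv x" t v] R00_Wv[OF x] by simp
    then show ?thesis by (simp add: Np_def by1)
  qed
  \<comment> \<open>This cofactor of 1 + t^2 results from eliminating the projective factor between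
    \<open>contracted_curvature\<close> and \<open>projective_factor\<close>.\<close>
  have "3 * (a * t + b * t\<^sup>2)\<^sup>2 + (1 + t\<^sup>2) * poly (p3 + [:1, 0, 1:] * (p1 - [:0, 1:] * p2 - [:K:] * pF * pF)) t = 0" for t
  proof -
    define Z where "Z = pfactor Ep Pp x (y t)"
    have "(\<Sum>l\<in>UNIV. (\<Sum>i\<in>UNIV. th t i * spray_curv Ep i l x (y t)) * v $ l) + (\<Sum>l\<in>UNIV. th t l * v $ l) * Z
       = K * (Fk x (y t))\<^sup>2 * (\<Sum>l\<in>UNIV. th t l * v $ l)"
    proof -
      have "(\<Sum>i\<in>UNIV. th t i * spray_curv Ep i l x (y t)) + th t l * Z = K * (Fk x (y t))\<^sup>2 * th t l" for l
        using contracted_curvature[OF C D thy] unfolding Z_def .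
      then have "((\<Sum>i\<in>UNIV. th t i * spray_curv Ep i l x (y t)) + th t l * Z) * v $ l
          = (K * (Fk x (y t))\<^sup>2 * th t l) * v $ l" for l by simp
      then have "(\<Sum>i\<in>UNIV. th t i * spray_curv Ep i l x (y t)) * v $ l + (th t l * v $ l) * Z
          = K * (Fk x (y t))\<^sup>2 * (th t l * v $ l)" for l
        by (simp only: distrib_right distrib_left mult_ac)
      then show ?thesis
        unfolding sum_distrib_right[of "\<lambda>l. th t l * v $ l"] sum_distrib_left[of "K * (Fk x (y t))\<^sup>2"] sum.distrib[symmetric]
        by (intro sum.cong refl)
    qed
    moreover have "(\<Sum>l\<in>UNIV. (\<Sum>i\<in>UNIV. th t i * spray_curv Ep i l x (y t)) * v $ l) = g1 x (y t) - t * g2' x (y t)"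
      unfolding g1_def g2'_def th_def low_linear sum_collect
      by (intro sum.cong refl) (simp add: algebra_simps)
    ultimately have Z: "Z = K * (Fk x (y t))\<^sup>2 - (g1 x (y t) - t * g2' x (y t))" unfolding thv by simp
    have "(1 + t\<^sup>2)\<^sup>2 * Z = 3 * (a * t + b * t\<^sup>2)\<^sup>2 + (1 + t\<^sup>2) * g3 x (y t)"
      using projective_factor[OF D, of t] unfolding Z_def[symmetric] A Ny g3_def power2_minus .
    then show ?thesis unfolding Z p by (simp add: algebra_simps power2_eq_square)
  qed
  from dvd_one_plus_square[OF this] show ?thesis by (simp add: a_def b_def)
qed

text \<open>Vectors orthogonal to \<open>W\<close> are scaled to unit length for
  \<open>R00_on_plane\<close>. A general \<open>y\<close> is such a vector plus a multiple of
  \<open>W\<close>, and all parts of the quadratic form vanish.\<close>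

theorem killing_of_curv_const:
  assumes C: "curv_const K" and x: "x \<in> U"
  shows "killing_at x"
proof -
  have perp: "(\<Sum>i\<in>UNIV. \<Sum>j\<in>UNIV. Rl i j x * Wv x $ i * v $ j) = 0 \<and> R00 x v = 0" if v: "bet x v = 0" for v
  proof (cases "v = 0")
    case True
    then show ?thesis by (simp add: R00_def)
  next
    case False
    define c where "c = 1 / sqrt (g2 x v v)"
    have pos: "g2 x v v > 0" using g2_pos[OF x False] .
    have c0: "c \<noteq> 0" and cc: "c * c * g2 x v v = 1" using pos by (simp_all add: c_def)
    have "(\<Sum>i\<in>UNIV. \<Sum>j\<in>UNIV. Rl i j x * Wv x $ i * (c *\<^sub>R v) $ j) = 0 \<and> R00 x (c *\<^sub>R v) = 0"
      using cc v by (intro R00_on_plane[OF C x]) (auto simp: bet_linear g2_bilinear mult_ac)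
    moreover have "(\<Sum>i\<in>UNIV. \<Sum>j\<in>UNIV. Rl i j x * Wv x $ i * (c *\<^sub>R v) $ j)
       = c * (\<Sum>i\<in>UNIV. \<Sum>j\<in>UNIV. Rl i j x * Wv x $ i * v $ j)"
      by (simp add: sum_distrib_left mult_ac)
    moreover have "R00 x (c *\<^sub>R v) = c * c * R00 x v"
      by (simp add: R00_def sum_distrib_left mult_ac)
    ultimately show ?thesis using c0 by simp
  qed
  have "R00 x y = 0" for y
  proof -
    define v where "v = y - bet x y *\<^sub>R Wv x"
    have v: "bet x v = 0" by (simp add: v_def bet_linear bet_Wv x)
    have y: "y = bet x y *\<^sub>R Wv x + 1 *\<^sub>R v" by (simp add: v_def)
    have "R00 x (bet x y *\<^sub>R Wv x + 1 *\<^sub>R v) = R00 x (bet x y *\<^sub>R Wv x)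
        + 2 * (\<Sum>i\<in>UNIV. \<Sum>j\<in>UNIV. Rl i j x * (bet x y *\<^sub>R Wv x) $ i * v $ j) + R00 x v"
      using R00_parts[OF x, of "bet x y *\<^sub>R Wv x" 1 v] by simp
    also have "(\<Sum>i\<in>UNIV. \<Sum>j\<in>UNIV. Rl i j x * (bet x y *\<^sub>R Wv x) $ i * v $ j)
        = bet x y * (\<Sum>i\<in>UNIV. \<Sum>j\<in>UNIV. Rl i j x * Wv x $ i * v $ j)"
      by (simp add: sum_distrib_left mult_ac)
    also have "R00 x (bet x y *\<^sub>R Wv x) = bet x y * bet x y * R00 x (Wv x)"
      by (simp add: R00_def sum_distrib_left mult_ac)
    finally show ?thesis using perp[OF v] y by (simp add: R00_Wv[OF x])
  qed
  then have "Rl i j x + Rl j i x = 0" for i j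
    unfolding R00_def by (rule quadratic_zero_imp)
  then have "cov i j x + cov j i x = 0" for i j
    by (simp add: Rl_def add.commute)
  then show ?thesis by (simp add: killing_at_def)
qed

end

section \<open>Curvature when the unit field is Killing\<close>

context unit_covector begin

section \<open>Connection and curvature of h contracted with y\<close>

definition Gl :: "'n \<Rightarrow> 'n \<Rightarrow> 'n tbfun" where "Gl i l x y = (\<Sum>j\<in>UNIV. Gm i l j x * y $ j)"

text \<open>\<open>DS i l k\<close> is \<open>S\<^sup>i\<^sub>l\<^sub>|\<^sub>|\<^sub>k\<close>; \<open>dS\<close>, \<open>dG\<close> and \<open>dGl\<close> are \<open>x\<close>-derivatives of \<open>sv\<close>, \<open>Gy\<close> and \<open>Gl\<close>.\<close>

definition DS :: "'n \<Rightarrow> 'n \<Rightarrow> 'n \<Rightarrow> real^'n \<Rightarrow> real"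
  where "DS i l k x = pd k (Su i l) x + (\<Sum>m\<in>UNIV. Gm i k m x * Su m l x) - (\<Sum>m\<in>UNIV. Gm m k l x * Su i m x)"

definition dS :: "'n \<Rightarrow> 'n \<Rightarrow> 'n tbfun" where "dS i k x y = (\<Sum>j\<in>UNIV. pd k (Su i j) x * y $ j)"

definition dG :: "'n \<Rightarrow> 'n \<Rightarrow> 'n tbfun"
  where "dG i l x y = (\<Sum>j\<in>UNIV. \<Sum>k\<in>UNIV. pd l (Gm i j k) x * y $ j * y $ k)"

definition dGl :: "'n \<Rightarrow> 'n \<Rightarrow> 'n \<Rightarrow> 'n tbfun"
  where "dGl i l k x y = (\<Sum>j\<in>UNIV. pd k (Gm i l j) x * y $ j)"

lemma DX_Gy: "x \<in> U \<Longrightarrow> ((\<lambda>t. Gy i (x + t *\<^sub>R axis l 1) y) has_real_derivative dG i l x y) (at 0)"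
  unfolding Gy_def dG_def by (auto intro!: derivative_eq_intros smooth_DERIV[OF smooth_Gm])

lemma DX_Gl: "x \<in> U \<Longrightarrow> ((\<lambda>t. Gl i l (x + t *\<^sub>R axis k 1) y) has_real_derivative dGl i l k x y) (at 0)"
  unfolding Gl_def dGl_def by (auto intro!: derivative_eq_intros smooth_DERIV[OF smooth_Gm])

lemma DY_Gl: "((\<lambda>t. Gl i r x (y + t *\<^sub>R axis l 1)) has_real_derivative Gm i r l x) (at 0)"
  unfolding Gl_def by (auto intro!: derivative_eq_intros DERIV_coord simp del: vector_add_component)

lemma Gy_Gl: "Gy i x y = (\<Sum>j\<in>UNIV. Gl i j x y * y $ j)"
  unfolding Gy_def Gl_def sum_distrib_right by (simp add: mult_ac)

lemma DY_Gy: assumes "x \<in> U"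
  shows "((\<lambda>t. Gy i x (y + t *\<^sub>R axis l 1)) has_real_derivative 2 * Gl i l x y) (at 0)"
proof -
  have "((\<lambda>t. Gy i x (y + t *\<^sub>R axis l 1)) has_real_derivative
      (\<Sum>j\<in>UNIV. Gl i j x y * kron j l + Gm i j l x * y $ j)) (at 0)"
    unfolding Gy_Gl
    by (auto intro!: derivative_eq_intros DERIV_coord DY_Gl sum.cong simp del: vector_add_component)
  moreover have "(\<Sum>j\<in>UNIV. Gl i j x y * kron j l + Gm i j l x * y $ j) = 2 * Gl i l x y"
    by (simp only: sum.distrib sum_kron) (simp add: Gl_def Gm_sym[OF assms, of _ _ l])
  ultimately show ?thesis by simp
qed

lemma DX_sv: "x \<in> U \<Longrightarrow> ((\<lambda>t. sv i (x + t *\<^sub>R axis k 1) y) has_real_derivative dS i k x y) (at 0)"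
  unfolding sv_def dS_def by (auto intro!: derivative_eq_intros smooth_DERIV[OF smooth_Su])

lemma DY_sv: "((\<lambda>t. sv i x (y + t *\<^sub>R axis l 1)) has_real_derivative Su i l x) (at 0)"
  unfolding sv_def by (auto intro!: derivative_eq_intros DERIV_coord simp del: vector_add_component)

lemma low_Gl: assumes x: "x \<in> U" shows "(\<Sum>r\<in>UNIV. low x y r * Gl r l x y) = dA l x y / 2"
proof -
  have 1: "(\<Sum>i\<in>UNIV. y $ i * (\<Sum>j\<in>UNIV. (\<Sum>m\<in>UNIV. H i m x * Gm m l j x) * y $ j)) = (\<Sum>r\<in>UNIV. low x y r * Gl r l x y)"
    unfolding sum_contract_swap[symmetric] Gl_def[symmetric] unfolding sum_contract_swap low_alt[OF x] ..
  have "dA l x y = (\<Sum>i\<in>UNIV. \<Sum>j\<in>UNIV. (\<Sum>m\<in>UNIV. H i m x * Gm m l j x) * y $ i * y $ j)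
     + (\<Sum>i\<in>UNIV. \<Sum>j\<in>UNIV. (\<Sum>m\<in>UNIV. H j m x * Gm m l i x) * y $ i * y $ j)"
    unfolding dA_def metric_compat[OF x] by (simp add: distrib_right sum.distrib)
  also have "(\<Sum>i\<in>UNIV. \<Sum>j\<in>UNIV. (\<Sum>m\<in>UNIV. H j m x * Gm m l i x) * y $ i * y $ j)
     = (\<Sum>i\<in>UNIV. \<Sum>j\<in>UNIV. (\<Sum>m\<in>UNIV. H i m x * Gm m l j x) * y $ i * y $ j)"
    by (subst sum.swap) (simp add: mult_ac)
  finally show ?thesis unfolding 1[symmetric] by (simp add: sum_distrib_left mult_ac)
qed

lemma w_Gl: "dB l x y - (\<Sum>r\<in>UNIV. w x $ r * Gl r l x y) = (\<Sum>i\<in>UNIV. y $ i * cov i l x)" if x: "x \<in> U"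
proof -
  have "(\<Sum>r\<in>UNIV. w x $ r * Gl r l x y) = (\<Sum>i\<in>UNIV. y $ i * (\<Sum>r\<in>UNIV. Gm r i l x * w x $ r))"
    unfolding Gl_def by (subst sum_contract_swap) (simp add: Gm_sym[OF x, of _ l] mult.commute)
  then show ?thesis unfolding dB_def covd_def by (simp add: right_diff_distrib sum_subtractf mult.commute)
qed

text \<open>The right side is \<open>spray_curv\<close> of the geodesic spray \<open>Gy / 2\<close>
  of \<open>h\<close>, the left side the Jacobi operator of \<open>h\<close>.\<close>

lemma riem_y_y:
  assumes x: "x \<in> U"
  shows "(\<Sum>k\<in>UNIV. \<Sum>j\<in>UNIV. riem h i k l j x * y $ k * y $ j)
    = dG i l x y - (\<Sum>k\<in>UNIV. y $ k * dGl i l k x y) + (\<Sum>r\<in>UNIV. Gy r x y * Gm i r l x)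
      - (\<Sum>r\<in>UNIV. Gl i r x y * Gl r l x y)"
proof -
  have 1: "dG i l x y = (\<Sum>k\<in>UNIV. \<Sum>j\<in>UNIV. pd l (Gm i j k) x * y $ k * y $ j)"
    unfolding dG_def by (subst sum.swap) (simp add: mult_ac)
  have pdG: "pd a (Gm i b c) x = pd a (Gm i c b) x" for a b c
    by (rule pd_cong_open[OF openU x]) (rule Gm_sym)
  have 2: "(\<Sum>k\<in>UNIV. y $ k * dGl i l k x y) = (\<Sum>k\<in>UNIV. \<Sum>j\<in>UNIV. pd j (Gm i l k) x * y $ k * y $ j)"
    unfolding dGl_def sum_distrib_left by (subst sum.swap) (simp add: mult_ac)
  have 3: "(\<Sum>r\<in>UNIV. Gy r x y * Gm i r l x) = (\<Sum>k\<in>UNIV. \<Sum>j\<in>UNIV. (\<Sum>m\<in>UNIV. Gm i l m x * Gm m j k x) * y $ k * y $ j)"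
  proof -
    have "(\<Sum>r\<in>UNIV. Gy r x y * Gm i r l x) = (\<Sum>m\<in>UNIV. \<Sum>k\<in>UNIV. \<Sum>j\<in>UNIV. Gm i l m x * Gm m j k x * y $ k * y $ j)"
      unfolding Gy_def sum_distrib_right by (simp add: Gm_sym[OF x, of i l] Gm_sym[OF x, of _ _] mult_ac cong: sum.cong)
    also have "\<dots> = (\<Sum>k\<in>UNIV. \<Sum>j\<in>UNIV. \<Sum>m\<in>UNIV. Gm i l m x * Gm m j k x * y $ k * y $ j)"
      by (rule sum3_rotate)
    finally show ?thesis by (simp add: sum_distrib_right)
  qed
  have 4: "(\<Sum>r\<in>UNIV. Gl i r x y * Gl r l x y) = (\<Sum>k\<in>UNIV. \<Sum>j\<in>UNIV. (\<Sum>m\<in>UNIV. Gm i j m x * Gm m l k x) * y $ k * y $ j)"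
  proof -
    have "(\<Sum>r\<in>UNIV. Gl i r x y * Gl r l x y) = (\<Sum>m\<in>UNIV. \<Sum>k\<in>UNIV. \<Sum>j\<in>UNIV. Gm i j m x * Gm m l k x * y $ k * y $ j)"
    proof (rule sum.cong[OF refl])
      fix m
      have "Gl i m x y * Gl m l x y = Gl m l x y * Gl i m x y" by simp
      also have "\<dots> = (\<Sum>k\<in>UNIV. \<Sum>j\<in>UNIV. Gm i j m x * Gm m l k x * y $ k * y $ j)"
        unfolding Gl_def sum_product by (simp add: Gm_sym[OF x, of i m] mult_ac)
      finally show "Gl i m x y * Gl m l x y = (\<Sum>k\<in>UNIV. \<Sum>j\<in>UNIV. Gm i j m x * Gm m l k x * y $ k * y $ j)" .
    qed
    also have "\<dots> = (\<Sum>k\<in>UNIV. \<Sum>j\<in>UNIV. \<Sum>m\<in>UNIV. Gm i j m x * Gm m l k x * y $ k * y $ j)"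
      by (rule sum3_rotate)
    finally show ?thesis by (simp add: sum_distrib_right)
  qed
  show ?thesis
    unfolding 1 2 3 4 riem_def sum.distrib[symmetric] sum_subtractf[symmetric]
    by (intro sum.cong refl) (simp add: algebra_simps sum_subtractf)
qed

lemma DS_contract:
  assumes x: "x \<in> U"
  shows "(\<Sum>k\<in>UNIV. DS i l k x * y $ k) = (\<Sum>k\<in>UNIV. y $ k * pd k (Su i l) x)
      + (\<Sum>m\<in>UNIV. Gl i m x y * Su m l x) - (\<Sum>m\<in>UNIV. Su i m x * Gl m l x y)"
    and "(\<Sum>j\<in>UNIV. DS i j l x * y $ j) = dS i l x y + (\<Sum>m\<in>UNIV. sv m x y * Gm i m l x) - (\<Sum>m\<in>UNIV. Su i m x * Gl m l x y)"
proof -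
  have 1: "(\<Sum>k\<in>UNIV. (\<Sum>m\<in>UNIV. Gm i k m x * Su m l x) * y $ k) = (\<Sum>m\<in>UNIV. Gl i m x y * Su m l x)"
  proof -
    have "(\<Sum>k\<in>UNIV. (\<Sum>m\<in>UNIV. Su m l x * Gm i m k x) * y $ k) = (\<Sum>m\<in>UNIV. Su m l x * Gl i m x y)"
      unfolding Gl_def by (rule sum_contract_swap[symmetric])
    then show ?thesis by (simp add: Gm_sym[OF x, of i] mult.commute)
  qed
  have 2: "(\<Sum>k\<in>UNIV. (\<Sum>m\<in>UNIV. Gm m k l x * Su i m x) * y $ k) = (\<Sum>m\<in>UNIV. Su i m x * Gl m l x y)"
    unfolding Gl_def sum_contract_swap by (simp add: Gm_sym[OF x, of _ _ l] mult.commute)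
  show "(\<Sum>k\<in>UNIV. DS i l k x * y $ k) = (\<Sum>k\<in>UNIV. y $ k * pd k (Su i l) x)
      + (\<Sum>m\<in>UNIV. Gl i m x y * Su m l x) - (\<Sum>m\<in>UNIV. Su i m x * Gl m l x y)"
    unfolding DS_def distrib_right left_diff_distrib sum.distrib sum_subtractf 1 2 by (simp add: mult.commute)
  have 3: "(\<Sum>j\<in>UNIV. (\<Sum>m\<in>UNIV. Gm i l m x * Su m j x) * y $ j) = (\<Sum>m\<in>UNIV. sv m x y * Gm i m l x)"
  proof -
    have "(\<Sum>j\<in>UNIV. (\<Sum>m\<in>UNIV. Gm i l m x * Su m j x) * y $ j) = (\<Sum>m\<in>UNIV. Gm i l m x * sv m x y)"
      unfolding sv_def by (rule sum_contract_swap[symmetric])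
    then show ?thesis by (simp add: Gm_sym[OF x, of i l] mult.commute)
  qed
  have 4: "(\<Sum>j\<in>UNIV. (\<Sum>m\<in>UNIV. Gm m l j x * Su i m x) * y $ j) = (\<Sum>m\<in>UNIV. Su i m x * Gl m l x y)"
    unfolding Gl_def sum_contract_swap by (simp add: mult.commute)
  show "(\<Sum>j\<in>UNIV. DS i j l x * y $ j) = dS i l x y + (\<Sum>m\<in>UNIV. sv m x y * Gm i m l x) - (\<Sum>m\<in>UNIV. Su i m x * Gl m l x y)"
    unfolding DS_def dS_def by (simp add: distrib_right left_diff_distrib sum.distrib sum_subtractf 3 4)
qed

lemma DS_contract2:
  assumes x: "x \<in> U"
  shows "(\<Sum>l\<in>UNIV. (\<Sum>j\<in>UNIV. DS i j l x * y $ j) * y $ l) = (\<Sum>k\<in>UNIV. y $ k * dS i k x y)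
     + (\<Sum>m\<in>UNIV. Gl i m x y * sv m x y) - (\<Sum>m\<in>UNIV. Gy m x y * Su i m x)"
proof -
  have 1: "(\<Sum>l\<in>UNIV. (\<Sum>m\<in>UNIV. sv m x y * Gm i m l x) * y $ l) = (\<Sum>m\<in>UNIV. Gl i m x y * sv m x y)"
  proof -
    have "(\<Sum>l\<in>UNIV. (\<Sum>m\<in>UNIV. sv m x y * Gm i m l x) * y $ l) = (\<Sum>m\<in>UNIV. sv m x y * Gl i m x y)"
      unfolding Gl_def by (rule sum_contract_swap[symmetric])
    then show ?thesis by (simp add: mult.commute)
  qed
  have 2: "(\<Sum>l\<in>UNIV. (\<Sum>m\<in>UNIV. Su i m x * Gl m l x y) * y $ l) = (\<Sum>m\<in>UNIV. Gy m x y * Su i m x)"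
  proof -
    have "(\<Sum>l\<in>UNIV. (\<Sum>m\<in>UNIV. Su i m x * Gl m l x y) * y $ l) = (\<Sum>m\<in>UNIV. Su i m x * (\<Sum>l\<in>UNIV. Gl m l x y * y $ l))"
      by (rule sum_contract_swap[symmetric])
    then show ?thesis by (simp add: Gy_Gl mult.commute)
  qed
  show ?thesis
    unfolding DS_contract(2)[OF x] distrib_right left_diff_distrib sum.distrib sum_subtractf 1 2
    by (simp add: mult.commute)
qed

section \<open>Spray curvature for a Killing field\<close>

definition SS :: "'n \<Rightarrow> 'n \<Rightarrow> real^'n \<Rightarrow> real" where "SS a l x = (\<Sum>r\<in>UNIV. cov a r x * Su r l x)"

context
  assumes kill: "\<forall>x\<in>U. killing_at x"
begin

lemma cov_skew: "x \<in> U \<Longrightarrow> cov i j x = - cov j i x"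
  using bspec[OF kill, of x] unfolding killing_at_def by (metis add_eq_0_iff)

lemma Sl_cov: "x \<in> U \<Longrightarrow> Sl i j x = cov i j x"
  using Sl_killing kill by blast

lemma Su_w0: assumes x: "x \<in> U" shows "(\<Sum>i\<in>UNIV. w x $ i * Su i j x) = 0"
  by (simp add: Su_w[OF x] Sl_cov[OF x] Wu_cov[OF x])

lemma Su_Wu: assumes x: "x \<in> U" shows "(\<Sum>r\<in>UNIV. Su i r x * Wu r x) = 0"
proof -
  have 0: "(\<Sum>r\<in>UNIV. cov m r x * Wu r x) = 0" for m
  proof -
    have "(\<Sum>r\<in>UNIV. cov m r x * Wu r x) = - (\<Sum>r\<in>UNIV. Wu r x * cov r m x)"
      unfolding sum_negf[symmetric] by (intro sum.cong refl, subst cov_skew[OF x]) simp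
    then show ?thesis by (simp add: Wu_cov[OF x])
  qed
  have "(\<Sum>r\<in>UNIV. Su i r x * Wu r x) = (\<Sum>m\<in>UNIV. hi i m x * (\<Sum>r\<in>UNIV. cov m r x * Wu r x))"
    unfolding Su_def Sl_cov[OF x] by (rule sum_contract_swap[symmetric])
  then show ?thesis by (simp add: 0)
qed

lemma S0_0: assumes x: "x \<in> U" shows "S0 x y = 0"
  unfolding S0_def sv_def sum_contract_swap by (simp add: Su_w0[OF x])

lemma R00_0: assumes x: "x \<in> U" shows "R00 x y = 0"
  using bspec[OF kill x] by (simp add: R00_def Rl_def killing_at_def)

text \<open>\<open>R00\<close> vanishes by the Killing equation, and \<open>S0\<close> because, in
  addition, \<open>W\<close> has constant length.\<close>

lemma Gk_killing: assumes D: "(x, y) \<in> Dom" shows "Gk i x y = Gy i x y / 2 - Fk x y * sv i x y"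
  using Dom_pos(1)[OF D] by (simp add: Gk_def qv_def mu_def R00_0 S0_0 field_simps)

lemma Fl_sv: assumes D: "(x, y) \<in> Dom" shows "(\<Sum>r\<in>UNIV. Fl r x y * sv r x y) = 0"
proof -
  note P = Dom_pos[OF D]
  show ?thesis unfolding Fl_contract low_sv[OF P(1)] S0_def[symmetric] S0_0[OF P(1)] by simp
qed

text \<open>The horizontal derivative of \<open>F\<close> vanishes. The nonlinear connection of the
  spray differs from \<open>Gl - F * Su\<close> by a multiple of \<open>sv\<close>, which drops out
  by \<open>Fl_sv\<close>.\<close>

lemma Fl_Gl:
  assumes D: "(x, y) \<in> Dom"
  shows "dF l x y - (\<Sum>r\<in>UNIV. Fl r x y * Gl r l x y) + Fk x y * (\<Sum>r\<in>UNIV. Fl r x y * Su r l x) = 0"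
proof -
  note P = Dom_pos[OF D]
  have 1: "(\<Sum>r\<in>UNIV. low x y r * Su r l x) = (\<Sum>i\<in>UNIV. y $ i * cov i l x)"
  proof -
    have "(\<Sum>i\<in>UNIV. y $ i * cov i l x) = (\<Sum>i\<in>UNIV. y $ i * (\<Sum>r\<in>UNIV. H i r x * Su r l x))"
      by (simp add: H_Su[OF P(1)] Sl_cov[OF P(1)])
    then show ?thesis unfolding sum_contract_swap low_alt[OF P(1)] by simp
  qed
  have w: "(\<Sum>r\<in>UNIV. w x $ r * Gl r l x y) = dB l x y - (\<Sum>i\<in>UNIV. y $ i * cov i l x)"
    using w_Gl[OF P(1), of l y] by simp
  show ?thesis
    unfolding Fl_contract low_Gl[OF P(1)] w 1 Su_w0[OF P(1)] dF_def using P(2) by (simp add: field_simps)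
qed

text \<open>Derivatives of \<open>F\<close> that are not covariant are eliminated by
  \<open>k1\<close> to \<open>k4\<close>: orthogonality to \<open>sv\<close>, constancy along the
  spray, the Euler-Lagrange equation, and horizontal constancy. The rest assembles into covariant
  terms.\<close>

lemma spray_curv_killing:
  assumes D: "(x, y) \<in> Dom"
  shows "spray_curv Gk i l x y = (\<Sum>k\<in>UNIV. \<Sum>j\<in>UNIV. riem h i k l j x * y $ k * y $ j)
    + Fk x y * ((\<Sum>k\<in>UNIV. DS i l k x * y $ k) - 2 * (\<Sum>j\<in>UNIV. DS i j l x * y $ j))
    + Fl l x y * (\<Sum>l\<in>UNIV. (\<Sum>j\<in>UNIV. DS i j l x * y $ j) * y $ l)
    + Fk x y * Fl l x y * (\<Sum>r\<in>UNIV. Su i r x * sv r x y)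
    - (Fk x y)\<^sup>2 * (\<Sum>r\<in>UNIV. Su i r x * Su r l x)" (is "_ = ?R")
proof -
  note P = Dom_pos[OF D]
  let ?G = "\<lambda>i x y. Gy i x y / 2 - Fk x y * sv i x y"
  have Gx: "pdx l (?G i) x y = dG i l x y / 2 - (dF l x y * sv i x y + Fk x y * dS i l x y)"
    by (rule pdx_eqI) (use P in \<open>auto intro!: derivative_eq_intros DX_Gy DX_F[OF D] DX_sv\<close>)
  have Gy: "pdy l (?G i) x y = Gl i l x y - Fl l x y * sv i x y - Fk x y * Su i l x"
    if D: "(x, y) \<in> Dom" for x y i l
    by (rule pdy_eqI)
      (use Dom_pos[OF D] in \<open>auto intro!: derivative_eq_intros DY_Gy DY_F[OF D] DY_sv simp: algebra_simps\<close>)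
  have Gyx: "pdx k (pdy l (?G i)) x y = dGl i l k x y - (dFl l k x y * sv i x y + Fl l x y * dS i k x y)
      - (dF k x y * Su i l x + Fk x y * pd k (Su i l) x)" for k
  proof -
    have "pdx k (pdy l (?G i)) x y = pdx k (\<lambda>x y. Gl i l x y - Fl l x y * sv i x y - Fk x y * Su i l x) x y"
      by (rule pdx_cong[OF slice_open_Dom D Gy])
    also have "\<dots> = dGl i l k x y - (dFl l k x y * sv i x y + Fl l x y * dS i k x y)
      - (dF k x y * Su i l x + Fk x y * pd k (Su i l) x)"
      by (rule pdx_eqI) (use P in \<open>auto intro!: derivative_eq_intros DX_Gl DX_F[OF D] DX_Fl[OF D] DX_sv
        smooth_DERIV[OF smooth_Su] simp: algebra_simps\<close>)
    finally show ?thesis .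
  qed
  have Gyy: "pdy l (pdy r (?G i)) x y = Gm i r l x - (Fll r l x y * sv i x y + Fl r x y * Su i l x) - Fl l x y * Su i r x" for r
  proof -
    have "pdy l (pdy r (?G i)) x y = pdy l (\<lambda>x y. Gl i r x y - Fl r x y * sv i x y - Fk x y * Su i r x) x y"
      by (rule pdy_cong[OF slice_open_Dom D Gy])
    also have "\<dots> = Gm i r l x - (Fll r l x y * sv i x y + Fl r x y * Su i l x) - Fl l x y * Su i r x"
      by (rule pdy_eqI) (auto intro!: derivative_eq_intros DY_Gl DY_F[OF D] DY_Fl[OF D] DY_sv simp: algebra_simps)
    finally show ?thesis .
  qed
  define f fl s g where "f = Fk x y" and "fl = Fl l x y" and "s r = sv r x y" and "g r = Gy r x y" for r
  define S Fr where "S a b = Su a b x" and "Fr r = Fl r x y" for a b r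
  define Frl L where "Frl r = Fll r l x y" and "L a b = Gl a b x y" for r a b
  define M where "M r = Gm i r l x" for r
  have k1: "(Fr \<odot> s) = 0" using Fl_sv[OF D] by (simp add: Fr_def s_def)
  have G2: "(\<Sum>i\<in>UNIV. c i * Gk i x y) = (c \<odot> g) / 2 - f * (c \<odot> s)" for c
    unfolding Gk_killing[OF D] f_def s_def g_def sum_collect
    by (intro sum.cong refl) (simp add: algebra_simps)
  have k2: "(\<Sum>k\<in>UNIV. y $ k * dF k x y) = (Fr \<odot> g)"
    using spray_F[OF D] k1 unfolding G2 Fr_def by (simp add: mult.commute)
  have k3: "(\<Sum>k\<in>UNIV. y $ k * dFl l k x y) = dF l x y + (Frl \<odot> g) - 2 * f * (Frl \<odot> s)"
    using spray_Fl[OF D, of l] unfolding G2 Frl_def Fll_sym[OF P(1), of l] by (simp add: algebra_simps)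
  have k4: "dF l x y = (\<Sum>r\<in>UNIV. Fr r * L r l) - f * (\<Sum>r\<in>UNIV. Fr r * S r l)"
    using Fl_Gl[OF D, of l] by (simp add: Fr_def L_def f_def S_def)
  have s1: "(\<Sum>k\<in>UNIV. y $ k * pdx k (pdy l (?G i)) x y)
     = (\<Sum>k\<in>UNIV. y $ k * dGl i l k x y) - s i * (\<Sum>k\<in>UNIV. y $ k * dFl l k x y) - fl * (\<Sum>k\<in>UNIV. y $ k * dS i k x y)
      - S i l * (\<Sum>k\<in>UNIV. y $ k * dF k x y) - f * (\<Sum>k\<in>UNIV. y $ k * pd k (Su i l) x)"
    unfolding Gyx sum_collect f_def fl_def s_def S_def
    by (intro sum.cong refl) (simp add: algebra_simps)
  have s2: "(\<Sum>r\<in>UNIV. ?G r x y * pdy l (pdy r (?G i)) x y)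
     = ((g \<odot> M) - s i * (Frl \<odot> g) - S i l * (Fr \<odot> g) - fl * (g \<odot> S i)) / 2
      - f * ((s \<odot> M) - s i * (Frl \<odot> s) - S i l * (Fr \<odot> s) - fl * (S i \<odot> s))"
    unfolding Gyy sum_collect
      f_def fl_def s_def S_def g_def Frl_def Fr_def M_def
    by (intro sum.cong refl) (simp add: algebra_simps diff_divide_distrib add_divide_distrib)
  have s3: "(\<Sum>r\<in>UNIV. pdy r (?G i) x y * pdy l (?G r) x y)
     = (\<Sum>r\<in>UNIV. L i r * L r l) - fl * (L i \<odot> s) - f * (\<Sum>r\<in>UNIV. L i r * S r l)
      - s i * ((\<Sum>r\<in>UNIV. Fr r * L r l) - fl * (Fr \<odot> s) - f * (\<Sum>r\<in>UNIV. Fr r * S r l))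
      - f * ((\<Sum>r\<in>UNIV. S i r * L r l) - fl * (S i \<odot> s) - f * (\<Sum>r\<in>UNIV. S i r * S r l))"
    unfolding Gy[OF D] sum_collect
      f_def fl_def s_def S_def Fr_def L_def
    by (intro sum.cong refl) (simp add: algebra_simps)
  have "spray_curv Gk i l x y = spray_curv ?G i l x y"
    by (rule spray_curv_cong[OF slice_open_Dom D]) (rule Gk_killing)
  also have "\<dots> = dG i l x y - 2 * s i * dF l x y - 2 * f * dS i l x y
     - ((\<Sum>k\<in>UNIV. y $ k * dGl i l k x y) - s i * (dF l x y + (Frl \<odot> g) - 2 * f * (Frl \<odot> s))
       - fl * (\<Sum>k\<in>UNIV. y $ k * dS i k x y)
      - S i l * (Fr \<odot> g) - f * (\<Sum>k\<in>UNIV. y $ k * pd k (Su i l) x))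
     + ((g \<odot> M) - s i * (Frl \<odot> g) - S i l * (Fr \<odot> g) - fl * (g \<odot> S i))
      - 2 * f * ((s \<odot> M) - s i * (Frl \<odot> s) - fl * (S i \<odot> s))
     - ((\<Sum>r\<in>UNIV. L i r * L r l) - fl * (L i \<odot> s) - f * (\<Sum>r\<in>UNIV. L i r * S r l)
      - s i * dF l x y
      - f * ((\<Sum>r\<in>UNIV. S i r * L r l) - fl * (S i \<odot> s) - f * (\<Sum>r\<in>UNIV. S i r * S r l)))"
    unfolding spray_curv_def s1 s2 s3 Gx k1 k2 k3 unfolding k4 f_def[symmetric] s_def[symmetric]
    by (simp add: algebra_simps diff_divide_distrib add_divide_distrib)
  also have "\<dots> = ?R"
    unfolding riem_y_y[OF P(1)] DS_contract2[OF P(1)] unfolding DS_contract[OF P(1)]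
      f_def[symmetric] fl_def[symmetric] s_def[symmetric] S_def[symmetric] g_def[symmetric] M_def[symmetric] L_def[symmetric]
    by (simp add: algebra_simps power2_eq_square)
  finally show ?thesis .
qed

lemma lower_spray_curv:
  assumes D: "(x, y) \<in> Dom"
  shows "(\<Sum>i\<in>UNIV. H a i x * spray_curv Gk i l x y) = Jac a l x y
    + Fk x y * ((\<Sum>k\<in>UNIV. ddw a l k x * y $ k) - 2 * (\<Sum>j\<in>UNIV. ddw a j l x * y $ j))
    + Fl l x y * (\<Sum>l\<in>UNIV. (\<Sum>j\<in>UNIV. ddw a j l x * y $ j) * y $ l)
    + Fk x y * Fl l x y * (\<Sum>l\<in>UNIV. SS a l x * y $ l)
    - (Fk x y)\<^sup>2 * SS a l x"
proof -
  note P = Dom_pos[OF D]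
  have DS: "(\<Sum>i\<in>UNIV. H a i x * DS i l k x) = ddw a l k x" for l k
    unfolding DS_def by (rule lower_DSu[OF kill P(1)])
  have HS: "(\<Sum>i\<in>UNIV. H a i x * Su i j x) = cov a j x" for j
    using H_Su[OF P(1)] Sl_cov[OF P(1)] by simp
  have 1: "(\<Sum>i\<in>UNIV. H a i x * (\<Sum>k\<in>UNIV. \<Sum>j\<in>UNIV. riem h i k l j x * y $ k * y $ j)) = Jac a l x y"
  proof -
    have "(\<Sum>i\<in>UNIV. H a i x * (\<Sum>k\<in>UNIV. \<Sum>j\<in>UNIV. riem h i k l j x * y $ k * y $ j))
      = (\<Sum>i\<in>UNIV. \<Sum>k\<in>UNIV. \<Sum>j\<in>UNIV. H a i x * riem h i k l j x * y $ k * y $ j)"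
      by (simp add: sum_distrib_left mult_ac)
    also have "\<dots> = (\<Sum>k\<in>UNIV. \<Sum>j\<in>UNIV. \<Sum>i\<in>UNIV. H a i x * riem h i k l j x * y $ k * y $ j)"
      by (rule sum3_rotate)
    finally show ?thesis unfolding Jac_def Rm_def by (simp add: sum_distrib_right)
  qed
  have 2: "(\<Sum>i\<in>UNIV. H a i x * (\<Sum>k\<in>UNIV. DS i l k x * y $ k)) = (\<Sum>k\<in>UNIV. ddw a l k x * y $ k)"
    unfolding sum_contract_swap DS ..
  have 3: "(\<Sum>i\<in>UNIV. H a i x * (\<Sum>j\<in>UNIV. DS i j l x * y $ j)) = (\<Sum>j\<in>UNIV. ddw a j l x * y $ j)" for l
    unfolding sum_contract_swap DS ..
  have 4: "(\<Sum>i\<in>UNIV. H a i x * (\<Sum>l\<in>UNIV. (\<Sum>j\<in>UNIV. DS i j l x * y $ j) * y $ l))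
     = (\<Sum>l\<in>UNIV. (\<Sum>j\<in>UNIV. ddw a j l x * y $ j) * y $ l)"
    by (subst sum_contract_swap) (simp only: 3)
  have 5: "(\<Sum>i\<in>UNIV. H a i x * (\<Sum>r\<in>UNIV. Su i r x * Su r l x)) = SS a l x"
    unfolding sum_contract_swap HS SS_def ..
  have 6: "(\<Sum>i\<in>UNIV. H a i x * (\<Sum>r\<in>UNIV. Su i r x * sv r x y)) = (\<Sum>l\<in>UNIV. SS a l x * y $ l)"
    by (subst sum_contract_swap) (simp only: HS sv_def SS_def sum_contract_swap)
  have linear: "(\<Sum>i\<in>UNIV. c i * (p i + f * (q i - 2 * r i) + g * s i + f * g * t i - f\<^sup>2 * u i))
    = (c \<odot> p) + f * ((c \<odot> q) - 2 * (c \<odot> r)) + g * (c \<odot> s)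
      + f * g * (c \<odot> t) - f\<^sup>2 * (c \<odot> u)"
    for c p q r s t u :: "'n \<Rightarrow> real" and f g
    unfolding sum_collect
    by (intro sum.cong refl) (simp add: algebra_simps)
  have "(\<Sum>i\<in>UNIV. H a i x * spray_curv Gk i l x y) =
     (\<Sum>i\<in>UNIV. H a i x * (\<Sum>k\<in>UNIV. \<Sum>j\<in>UNIV. riem h i k l j x * y $ k * y $ j))
    + Fk x y * ((\<Sum>i\<in>UNIV. H a i x * (\<Sum>k\<in>UNIV. DS i l k x * y $ k)) - 2 * (\<Sum>i\<in>UNIV. H a i x * (\<Sum>j\<in>UNIV. DS i j l x * y $ j)))
    + Fl l x y * (\<Sum>i\<in>UNIV. H a i x * (\<Sum>l\<in>UNIV. (\<Sum>j\<in>UNIV. DS i j l x * y $ j) * y $ l))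
    + Fk x y * Fl l x y * (\<Sum>i\<in>UNIV. H a i x * (\<Sum>r\<in>UNIV. Su i r x * sv r x y))
    - (Fk x y)\<^sup>2 * (\<Sum>i\<in>UNIV. H a i x * (\<Sum>r\<in>UNIV. Su i r x * Su r l x))"
    unfolding spray_curv_killing[OF D] by (rule linear)
  then show ?thesis unfolding 1 2 3 4 5 6 .
qed

end

end

section \<open>Killing fields and constant curvature\<close>

text \<open>Carries identities from W(y) > 0 to the boundary W(y) = 0, once they are free of
  denominators.\<close>

lemma continuous_zero_right:
  fixes f :: "real \<Rightarrow> real"
  assumes "continuous_on UNIV f" "\<And>t. t > 0 \<Longrightarrow> f t = 0"
  shows "f 0 = 0"
proof -
  have "isCont f 0" using assms(1) by (simp add: continuous_on_eq_continuous_at)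
  then have "(f \<longlongrightarrow> f 0) (at_right 0)" by (simp add: isCont_def filterlim_at_split)
  moreover have "(f \<longlongrightarrow> 0) (at_right 0)"
    by (rule tendsto_eventually) (auto simp: eventually_at_right_less assms(2) intro: eventually_mono[OF eventually_at_right_less])
  ultimately show ?thesis using tendsto_unique trivial_limit_at_right_real by blast
qed

lemma linear_zero_imp:
  fixes M :: "'n::finite \<Rightarrow> real"
  assumes "\<And>y::real^'n. (\<Sum>l\<in>UNIV. M l * y $ l) = 0"
  shows "M l = 0"
  using assms[of "axis l 1"] by (simp add: axis_def)

section \<open>The curvature equation for a Killing field\<close>

context unit_covector begin

context
  assumes kill: "\<forall>x\<in>U. killing_at x"
begin

lemma SS_Wu: assumes x: "x \<in> U" shows "(\<Sum>l\<in>UNIV. SS a l x * Wu l x) = 0"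
proof -
  have "(\<Sum>l\<in>UNIV. SS a l x * Wu l x) = (\<Sum>r\<in>UNIV. cov a r x * (\<Sum>l\<in>UNIV. Su r l x * Wu l x))"
    unfolding SS_def by (rule sum_contract_swap[symmetric])
  then show ?thesis by (simp add: Su_Wu[OF kill x])
qed

text \<open>\<open>Wu_ddw\<close>, which stems from the unit length, moved to the second index by
  skewness.\<close>

lemma ddw_Wu1: assumes x: "x \<in> U" shows "(\<Sum>j\<in>UNIV. Wu j x * ddw a j l x) = - SS a l x"
proof -
  have "(\<Sum>j\<in>UNIV. Wu j x * ddw a j l x) = - (\<Sum>j\<in>UNIV. Wu j x * ddw j a l x)"
    unfolding sum_negf[symmetric] by (intro sum.cong refl, subst ddw_skew[OF kill x]) simp_all
  also have "\<dots> = (\<Sum>s\<in>UNIV. Su s l x * cov s a x)"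
    by (simp add: Wu_ddw[OF x] Su_killing[OF bspec[OF kill x]])
  also have "\<dots> = - SS a l x"
    unfolding SS_def sum_negf[symmetric]
    by (intro sum.cong refl, subst cov_skew[OF kill x]) simp_all
  finally show ?thesis .
qed

lemma Fl_Wu: assumes D: "(x, y) \<in> Dom" shows "(\<Sum>l\<in>UNIV. Fl l x y * Wu l x) = 1 - Fk x y / bet x y"
  using Dom_pos[OF D] unfolding Fl_contract by (simp add: low_Wu w_Wu field_simps)

text \<open>Serves both directions of the equivalence: once \<open>ddw\<close> and \<open>SS\<close>
  have these values, the defect in the curvature equation of \<open>F\<close> equals the defect in
  that of \<open>h\<close>.\<close>

lemma curvature_algebra:
  assumes D: "(x, y) \<in> Dom"
    and T: "\<And>j l. ddw a j l x = K * (w x $ j * H a l x - w x $ a * H j l x)"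
    and S: "\<And>l. SS a l x = - K * (H a l x - w x $ a * w x $ l)"
  shows "(\<Sum>i\<in>UNIV. H a i x * spray_curv Gk i l x y) = Jac a l x y
      - K * (g2 x y y * H a l x - low x y a * low x y l)
      + (K * (Fk x y)\<^sup>2 * H a l x - K * Fk x y * low x y a * Fl l x y)"
proof -
  note P = Dom_pos[OF D]
  have low_l: "(\<Sum>j\<in>UNIV. H j l x * y $ j) = low x y l" for l
    by (simp add: low_def h_sym[OF P(1), of l])
  have T1: "(\<Sum>k\<in>UNIV. ddw a l k x * y $ k) = K * (w x $ l * low x y a - w x $ a * low x y l)"
    unfolding T low_def sum_collect
    by (intro sum.cong refl) (simp add: algebra_simps)
  have T2: "(\<Sum>j\<in>UNIV. ddw a j l x * y $ j) = K * (bet x y * H a l x - w x $ a * low x y l)" for l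
    unfolding T low_l[symmetric] bet_def sum_collect
    by (intro sum.cong refl) (simp add: algebra_simps)
  have T3: "(\<Sum>l\<in>UNIV. (\<Sum>j\<in>UNIV. ddw a j l x * y $ j) * y $ l) = K * (bet x y * low x y a - w x $ a * g2 x y y)"
    unfolding T2 low_def[of _ _ a] g2_def sum_collect
    by (intro sum.cong refl) (simp add: algebra_simps)
  have S1: "(\<Sum>l\<in>UNIV. SS a l x * y $ l) = - K * (low x y a - w x $ a * bet x y)"
    unfolding S low_def bet_def sum_collect
    by (intro sum.cong refl) (simp add: algebra_simps)
  \<comment> \<open>The definition of \<open>Fl\<close> solved for \<open>low x y l\<close>, which
    is thereby eliminated.\<close>
  have low: "low x y l = bet x y * Fl l x y + Fk x y * w x $ l" using P by (simp add: Fl_def)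
  show ?thesis
    unfolding lower_spray_curv[OF kill D] T3 S1 unfolding T2 T1 S P(6) low by (simp add: algebra_simps power2_eq_square)
qed

text \<open>Kostant's formula gives \<open>ddw\<close> from the curvature tensor, and its
  contraction with \<open>W\<close> gives \<open>SS\<close> through \<open>ddw_Wu1\<close>.\<close>

lemma constant_curvature_ddw:
  assumes x: "x \<in> U" and J: "\<And>v s i. Jac s i x v = K * (g2 x v v * H s i x - low x v s * low x v i)"
  shows "ddw a j l x = K * (w x $ j * H a l x - w x $ a * H j l x)"
    and "SS a l x = - K * (H a l x - w x $ a * w x $ l)"
proof -
  have HW: "(\<Sum>s\<in>UNIV. Wu s x * H s j x) = w x $ j" for j
    using H_Wu[OF x, of j] by (simp add: h_sym[OF x, of j] mult.commute)
  show T: "ddw a j l x = K * (w x $ j * H a l x - w x $ a * H j l x)" for a j l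
  proof -
    have "ddw a j l x = (\<Sum>s\<in>UNIV. Wu s x * (K * (H s j x * H l a x - H s a x * H l j x)))"
      using ddw_killing[OF kill x, of a j l] low_w_riem[OF x] Jac_imp_Rm[OF x J] by simp
    also have "\<dots> = K * ((\<Sum>s\<in>UNIV. Wu s x * H s j x) * H l a x - (\<Sum>s\<in>UNIV. Wu s x * H s a x) * H l j x)"
      unfolding sum_collect
      by (intro sum.cong refl) (simp add: algebra_simps)
    finally show ?thesis unfolding HW by (simp add: h_sym[OF x, of l])
  qed
  have "- SS a l x = (\<Sum>j\<in>UNIV. Wu j x * ddw a j l x)" using ddw_Wu1[OF x] by simp
  also have "\<dots> = K * ((\<Sum>j\<in>UNIV. w x $ j * Wu j x) * H a l x - w x $ a * (\<Sum>j\<in>UNIV. Wu j x * H j l x))"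
    unfolding T sum_collect
    by (intro sum.cong refl) (simp add: algebra_simps)
  finally show "SS a l x = - K * (H a l x - w x $ a * w x $ l)"
    unfolding HW w_Wu[OF x] by (simp add: algebra_simps)
qed

lemma curv_const_lowered:
  assumes x: "x \<in> U"
  shows "(\<forall>i l. spray_curv Gk i l x y = cc_rhs K i l x y) \<longleftrightarrow>
    (\<forall>a l. (\<Sum>i\<in>UNIV. H a i x * spray_curv Gk i l x y) = K * (Fk x y)\<^sup>2 * H a l x - K * Fk x y * low x y a * Fl l x y)"
    (is "?L \<longleftrightarrow> ?R")
proof -
  have low: "(\<Sum>i\<in>UNIV. H a i x * (cc_rhs K i l x y))
      = K * (Fk x y)\<^sup>2 * H a l x - K * Fk x y * low x y a * Fl l x y" for a l
  proof -
    have "cc_rhs K i l x y = K * (Fk x y)\<^sup>2 * kron i l - K * Fk x y * Fl l x y * y $ i" for i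
      by (cases "Fk x y = 0") (simp_all add: right_diff_distrib power2_eq_square del: mult_cancel_left)
    then have "(\<Sum>i\<in>UNIV. H a i x * (cc_rhs K i l x y))
      = (\<Sum>i\<in>UNIV. H a i x * (K * (Fk x y)\<^sup>2 * kron i l - K * Fk x y * Fl l x y * y $ i))" by (simp only:)
    also have "\<dots> = K * (Fk x y)\<^sup>2 * (\<Sum>i\<in>UNIV. H a i x * kron i l) - K * Fk x y * Fl l x y * (\<Sum>i\<in>UNIV. H a i x * y $ i)"
      unfolding sum_collect
      by (intro sum.cong refl) (simp only: right_diff_distrib mult_ac)
    finally show ?thesis by (simp add: low_def)
  qed
  show ?thesis
  proof
    assume ?L
    then have "spray_curv Gk i l x y = cc_rhs K i l x y" for i l by blast
    then show ?R by (auto simp only: low)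
  next
    assume R: ?R
    show ?L
    proof (intro allI)
      fix i l
      show "spray_curv Gk i l x y = cc_rhs K i l x y"
        by (rule lower_cancel[OF x, where f="\<lambda>i. spray_curv Gk i l x y"]) (simp only: low R)
    qed
  qed
qed

lemma constant_curvature_imp_curv_const:
  assumes J: "\<And>x v s i. x \<in> U \<Longrightarrow> Jac s i x v = K * (g2 x v v * H s i x - low x v s * low x v i)"
  shows "curv_const K"
  unfolding curv_const_def
proof (intro allI impI)
  fix x y i l assume D: "(x, y) \<in> Dom"
  note x = Dom_pos(1)[OF D]
  have "(\<Sum>i\<in>UNIV. H a i x * spray_curv Gk i l x y) = K * (Fk x y)\<^sup>2 * H a l x - K * Fk x y * low x y a * Fl l x y" for a l
    using curvature_algebra[OF D constant_curvature_ddw[OF x J[OF x]], of a l] J[OF x, of a l y] by simp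
  then show "spray_curv Gk i l x y = cc_rhs K i l x y"
    using curv_const_lowered[OF x] by blast
qed

section \<open>Behaviour at the boundary W(y) = 0\<close>

context
  fixes K :: real and x :: "real^'n"
  assumes C: "curv_const K" and x: "x \<in> U"
begin

text \<open>Contractions of the terms of the curvature equation with \<open>y\<close> or \<open>W\<close>, at the fixed point \<open>x\<close>.\<close>

definition JW :: "'n \<Rightarrow> real^'n \<Rightarrow> real" where "JW a y = (\<Sum>l\<in>UNIV. Wu l x * Jac a l x y)"
definition T00 :: "'n \<Rightarrow> real^'n \<Rightarrow> real" where "T00 a y = (\<Sum>l\<in>UNIV. (\<Sum>j\<in>UNIV. ddw a j l x * y $ j) * y $ l)"
definition TW :: "'n \<Rightarrow> real^'n \<Rightarrow> real"
  where "TW a y = (\<Sum>l\<in>UNIV. Wu l x * ((\<Sum>k\<in>UNIV. ddw a l k x * y $ k) - 2 * (\<Sum>j\<in>UNIV. ddw a j l x * y $ j)))"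
definition SY :: "'n \<Rightarrow> real^'n \<Rightarrow> real" where "SY a y = (\<Sum>l\<in>UNIV. SS a l x * y $ l)"

lemma line_continuous:
  "continuous_on UNIV (\<lambda>t. JW a (y + t *\<^sub>R v))" "continuous_on UNIV (\<lambda>t. T00 a (y + t *\<^sub>R v))"
  "continuous_on UNIV (\<lambda>t. TW a (y + t *\<^sub>R v))" "continuous_on UNIV (\<lambda>t. SY a (y + t *\<^sub>R v))"
  "continuous_on UNIV (\<lambda>t. low x (y + t *\<^sub>R v) a)" "continuous_on UNIV (\<lambda>t. g2 x (y + t *\<^sub>R v) (y + t *\<^sub>R v))"
  "continuous_on UNIV (\<lambda>t. bet x (y + t *\<^sub>R v))" "continuous_on UNIV (\<lambda>t. Jac a l x (y + t *\<^sub>R v))"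
  unfolding JW_def T00_def TW_def SY_def low_def g2_def bet_def Jac_def
    vector_add_component vector_scaleR_component
  by (intro continuous_intros)+

lemma curvature_eq:
  assumes D: "(x, y) \<in> Dom"
  shows "Jac a l x y + Fk x y * ((\<Sum>k\<in>UNIV. ddw a l k x * y $ k) - 2 * (\<Sum>j\<in>UNIV. ddw a j l x * y $ j))
    + Fl l x y * T00 a y + Fk x y * Fl l x y * SY a y - (Fk x y)\<^sup>2 * SS a l x
    = K * (Fk x y)\<^sup>2 * H a l x - K * Fk x y * low x y a * Fl l x y"
proof -
  have "\<forall>i l. spray_curv Gk i l x y = cc_rhs K i l x y"
    using C D by (auto simp: curv_const_def)
  then have "(\<Sum>i\<in>UNIV. H a i x * spray_curv Gk i l x y) = K * (Fk x y)\<^sup>2 * H a l x - K * Fk x y * low x y a * Fl l x y"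
    unfolding curv_const_lowered[OF x] by blast
  then show ?thesis
    unfolding lower_spray_curv[OF kill D] T00_def SY_def .
qed

text \<open>Contraction with \<open>W\<close> removes the term with \<open>SS a l\<close> and turns
  \<open>Fl\<close> into \<open>1 - F / bet\<close>. This exposes the powers of
  \<open>1 / bet\<close>: third order carries \<open>SY\<close> and \<open>K * low\<close>, second
  order \<open>T00\<close> and \<open>w\<close>.\<close>

lemma curvature_eq_W:
  assumes D: "(x, y) \<in> Dom"
  shows "JW a y + Fk x y * TW a y + (1 - Fk x y / bet x y) * T00 a y + Fk x y * (1 - Fk x y / bet x y) * SY a y
    = K * (Fk x y)\<^sup>2 * w x $ a - K * Fk x y * low x y a * (1 - Fk x y / bet x y)"
proof -
  have "JW a y + Fk x y * TW a y + (\<Sum>l\<in>UNIV. Fl l x y * Wu l x) * T00 a y + Fk x y * (\<Sum>l\<in>UNIV. Fl l x y * Wu l x) * SY a y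
     - (Fk x y)\<^sup>2 * (\<Sum>l\<in>UNIV. SS a l x * Wu l x)
     = (\<Sum>l\<in>UNIV. Wu l x * (Jac a l x y + Fk x y * ((\<Sum>k\<in>UNIV. ddw a l k x * y $ k) - 2 * (\<Sum>j\<in>UNIV. ddw a j l x * y $ j))
    + Fl l x y * T00 a y + Fk x y * Fl l x y * SY a y - (Fk x y)\<^sup>2 * SS a l x))"
    unfolding JW_def TW_def sum_distrib_left[of "Fk x y"] sum_distrib_left[of "(Fk x y)\<^sup>2"]
      sum_distrib_right sum.distrib[symmetric] sum_subtractf[symmetric]
    by (intro sum.cong refl) (simp only: distrib_left right_diff_distrib mult_ac)
  also have "\<dots> = K * (Fk x y)\<^sup>2 * (\<Sum>l\<in>UNIV. H a l x * Wu l x) - K * Fk x y * low x y a * (\<Sum>l\<in>UNIV. Fl l x y * Wu l x)"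
    unfolding curvature_eq[OF D] unfolding sum_collect
    by (intro sum.cong refl) (simp add: algebra_simps)
  finally show ?thesis unfolding Fl_Wu[OF D] SS_Wu[OF x] H_Wu[OF x] by simp
qed

lemma line_Dom: "bet x v = 0 \<Longrightarrow> t > 0 \<Longrightarrow> (x, v + t *\<^sub>R Wv x) \<in> Dom"
  by (simp add: Dom_iff x bet_linear bet_Wv)

text \<open>Leading order in \<open>1/\<beta>\<close> as \<open>\<beta>\<close> tends to zero.\<close>

lemma SY_perp:
  assumes v: "bet x v = 0" shows "SY a v = - K * low x v a"
proof (cases "v = 0")
  case True
  then show ?thesis by (simp add: SY_def low_def)
next
  case False
  define Y where "Y t = v + t *\<^sub>R Wv x" for t
  \<comment> \<open>\<open>curvature_eq_W\<close> times \<open>4 * bet^3\<close>, with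
    \<open>F\<close> written as \<open>g2 x y y / (2 * bet)\<close>: a polynomial expression that
    remains meaningful at \<open>t = 0\<close>, where \<open>bet\<close> is zero.\<close>
  define f where "f t = 4 * (bet x (Y t))^3 * JW a (Y t) + 2 * g2 x (Y t) (Y t) * (bet x (Y t))\<^sup>2 * TW a (Y t)
    + (4 * (bet x (Y t))^3 - 2 * g2 x (Y t) (Y t) * bet x (Y t)) * T00 a (Y t)
    + (2 * g2 x (Y t) (Y t) * (bet x (Y t))\<^sup>2 - (g2 x (Y t) (Y t))\<^sup>2) * (SY a (Y t) + K * low x (Y t) a)
    - K * (g2 x (Y t) (Y t))\<^sup>2 * bet x (Y t) * w x $ a" for t
  have "f 0 = 0"
  proof (rule continuous_zero_right)
    show "continuous_on UNIV f" unfolding f_def Y_def by (intro continuous_intros line_continuous)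
    fix t :: real assume "t > 0"
    then have D: "(x, Y t) \<in> Dom" unfolding Y_def by (rule line_Dom[OF v])
    note P = Dom_pos[OF D]
    have alg: "4 * b^3 * J + 2 * (2 * b * F) * b\<^sup>2 * T + (4 * b^3 - 2 * (2 * b * F) * b) * Z
        + (2 * (2 * b * F) * b\<^sup>2 - (2 * b * F)\<^sup>2) * (S + K * L) - K * (2 * b * F)\<^sup>2 * b * u
      = 4 * b^3 * (J + F * T + (1 - F / b) * Z + F * (1 - F / b) * S - (K * F\<^sup>2 * u - K * F * L * (1 - F / b)))"
      if "b > 0" for b F J T Z S L u :: real
      using that by (simp add: field_simps power2_eq_square power3_eq_cube)
    show "f t = 0" unfolding f_def P(6) alg[OF P(2)] curvature_eq_W[OF D] by simp
  qed
  moreover have "f 0 = - (g2 x v v)\<^sup>2 * (SY a v + K * low x v a)" by (simp add: f_def Y_def v)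
  ultimately show ?thesis using g2_pos[OF x False] by simp
qed

text \<open>\<open>SY_perp\<close> covers the vectors orthogonal to \<open>W\<close>, and
  \<open>SS_Wu\<close> the direction of \<open>W\<close>.\<close>

lemma SS_formula: "SS a l x = - K * (H a l x - w x $ a * w x $ l)"
proof -
  have "(\<Sum>l\<in>UNIV. (SS a l x + K * (H a l x - w x $ a * w x $ l)) * y $ l) = 0" for y
  proof -
    define v where "v = y - bet x y *\<^sub>R Wv x"
    have v: "bet x v = 0" by (simp add: v_def bet_linear bet_Wv x)
    have "SY a v = SY a y - bet x y * (\<Sum>l\<in>UNIV. SS a l x * Wu l x)"
      unfolding SY_def sum_collect
      by (intro sum.cong refl) (simp add: v_def Wv_def algebra_simps)
    then have "SY a y = - K * (low x y a - bet x y * w x $ a)"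
      using SY_perp[OF v, of a] by (simp add: SS_Wu[OF x] v_def low_linear low_Wv[OF x])
    moreover have "(\<Sum>l\<in>UNIV. (SS a l x + K * (H a l x - w x $ a * w x $ l)) * y $ l)
       = SY a y + K * (low x y a - w x $ a * bet x y)"
      unfolding SY_def low_def bet_def sum_collect
      by (intro sum.cong refl) (simp add: algebra_simps)
    ultimately show ?thesis by (simp add: algebra_simps)
  qed
  from linear_zero_imp[of "\<lambda>l. SS a l x + K * (H a l x - w x $ a * w x $ l)", OF this]
  show ?thesis by (simp add: algebra_simps)
qed

lemma SY_formula: "SY a y = - K * (low x y a - bet x y * w x $ a)"
  unfolding SY_def SS_formula low_def bet_def sum_collect
  by (intro sum.cong refl) (simp add: algebra_simps)

text \<open>By \<open>SY_formula\<close>, \<open>SY\<close> and \<open>K * low\<close> add up to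
  \<open>K * bet * w\<close>, so the third order terms drop by one order and the leading order now
  isolates \<open>T00\<close>.\<close>

lemma T00_perp:
  assumes v: "bet x v = 0" shows "T00 a v = - K * g2 x v v * w x $ a"
proof (cases "v = 0")
  case True
  then show ?thesis by (simp add: T00_def g2_def)
next
  case False
  define Y where "Y t = v + t *\<^sub>R Wv x" for t
  \<comment> \<open>The factor that clears the denominators is now \<open>2 * bet^2\<close>.\<close>
  define f where "f t = 2 * (bet x (Y t))\<^sup>2 * JW a (Y t) + g2 x (Y t) (Y t) * bet x (Y t) * TW a (Y t)
    + (2 * (bet x (Y t))\<^sup>2 - g2 x (Y t) (Y t)) * T00 a (Y t)
    + K * w x $ a * (g2 x (Y t) (Y t) * (bet x (Y t))\<^sup>2 - (g2 x (Y t) (Y t))\<^sup>2)" for t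
  have "f 0 = 0"
  proof (rule continuous_zero_right)
    show "continuous_on UNIV f" unfolding f_def Y_def by (intro continuous_intros line_continuous)
    fix t :: real assume "t > 0"
    then have D: "(x, Y t) \<in> Dom" unfolding Y_def by (rule line_Dom[OF v])
    note P = Dom_pos[OF D]
    have alg: "2 * b\<^sup>2 * J + (2 * b * F) * b * T + (2 * b\<^sup>2 - 2 * b * F) * Z
        + K * u * ((2 * b * F) * b\<^sup>2 - (2 * b * F)\<^sup>2)
      = 2 * b\<^sup>2 * (J + F * T + (1 - F / b) * Z + F * (1 - F / b) * (- K * (L - b * u)) - (K * F\<^sup>2 * u - K * F * L * (1 - F / b)))"
      if "b > 0" for b F J T Z L u :: real
      using that by (simp add: field_simps power2_eq_square)
    show "f t = 0" unfolding f_def P(6) alg[OF P(2), of _ _ _ _ _ "low x (Y t) a"]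
      SY_formula[symmetric] curvature_eq_W[OF D] by simp
  qed
  moreover have "f 0 = - (g2 x v v) * (T00 a v + K * g2 x v v * w x $ a)"
    by (simp add: f_def Y_def v power2_eq_square algebra_simps)
  ultimately show ?thesis using g2_pos[OF x False] by simp
qed

text \<open>With \<open>y\<close> split along \<open>W\<close>, the contraction of \<open>W\<close>
  with the second index of \<open>ddw\<close> is known from \<open>ddw_Wu1\<close>, and that with
  the third vanishes by \<open>ddw_killing_W\<close>.\<close>

lemma T00_formula: "T00 a y = K * (bet x y * low x y a - w x $ a * g2 x y y)"
proof -
  define v where "v = y - bet x y *\<^sub>R Wv x"
  have v: "bet x v = 0" by (simp add: v_def bet_linear bet_Wv x)
  have y: "y $ j = v $ j + bet x y * Wu j x" for j by (simp add: v_def Wv_def)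
  have "T00 a y = T00 a v + bet x y * (\<Sum>l\<in>UNIV. (\<Sum>j\<in>UNIV. Wu j x * ddw a j l x) * y $ l)
      + bet x y * (\<Sum>l\<in>UNIV. (\<Sum>j\<in>UNIV. ddw a j l x * v $ j) * Wu l x)"
  proof -
    have "T00 a y = (\<Sum>l\<in>UNIV. (\<Sum>j\<in>UNIV. ddw a j l x * v $ j) * y $ l)
        + bet x y * (\<Sum>l\<in>UNIV. (\<Sum>j\<in>UNIV. Wu j x * ddw a j l x) * y $ l)"
    proof -
      have "(\<Sum>j\<in>UNIV. ddw a j l x * y $ j) = (\<Sum>j\<in>UNIV. ddw a j l x * v $ j) + bet x y * (\<Sum>j\<in>UNIV. Wu j x * ddw a j l x)" for l
        unfolding y sum_distrib_left[of "bet x y"] sum.distrib[symmetric]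
        by (intro sum.cong refl) (simp only: distrib_left mult_ac)
      then show ?thesis
        unfolding T00_def by (simp only: distrib_right sum.distrib mult.assoc sum_distrib_left[symmetric])
    qed
    moreover have "(\<Sum>l\<in>UNIV. (\<Sum>j\<in>UNIV. ddw a j l x * v $ j) * y $ l)
       = T00 a v + bet x y * (\<Sum>l\<in>UNIV. (\<Sum>j\<in>UNIV. ddw a j l x * v $ j) * Wu l x)"
      unfolding T00_def y sum_distrib_left[of "bet x y"] sum.distrib[symmetric]
      by (intro sum.cong refl) (simp only: distrib_left distrib_right mult_ac)
    ultimately show ?thesis by simp
  qed
  also have "(\<Sum>l\<in>UNIV. (\<Sum>j\<in>UNIV. ddw a j l x * v $ j) * Wu l x) = 0"
  proof -
    have "(\<Sum>l\<in>UNIV. (\<Sum>j\<in>UNIV. v $ j * ddw a j l x) * Wu l x) = (\<Sum>j\<in>UNIV. v $ j * (\<Sum>l\<in>UNIV. ddw a j l x * Wu l x))"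
      by (rule sum_contract_swap[symmetric])
    then show ?thesis unfolding ddw_killing_W[OF kill x] by (simp add: mult.commute)
  qed
  also have "(\<Sum>l\<in>UNIV. (\<Sum>j\<in>UNIV. Wu j x * ddw a j l x) * y $ l) = - SY a y"
    unfolding ddw_Wu1[OF x] SY_def by (simp add: sum_negf)
  also have "T00 a v = - K * (g2 x y y - (bet x y)\<^sup>2) * w x $ a"
    unfolding T00_perp[OF v] by (simp add: v_def g2_bilinear g2_Wv x bet_Wv power2_eq_square)
  finally show ?thesis unfolding SY_formula by (simp add: algebra_simps power2_eq_square)
qed

text \<open>\<open>T00\<close> determines only the symmetrisation in \<open>j\<close> and
  \<open>l\<close>, so the difference \<open>E\<close> is skew in them. It is also skew in
  \<open>a\<close> and \<open>j\<close>, hence totally skew, and the cyclic identity gives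
  \<open>3 * E = 0\<close>.\<close>

lemma ddw_formula: "ddw a j l x = K * (w x $ j * H a l x - w x $ a * H j l x)"
proof -
  define E where "E a j l = ddw a j l x - K * (w x $ j * H a l x - w x $ a * H j l x)" for a j l
  have sw: "E a j l + E a l j = 0" for a j l
  proof -
    have "(\<Sum>l\<in>UNIV. \<Sum>j\<in>UNIV. E a j l * y $ l * y $ j) = 0" for y
    proof -
      have "(\<Sum>l\<in>UNIV. \<Sum>j\<in>UNIV. E a j l * y $ l * y $ j)
         = T00 a y - K * ((\<Sum>j\<in>UNIV. w x $ j * y $ j) * (\<Sum>l\<in>UNIV. H a l x * y $ l)
           - w x $ a * (\<Sum>l\<in>UNIV. y $ l * (\<Sum>j\<in>UNIV. H j l x * y $ j)))"
        unfolding T00_def E_def sum_collect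
        by (intro sum.cong refl) (simp add: algebra_simps)
      also have "(\<Sum>l\<in>UNIV. y $ l * (\<Sum>j\<in>UNIV. H j l x * y $ j)) = g2 x y y"
        by (simp add: g2_def low_def h_sym[OF x, of _ _] cong: sum.cong)
      finally show ?thesis unfolding T00_formula low_def[symmetric] bet_def[symmetric] by (simp add: algebra_simps)
    qed
    from quadratic_zero_imp[of "\<lambda>l j. E a j l", OF this] show ?thesis by (simp add: add.commute)
  qed
  have sk: "E a j l = - E j a l" for a j l
    using ddw_skew[OF kill x, of a j l] by (simp add: E_def algebra_simps)
  have "ddw a j l x + ddw j l a x + ddw l a j x = 0"
    unfolding ddw_killing[OF kill x] sum.distrib[symmetric] distrib_right[symmetric]
    by (rule sum.neutral) (use riem_bianchi[OF x, of _ l j a] in \<open>simp add: add_ac\<close>)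
  then have "E a j l + E j l a + E l a j = 0"
    by (simp add: E_def algebra_simps h_sym[OF x, of j a] h_sym[OF x, of l a] h_sym[OF x, of l j])
  moreover have "E j l a = E a j l" using sw[of j l a] sk[of j a l] by linarith
  moreover have "E l a j = E a j l" using sk[of l a j] sw[of a l j] by linarith
  ultimately have "E a j l = 0" by linarith
  then show ?thesis by (simp add: E_def)
qed

text \<open>Both sides are even in \<open>v\<close>, which covers W(v) < 0; the case W(v) = 0 is a
  limit from inside the half space.\<close>

lemma Jac_formula: "Jac s i x v = K * (g2 x v v * H s i x - low x v s * low x v i)"
proof -
  have pos: "Jac s i x y = K * (g2 x y y * H s i x - low x y s * low x y i)" if D: "(x, y) \<in> Dom" for y
  proof -
    have "\<forall>i l. spray_curv Gk i l x y = cc_rhs K i l x y"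
      using C D by (auto simp: curv_const_def)
    then have "(\<Sum>j\<in>UNIV. H s j x * spray_curv Gk j i x y) = K * (Fk x y)\<^sup>2 * H s i x - K * Fk x y * low x y s * Fl i x y"
      unfolding curv_const_lowered[OF x] by blast
    then show ?thesis using curvature_algebra[OF D ddw_formula SS_formula, of s i] by simp
  qed
  have neg: "Jac s i x (- y) = Jac s i x y" "g2 x (- y) (- y) = g2 x y y" "low x (- y) i = - low x y i" for y i
    by (simp_all add: Jac_def g2_def low_def sum_negf)
  consider "bet x v > 0" | "bet x (- v) > 0" | "bet x v = 0"
    by (cases "bet x v" "0::real" rule: linorder_cases) (auto simp: bet_def sum_negf)
  then show ?thesis
  proof cases
    case 1
    then show ?thesis using pos x by (simp add: Dom_iff)
  next
    case 2
    then show ?thesis using pos[of "- v"] x by (simp add: Dom_iff neg)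
  next
    case 3
    define f where "f t = Jac s i x (v + t *\<^sub>R Wv x) - K * (g2 x (v + t *\<^sub>R Wv x) (v + t *\<^sub>R Wv x) * H s i x
      - low x (v + t *\<^sub>R Wv x) s * low x (v + t *\<^sub>R Wv x) i)" for t
    have "f 0 = 0"
    proof (rule continuous_zero_right)
      show "continuous_on UNIV f" unfolding f_def by (intro continuous_intros line_continuous)
      show "f t = 0" if "t > 0" for t using pos[OF line_Dom[OF 3 that]] by (simp add: f_def)
    qed
    then show ?thesis by (simp add: f_def)
  qed
qed

end

end

theorem curv_const_iff:
  "curv_const K \<longleftrightarrow> (\<forall>x\<in>U. killing_at x) \<and>
    (\<forall>x\<in>U. \<forall>u v. u \<noteq> v \<and> independent {u, v} \<longrightarrow> sectional_curvature h x u v = K)"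
proof -
  have "curv_const K \<longleftrightarrow> (\<forall>x\<in>U. killing_at x) \<and>
    (\<forall>x\<in>U. \<forall>v s i. Jac s i x v = K * (g2 x v v * H s i x - low x v s * low x v i))"
    using killing_of_curv_const Jac_formula constant_curvature_imp_curv_const by metis
  then show ?thesis using sectional_iff_Jac by simp
qed

end

section \<open>Kropina spaces\<close>

context unit_covector begin

lemma finsler_constant_curvature_iff:
  assumes F: "\<And>x y. (x, y) \<in> Dom \<Longrightarrow> F x y = Fk x y"
  shows "(\<forall>(x, y)\<in>Dom. \<forall>i l. finsler_curv F i l x y
      = K * (F x y)\<^sup>2 * (kron i l - (y $ i / F x y) * pdy l F x y)) \<longleftrightarrow> curv_const K"
proof -
  have "finsler_curv F i l x y = spray_curv Gk i l x y" if D: "(x, y) \<in> Dom" for i l x y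
    unfolding finsler_curv_spray_curv
    by (rule spray_curv_cong[OF slice_open_Dom D]) (rule spray_eq[OF F])
  moreover have "pdy l F x y = Fl l x y" if D: "(x, y) \<in> Dom" for l x y
  proof -
    have "pdy l F x y = pdy l Fk x y" by (rule pdy_cong[OF slice_open_Dom D F])
    then show ?thesis using pdy_eqI[of Fk x y l, OF DY_F[OF D]] by simp
  qed
  ultimately show ?thesis using F by (auto simp: curv_const_def)
qed

end

section \<open>Passage from a, b to h, W in a chart\<close>

lemma (in local_metric) covector_norm_sq_lower:
  assumes "x \<in> U"
  shows "covector_norm_sq (h x) (h x *v V) = V \<bullet> (h x *v V)"
proof -
  have "covector_norm_sq (h x) (h x *v V) = (\<Sum>i\<in>UNIV. (h x *v V) $ i * (\<Sum>j\<in>UNIV. hi i j x * (h x *v V) $ j))"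
    unfolding covector_norm_sq_def by (simp add: sum_distrib_left mult_ac)
  also have "\<dots> = (\<Sum>i\<in>UNIV. (h x *v V) $ i * V $ i)"
    using hi_H_cancel[OF assms, of _ "\<lambda>m. V $ m"] by (simp add: matrix_vector_mult_def)
  finally show ?thesis by (simp add: inner_vec_def mult.commute)
qed

text \<open>The factor \<open>e\<close> is \<open>e\<^sup>\<kappa>\<close>; it cancels in \<open>\<alpha>\<^sup>2 / \<beta>\<close>, so \<open>F\<close> is the Kropina metric of \<open>h\<close> and \<open>2 W\<close>.\<close>

lemma kropina_chart:
  fixes a h :: "real^'n::finite \<Rightarrow> real^'n^'n" and b W :: "real^'n \<Rightarrow> real^'n"
  assumes a: "local_metric U a" and b: "\<And>i. smooth_fun_on U (\<lambda>x. b x $ i)"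
    and e: "\<And>x. x \<in> U \<Longrightarrow> e x > 0 \<and> e x * covector_norm_sq (a x) (b x) = 4"
    and h: "\<And>x. x \<in> U \<Longrightarrow> h x = e x *\<^sub>R a x"
    and W: "\<And>x. x \<in> U \<Longrightarrow> 2 *\<^sub>R lower_index h W x = e x *\<^sub>R b x"
  shows "x \<in> U \<Longrightarrow> W x \<bullet> (h x *v W x) = 1"
    and "(\<forall>(x, y)\<in>{(x, y). x \<in> U \<and> kropina_beta b x y > 0}. \<forall>i l. finsler_curv (kropina_F a b) i l x y
        = K * (kropina_F a b x y)\<^sup>2 * (kron i l - (y $ i / kropina_F a b x y) * pdy l (kropina_F a b) x y)) \<longleftrightarrow>
      (\<forall>x\<in>U. \<forall>i j. covd h (lower_index h W) i j x + covd h (lower_index h W) j i x = 0) \<and>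
      (\<forall>x\<in>U. \<forall>u v. u \<noteq> v \<and> independent {u, v} \<longrightarrow> sectional_curvature h x u v = K)" (is "?F \<longleftrightarrow> ?R")
proof -
  interpret a: local_metric U a by (rule a)
  have e': "e x = 4 / covector_norm_sq (a x) (b x)" "covector_norm_sq (a x) (b x) \<noteq> 0" if "x \<in> U" for x
  proof -
    show "covector_norm_sq (a x) (b x) \<noteq> 0" using e[OF that] by auto
    then show "e x = 4 / covector_norm_sq (a x) (b x)" using e[OF that] by (simp add: eq_divide_eq)
  qed
  \<comment> \<open>Smoothness of the factor is read off from its expression as a quotient, not from
    a property of \<kappa>.\<close>
  have smooth_e: "smooth_fun_on U e"
  proof (rule smooth_cong[OF a.openU, of "\<lambda>x. 4 / covector_norm_sq (a x) (b x)"])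
    show "smooth_fun_on U (\<lambda>x. 4 / covector_norm_sq (a x) (b x))"
      using e'(2) unfolding covector_norm_sq_def
      by (intro smooth_divide smooth_sum smooth_mult smooth_const a.openU a.smooth_hi b)
  qed (simp add: e'(1))
  have smooth_h: "smooth_fun_on U (\<lambda>x. h x $ i $ j)" for i j
    by (rule smooth_cong[OF a.openU _ smooth_mult[OF a.openU smooth_e a.smooth_h[of i j]]]) (simp add: h)
  have w: "lower_index h W x = (e x / 2) *\<^sub>R b x" if "x \<in> U" for x
  proof -
    have "lower_index h W x = (1 / 2) *\<^sub>R (2 *\<^sub>R lower_index h W x)" by simp
    also have "\<dots> = (e x / 2) *\<^sub>R b x" by (simp add: W[OF that])
    finally show ?thesis .
  qed
  have smooth_w: "smooth_fun_on U (\<lambda>x. lower_index h W x $ i)" for i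
    by (rule smooth_cong[OF a.openU _ smooth_mult[OF a.openU smooth_mult[OF a.openU smooth_const[of U "1/2"] smooth_e] b[of i]]])
      (simp add: w)
  interpret h: local_metric U h
  proof
    show "y \<bullet> (h x *v y) > 0" if "x \<in> U" "y \<noteq> 0" for x y
      using a.h_pos[OF that] e[OF that(1)] by (simp add: h[OF that(1)] scaleR_matrix_vector_assoc[symmetric])
  qed (simp_all add: a.openU smooth_h h a.h_sym)
  show unit: "W x \<bullet> (h x *v W x) = 1" if x: "x \<in> U" for x
  proof -
    \<comment> \<open>\<open>u\<close> is \<open>b\<close> raised with \<open>a\<close>, and
      \<open>W\<close> turns out to be \<open>u / 2\<close>; so |W|^2 is a quarter of e b^2, which
      is 1.\<close>
    define u where "u = matrix_inv (a x) *v b x"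
    have au: "a x *v u = b x"
      by (simp add: u_def matrix_vector_mul_assoc matrix_inv_mult a.h_invertible[OF x])
    have "e x *\<^sub>R (a x *v W x) = e x *\<^sub>R (a x *v ((1 / 2) *\<^sub>R u))"
      using w[OF x] by (simp add: lower_index_def h[OF x] scaleR_matrix_vector_assoc[symmetric] matrix_vector_mult_scaleR au)
    then have "a x *v W x = a x *v ((1 / 2) *\<^sub>R u)" using e[OF x] by simp
    then have "matrix_inv (a x) *v (a x *v W x) = matrix_inv (a x) *v (a x *v ((1 / 2) *\<^sub>R u))" by simp
    then have Wu: "W x = (1 / 2) *\<^sub>R u"
      by (simp add: matrix_vector_mul_assoc matrix_inv_mult a.h_invertible[OF x])
    have "u \<bullet> (a x *v u) = covector_norm_sq (a x) (b x)"
      using a.covector_norm_sq_lower[OF x, of u] by (simp add: au)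
    then show ?thesis
      using e[OF x] by (simp add: Wu h[OF x] scaleR_matrix_vector_assoc[symmetric] matrix_vector_mult_scaleR)
  qed
  interpret h: unit_covector U h "lower_index h W"
  proof
    show "covector_norm_sq (h x) (lower_index h W x) = 1" if "x \<in> U" for x
      using h.covector_norm_sq_lower[OF that, of "W x"] unit[OF that] by (simp add: lower_index_def)
  qed (rule smooth_w)
  have bet: "h.bet x y = e x / 2 * kropina_beta b x y" if "x \<in> U" for x y
    by (simp add: h.bet_def kropina_beta_def w[OF that] sum_distrib_left mult_ac)
  have A: "(\<Sum>i\<in>UNIV. \<Sum>j\<in>UNIV. a x $ i $ j * y $ i * y $ j) = y \<bullet> (a x *v y)" for x y
    by (simp add: inner_vec_def matrix_vector_mult_def sum_distrib_left mult_ac)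
  have Dom: "h.Dom = {(x, y). x \<in> U \<and> kropina_beta b x y > 0}"
  proof -
    have "0 < h.bet x y \<longleftrightarrow> 0 < kropina_beta b x y" if "x \<in> U" for x y
      using e[OF that] by (simp add: bet[OF that] zero_less_mult_iff)
    then show ?thesis by (auto simp: h.Dom_def)
  qed
  have F: "kropina_F a b x y = h.Fk x y" if "(x, y) \<in> h.Dom" for x y
  proof -
    have x: "x \<in> U" using that by (simp add: h.Dom_def)
    have "0 \<le> y \<bullet> (a x *v y)" using a.h_pos[OF x, of y] by (cases "y = 0") auto
    then have "kropina_F a b x y = y \<bullet> (a x *v y) / kropina_beta b x y"
      by (simp add: kropina_F_def kropina_alpha_def A)
    also have "\<dots> = h.Fk x y"
      using e[OF x] by (simp add: h.Fk_def bet[OF x] h.g2_inner h[OF x] scaleR_matrix_vector_assoc[symmetric])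
    finally show ?thesis .
  qed
  have "?F \<longleftrightarrow> h.curv_const K"
    unfolding Dom[symmetric] by (rule h.finsler_constant_curvature_iff) (rule F)
  also have "\<dots> \<longleftrightarrow> ?R" unfolding h.curv_const_iff h.killing_at_def ..
  finally show "?F \<longleftrightarrow> ?R" .
qed

theorem theorem4:
  fixes X :: "'m topology"
    and A :: "('m, 'n::finite) chart set"
    and a h :: "('m, 'n) chart \<Rightarrow> real^'n \<Rightarrow> real^'n^'n"
    and b W :: "('m, 'n) chart \<Rightarrow> real^'n \<Rightarrow> real^'n"
    and \<kappa> :: "'m \<Rightarrow> real"
    and K :: real
  assumes "CARD('n) \<ge> 2"
    and "kropina_space X A a b"
    and "\<And>c p. c \<in> A \<Longrightarrow> p \<in> chart_dom c \<Longrightarrow>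
           exp (\<kappa> p) * covector_norm_sq (a c (coord c p)) (b c (coord c p)) = 4"
    and "\<And>c p. c \<in> A \<Longrightarrow> p \<in> chart_dom c \<Longrightarrow>
           h c (coord c p) = exp (\<kappa> p) *\<^sub>R a c (coord c p)"
    and "\<And>c p. c \<in> A \<Longrightarrow> p \<in> chart_dom c \<Longrightarrow>
           2 *\<^sub>R lower_index (h c) (W c) (coord c p) = exp (\<kappa> p) *\<^sub>R b c (coord c p)"
  shows "(\<forall>c\<in>A. \<forall>x\<in>chart_img c. sqrt (W c x \<bullet> (h c x *v W c x)) = 1) \<and>
         (kropina_constant_curvature A a b K \<longleftrightarrow>
            killing_field A h W \<and> riemannian_constant_curvature A h K)"
proof -
  have metric: "local_metric (chart_img c) (a c)" if "c \<in> A" for c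
  proof (standard, goal_cases)
    case 1
    show ?case using assms(2) that by (auto simp: kropina_space_def smooth_manifold_def)
  next
    case 2
    show ?case using assms(2) that by (auto simp: kropina_space_def riemannian_metric_def)
  next
    case (3 x i j)
    then have "transpose (a c x) = a c x"
      using assms(2) \<open>c \<in> A\<close> unfolding kropina_space_def riemannian_metric_def by blast
    then show ?case by (auto simp: transpose_def vec_eq_iff)
  next
    case (4 x y)
    then show ?case
      using assms(2) \<open>c \<in> A\<close> unfolding kropina_space_def riemannian_metric_def by blast
  qed
  \<comment> \<open>\<kappa> is a function on the manifold; this is its exponential in the
    coordinates of \<open>c\<close>.\<close>
  define e where "e c x = 4 / covector_norm_sq (a c x) (b c x)" for c x
  have e: "e c x > 0 \<and> e c x * covector_norm_sq (a c x) (b c x) = 4 \<and> h c x = e c x *\<^sub>R a c x \<and>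
      2 *\<^sub>R lower_index (h c) (W c) x = e c x *\<^sub>R b c x" if c: "c \<in> A" and x: "x \<in> chart_img c" for c x
  proof -
    obtain p where p: "p \<in> chart_dom c" "x = coord c p" using x by (auto simp: chart_img_def)
    have k: "exp (\<kappa> p) * covector_norm_sq (a c x) (b c x) = 4" using assms(3)[OF c p(1)] p by simp
    then have "covector_norm_sq (a c x) (b c x) \<noteq> 0" by auto
    then have "e c x = exp (\<kappa> p)" using k by (simp add: e_def field_simps)
    then show ?thesis using k assms(4,5)[OF c p(1)] p by simp
  qed
  have smooth_b: "smooth_fun_on (chart_img c) (\<lambda>x. b c x $ i)" if "c \<in> A" for c i
    using assms(2) that by (auto simp: kropina_space_def covector_field_def)
  have unit: "W c x \<bullet> (h c x *v W c x) = 1" if "c \<in> A" "x \<in> chart_img c" for c x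
    by (rule kropina_chart(1)[OF metric smooth_b, of c "e c" "h c" "W c" x]) (use e that in auto)
  have chart: "(\<forall>(x, y)\<in>kropina_domain c (b c). \<forall>i l. finsler_curv (kropina_F (a c) (b c)) i l x y
        = K * (kropina_F (a c) (b c) x y)\<^sup>2 * (kron i l - (y $ i / kropina_F (a c) (b c) x y) * pdy l (kropina_F (a c) (b c)) x y)) \<longleftrightarrow>
      (\<forall>x\<in>chart_img c. \<forall>i j. covd (h c) (lower_index (h c) (W c)) i j x + covd (h c) (lower_index (h c) (W c)) j i x = 0) \<and>
      (\<forall>x\<in>chart_img c. \<forall>u v. u \<noteq> v \<and> independent {u, v} \<longrightarrow> sectional_curvature (h c) x u v = K)"
    if "c \<in> A" for c
    unfolding kropina_domain_def
    by (rule kropina_chart(2)[OF metric smooth_b, of c "e c" "h c" "W c"]) (use e that in auto)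
  show ?thesis
    unfolding kropina_constant_curvature_def finsler_constant_curvature_def killing_field_def
      riemannian_constant_curvature_def
    using unit chart by auto
qed

end
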